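(* Let $m\ge2$ be fixed, and for each $n\ge1$ let $\rho_n\in(-1,1)\setminus\{0\}$ and let $(X_{i1}^{(n)},X_{i2}^{(n)})$, $1\le i\le m$, be independent bivariate Gaussian random vectors with $N(0,1)$ distributed marginals and correlation coefficient $\rho_n$. Let $$\zeta_1^{(n)}=\sum_{i=1}^m(X_{i1}^{(n)})^2,\qquad \zeta_2^{(n)}=\sum_{i=1}^m(X_{i2}^{(n)})^2,$$ and let $H_n(x,y)$ be the joint distribution function of $(\zeta_1^{(n)},\zeta_2^{(n)})$. Put $$a_n=2,\qquad b_n=2\ln n+(m-2)\ln(\ln n)-2\ln\Gamma(m/2),\qquad t_n(x)=a_nx+b_n,$$ and suppose that $$\lim_{n\to\infty}2\,\frac{b_n}{a_n}(1-\rho_n^2)=\lambda\in(0,\infty).$$ Let $\hat h_n(x,y)$ be the probability density function of the distribution function $(x,y)\mapsto(H_n(t_n(x),t_n(y)))^n$. Then $$\lim_{n\to\infty}\hat h_n(x,y)=h_\lambda(x,y)$$ holds for any $x,y\in\mathbb{R}$, where $h_\lambda$ is the density of the bivariate Hüsler-Reiss distribution given in the context.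
   Context: For $\lambda\in(0,\infty)$ the bivariate Hüsler-Reiss max-stable distribution function is $$H_\lambda(x,y)=\exp\left(-e^{-x}\Phi\Big(\frac{\sqrt\lambda}{2}+\frac{y-x}{\sqrt\lambda}\Big)-e^{-y}\Phi\Big(\frac{\sqrt\lambda}{2}+\frac{x-y}{\sqrt\lambda}\Big)\right),\quad x,y\in\mathbb{R},$$ where $\Phi$ is the standard Gaussian distribution function with density $\varphi$. Its probability density function is $$h_\lambda(x,y)=e^{-x}H_\lambda(x,y)\left(\frac{1}{\sqrt\lambda}\varphi\Big(\frac{\sqrt\lambda}{2}+\frac{y-x}{\sqrt\lambda}\Big)+e^{-y}\Phi\Big(\frac{\sqrt\lambda}{2}+\frac{y-x}{\sqrt\lambda}\Big)\Phi\Big(\frac{\sqrt\lambda}{2}+\frac{x-y}{\sqrt\lambda}\Big)\right).$$ $\Gamma(\cdot)$ is the Euler Gamma function. *)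

theory Defs
  imports "HOL-Probability.Probability"
begin

definition correlation :: "'a measure \<Rightarrow> ('a \<Rightarrow> real) \<Rightarrow> ('a \<Rightarrow> real) \<Rightarrow> real" where
  "correlation M X Y =
     (\<integral>\<omega>. (X \<omega> - integral\<^sup>L M X) * (Y \<omega> - integral\<^sup>L M Y) \<partial>M)
     / sqrt ((\<integral>\<omega>. (X \<omega> - integral\<^sup>L M X)\<^sup>2 \<partial>M) * (\<integral>\<omega>. (Y \<omega> - integral\<^sup>L M Y)\<^sup>2 \<partial>M))"

(* A Gaussian vector has the law of an affine image of a pair of independent standard normal
   variables.  Singular covariance matrices are included. *)
definition bivariate_gaussian :: "'a measure \<Rightarrow> ('a \<Rightarrow> real) \<Rightarrow> ('a \<Rightarrow> real) \<Rightarrow> bool" where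
  "bivariate_gaussian M X Y \<longleftrightarrow>
     X \<in> borel_measurable M \<and> Y \<in> borel_measurable M \<and>
     (\<exists>\<mu> \<nu> a b c d :: real.
        distr M (borel \<Otimes>\<^sub>M borel) (\<lambda>\<omega>. (X \<omega>, Y \<omega>)) =
        distr (std_normal_distribution \<Otimes>\<^sub>M std_normal_distribution) (borel \<Otimes>\<^sub>M borel)
          (\<lambda>(z, w). (\<mu> + a * z + b * w, \<nu> + c * z + d * w)))"

definition joint_cdf ::
  "'a measure \<Rightarrow> ('a \<Rightarrow> real) \<Rightarrow> ('a \<Rightarrow> real) \<Rightarrow> real \<Rightarrow> real \<Rightarrow> real" where
  "joint_cdf M U V x y = measure M {\<omega> \<in> space M. U \<omega> \<le> x \<and> V \<omega> \<le> y}"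

definition is_pdf_of :: "(real \<Rightarrow> real \<Rightarrow> real) \<Rightarrow> (real \<Rightarrow> real \<Rightarrow> real) \<Rightarrow> bool" where
  "is_pdf_of h F \<longleftrightarrow>
     (\<lambda>(u, v). h u v) \<in> borel_measurable borel \<and>
     (\<forall>u v. 0 \<le> h u v) \<and>
     (\<forall>x y. set_integrable lborel ({..x} \<times> {..y}) (\<lambda>(u, v). h u v) \<and>
            F x y = set_lebesgue_integral lborel ({..x} \<times> {..y}) (\<lambda>(u, v). h u v))"

definition norm_a :: "nat \<Rightarrow> real" where
  "norm_a n = 2"

definition norm_b :: "nat \<Rightarrow> nat \<Rightarrow> real" where
  "norm_b m n = 2 * ln (real n) + (real m - 2) * ln (ln (real n)) - 2 * ln (Gamma (real m / 2))"

definition norm_t :: "nat \<Rightarrow> nat \<Rightarrow> real \<Rightarrow> real" where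
  "norm_t m n x = norm_a n * x + norm_b m n"

abbreviation std_normal_cdf :: "real \<Rightarrow> real" where
  "std_normal_cdf \<equiv> cdf std_normal_distribution"

definition HR_cdf :: "real \<Rightarrow> real \<Rightarrow> real \<Rightarrow> real" where
  "HR_cdf l x y =
     exp (- exp (- x) * std_normal_cdf (sqrt l / 2 + (y - x) / sqrt l)
          - exp (- y) * std_normal_cdf (sqrt l / 2 + (x - y) / sqrt l))"

definition HR_pdf :: "real \<Rightarrow> real \<Rightarrow> real \<Rightarrow> real" where
  "HR_pdf l x y =
     exp (- x) * HR_cdf l x y *
       (1 / sqrt l * std_normal_density (sqrt l / 2 + (y - x) / sqrt l)
        + exp (- y) * std_normal_cdf (sqrt l / 2 + (y - x) / sqrt l)
                    * std_normal_cdf (sqrt l / 2 + (x - y) / sqrt l))"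

end

theory Submission
  imports Defs
begin

text \<open>
The pair \<open>(\<zeta>1, \<zeta>2)\<close> has an explicit joint density, and the proof is an asymptotic analysis of that
density together with the two integrals of it that enter the density of a maximum.

The density. For a standard normal pair with correlation \<open>\<rho>\<close>, summing the normal density over the four
signs turns \<open>exp (\<rho> x y / (1 - \<rho>\<^sup>2))\<close> into a hyperbolic cosine, and its power series exhibits the law of the
squares as a mixture: draw \<open>k\<close> from a negative binomial law with parameters \<open>1/2\<close> and \<open>\<rho>\<^sup>2\<close>, then take two
independent gamma variables of shape \<open>1/2 + k\<close> and scale \<open>2 (1 - \<rho>\<^sup>2)\<close>. Gamma laws of a common scale
and negative binomial laws are convolution semigroups in their shapes
(\<open>nn_integral_gamma_density_convolution\<close>, \<open>nb_weight_convolution\<close>), hence so are these mixtures, and the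
sum of \<open>m\<close> independent copies is the same mixture with \<open>m/2\<close> in place of \<open>1/2\<close>
(\<open>sum_of_squares_law\<close>). This avoids polar coordinates and noncentral laws. Summing the
mixture gives a closed form with the hypergeometric series
\<open>0F1(a; w) = \<Sum>k. w^k / (k! (a)_k)\<close>, \<open>a = m/2\<close>, which for \<open>m \<ge> 2\<close> is continuous up to the boundary of the
quadrant.

From the distribution function to the density. Write \<open>G\<close> for the distribution function, \<open>A\<close> for its first partial
derivative and \<open>g\<close> for its mixed derivative. A density of \<open>G^n\<close> that is continuous on an open quadrant
equals the mixed derivative there (\<open>continuous_pdf_eq_mixed_derivative\<close>). As \<open>t_n\<close> has slope \<open>2\<close>,
at the point \<open>(u, v) = (t_n(x), t_n(y))\<close> the density is
\<open>G^(n-1) (4 n g) + ((n-1)/n) G^(n-2) (2 n A(u,v)) (2 n A(v,u))\<close>, so three limits suffice.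

The limit of \<open>4 n g\<close>. An Euler integral and dominated convergence give
\<open>0F1(a; z\<^sup>2/4) \<sim> C exp z / z powr (a - 1/2)\<close> (\<open>hyp0F1_asymptotics\<close>). Inserted in the closed form, with
\<open>b_n (1 - \<rho>_n\<^sup>2) \<rightarrow> l\<close> and the exact identity \<open>exponent_identity\<close> for the large cancelling exponents,
this yields the Huesler-Reiss exponent density (\<open>density_lim\<close>).

The limit of \<open>2 n A\<close>. This is the integral of \<open>4 n g\<close> over a half line. The integral over the full line is the
normalised marginal density, which converges to the total mass of the limit, so Scheffe's lemma allows
passing to the limit under the integral (\<open>partial_lim\<close>).

The limit of \<open>G^n\<close>. The exceedance probability \<open>n (1 - G)\<close> is an integral of a marginal density plus an
integral of \<open>2 n A\<close>, and \<open>A\<close> is dominated by the marginal density; dominated convergence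
and the fundamental theorem of calculus produce the exponent of the limit law (\<open>survival_lim\<close>).
\<close>

section \<open>Nonnegative integrals and gamma densities\<close>

definition gamma_density :: "real \<Rightarrow> real \<Rightarrow> real \<Rightarrow> real" where
  "gamma_density \<theta> a t =
     (if 0 < t then t powr (a - 1) * exp (- t / \<theta>) / (\<theta> powr a * Gamma a) else 0)"

lemma gamma_density_nonneg: "0 < a \<Longrightarrow> 0 \<le> gamma_density \<theta> a t"
  by (auto simp: gamma_density_def intro!: divide_nonneg_nonneg mult_nonneg_nonneg Gamma_real_nonneg)

lemma measurable_gamma_density [measurable]: "gamma_density \<theta> a \<in> borel_measurable borel"
  unfolding gamma_density_def[abs_def] by measurable

lemma nn_integral_gamma_density:
  assumes "0 < a" "0 < \<theta>"
  shows "(\<integral>\<^sup>+ t. gamma_density \<theta> a t \<partial>lborel) = 1"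
proof -
  have "(\<integral>\<^sup>+ t. gamma_density \<theta> a t \<partial>lborel) =
      ennreal \<bar>\<theta>\<bar> * (\<integral>\<^sup>+ t. gamma_density \<theta> a (0 + \<theta> * t) \<partial>lborel)"
    using assms by (intro nn_integral_real_affine) auto
  also have "\<dots> = ennreal \<theta> * (\<integral>\<^sup>+ t. ennreal (1 / (\<theta> * Gamma a)) *
      ennreal (indicator {0..} t * t powr (a - 1) / exp t) \<partial>lborel)"
    using assms Gamma_real_pos[OF assms(1), THEN less_imp_neq, THEN not_sym]
    by (intro arg_cong2[where f="(*)"] nn_integral_cong)
       (auto simp: gamma_density_def zero_less_mult_iff powr_mult powr_diff exp_minus field_simps indicator_def
          not_less le_less simp flip: ennreal_mult' intro!: arg_cong[where f=ennreal])
  also have "\<dots> = ennreal \<theta> * (ennreal (1 / (\<theta> * Gamma a)) * ennreal (Gamma a))"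
    using assms by (subst nn_integral_cmult) (auto simp: Gamma_conv_nn_integral_real)
  also have "\<dots> = 1"
    using assms Gamma_real_pos[OF assms(1), THEN less_imp_neq, THEN not_sym] by (simp flip: ennreal_mult)
  finally show ?thesis .
qed

text \<open>The substitution \<open>u = t x\<close> splits off the dependence on \<open>t\<close> and leaves the Beta integral,
whose value cancels the two Gamma factors against that of \<open>a + b\<close>.\<close>
lemma nn_integral_gamma_density_convolution_kernel:
  assumes "0 < a" "0 < b" "0 < \<theta>"
  shows "(\<integral>\<^sup>+ u. gamma_density \<theta> a u * gamma_density \<theta> b (t - u) \<partial>lborel) =
    ennreal (gamma_density \<theta> (a + b) t)"
proof (cases "0 < t")
  case False
  then have "gamma_density \<theta> a u * gamma_density \<theta> b (t - u) = 0" for u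
    by (auto simp: gamma_density_def)
  with False show ?thesis by (simp only:) (simp add: gamma_density_def)
next
  case True
  define c where "c = t powr (a + b - 2) * exp (- t / \<theta>) / (\<theta> powr (a + b) * Gamma a * Gamma b)"
  have c: "0 \<le> c"
    using assms by (auto simp: c_def intro!: divide_nonneg_nonneg mult_nonneg_nonneg Gamma_real_nonneg)
  have G: "Gamma a > 0" "Gamma b > 0" "Gamma (a + b) > 0"
    using assms by (auto intro!: Gamma_real_pos)
  have eq: "gamma_density \<theta> a (0 + t * x) * gamma_density \<theta> b (t - (0 + t * x)) =
      c * (indicator {0<..<1} x * (x powr (a - 1) * (1 - x) powr (b - 1)))" for x
  proof (cases "x \<in> {0<..<1}")
    case False
    then have "t * x \<le> 0 \<or> t - t * x \<le> 0"
      using True by (auto simp: mult_le_0_iff)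
    with False show ?thesis by (auto simp: gamma_density_def)
  next
    case x: True
    have 1: "t - t * x = t * (1 - x)" by (simp add: algebra_simps)
    have 2: "0 < t * (1 - x)" "0 < t * x" using x True by auto
    have 3: "exp (- (t * x) / \<theta>) * exp (- (t * (1 - x)) / \<theta>) = exp (- t / \<theta>)"
      using assms by (simp flip: exp_add add: field_simps)
    have 4: "t powr (a - 1) * t powr (b - 1) = t powr (a + b - 2)"
      by (simp flip: powr_add add: algebra_simps)
    have 5: "\<theta> powr a * \<theta> powr b = \<theta> powr (a + b)"
      by (simp flip: powr_add)
    have "gamma_density \<theta> a (0 + t * x) * gamma_density \<theta> b (t - (0 + t * x)) =
       (t powr (a - 1) * t powr (b - 1)) * (exp (- (t * x) / \<theta>) * exp (- (t * (1 - x)) / \<theta>))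
       / ((\<theta> powr a * \<theta> powr b) * Gamma a * Gamma b) * (x powr (a - 1) * (1 - x) powr (b - 1))"
      using 2 x True by (simp add: gamma_density_def 1 powr_mult mult_ac)
    then show ?thesis using x unfolding 3 4 5 by (simp add: c_def)
  qed
  have beta: "(\<integral>\<^sup>+ x. indicator {0<..<1} x * (x powr (a - 1) * (1 - x) powr (b - 1)) \<partial>lborel) = Beta a b"
  proof (rule nn_integral_has_integral_lebesgue)
    show "((\<lambda>x. x powr (a - 1) * (1 - x) powr (b - 1)) has_integral Beta a b) {0<..<1}"
      using has_integral_Beta_real[of a b] assms by (simp add: has_integral_Icc_iff_Ioo)
  qed auto
  have "(\<integral>\<^sup>+ u. gamma_density \<theta> a u * gamma_density \<theta> b (t - u) \<partial>lborel) =
     ennreal \<bar>t\<bar> * (\<integral>\<^sup>+ x. gamma_density \<theta> a (0 + t * x) * gamma_density \<theta> b (t - (0 + t * x)) \<partial>lborel)"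
    using True by (intro nn_integral_real_affine) auto
  also have "\<dots> = ennreal t * (\<integral>\<^sup>+ x. ennreal c * ennreal (indicator {0<..<1} x * (x powr (a - 1) * (1 - x) powr (b - 1))) \<partial>lborel)"
    unfolding eq using True c by (simp add: ennreal_mult')
  also have "\<dots> = ennreal t * (ennreal c * ennreal (Beta a b))"
    by (subst nn_integral_cmult) (auto simp: beta)
  also have "\<dots> = ennreal (t * (c * Beta a b))"
    using True c G by (simp add: Beta_def ennreal_mult[symmetric] del: times_divide_eq_right)
  also have "t * (c * Beta a b) = gamma_density \<theta> (a + b) t"
  proof -
    have "t * t powr (a + b - 2) = t powr (a + b - 1)"
      using True powr_add[of t 1 "a + b - 2"] by simp
    then show ?thesis
      using True G by (simp add: c_def Beta_def gamma_density_def field_simps)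
  qed
  finally show ?thesis .
qed

lemma nn_integral_gamma_density_convolution:
  fixes f :: "real \<Rightarrow> ennreal"
  assumes [measurable]: "f \<in> borel_measurable borel" and "0 < a" "0 < b" "0 < \<theta>"
  shows "(\<integral>\<^sup>+ u. gamma_density \<theta> a u * (\<integral>\<^sup>+ v. gamma_density \<theta> b v * f (u + v) \<partial>lborel) \<partial>lborel) =
    (\<integral>\<^sup>+ t. gamma_density \<theta> (a + b) t * f t \<partial>lborel)"
proof -
  have shift: "(\<integral>\<^sup>+ v. gamma_density \<theta> b v * f (u + v) \<partial>lborel) =
      (\<integral>\<^sup>+ t. gamma_density \<theta> b (t - u) * f t \<partial>lborel)" for u
    using nn_integral_real_affine[of "\<lambda>t. gamma_density \<theta> b (t - u) * f t" 1 u] by simp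
  have "(\<integral>\<^sup>+ u. gamma_density \<theta> a u * (\<integral>\<^sup>+ v. gamma_density \<theta> b v * f (u + v) \<partial>lborel) \<partial>lborel) =
      (\<integral>\<^sup>+ u. (\<integral>\<^sup>+ t. f t * (gamma_density \<theta> a u * gamma_density \<theta> b (t - u)) \<partial>lborel) \<partial>lborel)"
    unfolding shift
    by (intro nn_integral_cong, subst nn_integral_cmult[symmetric])
       (auto intro!: nn_integral_cong simp: ennreal_mult gamma_density_nonneg assms mult_ac)
  also have "\<dots> = (\<integral>\<^sup>+ t. (\<integral>\<^sup>+ u. f t * (gamma_density \<theta> a u * gamma_density \<theta> b (t - u)) \<partial>lborel) \<partial>lborel)"
    by (rule lborel_pair.Fubini') measurable
  also have "\<dots> = (\<integral>\<^sup>+ t. gamma_density \<theta> (a + b) t * f t \<partial>lborel)"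
    by (intro nn_integral_cong, subst nn_integral_cmult)
       (auto simp: nn_integral_gamma_density_convolution_kernel assms mult.commute)
  finally show ?thesis .
qed

text \<open>Lets a substitution rule for compact intervals be used on a half line.\<close>
lemma nn_integral_SUP_Icc:
  fixes f :: "real \<Rightarrow> ennreal"
  assumes [measurable]: "f \<in> borel_measurable borel" and "\<And>x. x < 0 \<Longrightarrow> f x = 0"
    and "incseq c" "filterlim c at_top sequentially"
  shows "(\<integral>\<^sup>+ x. f x \<partial>lborel) = (SUP n. \<integral>\<^sup>+ x. f x * indicator {0..c n} x \<partial>lborel)"
proof -
  have "(\<integral>\<^sup>+ x. (SUP n. f x * indicator {0..c n} x) \<partial>lborel) =
      (SUP n. \<integral>\<^sup>+ x. f x * indicator {0..c n} x \<partial>lborel)"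
    using assms(3) by (intro nn_integral_monotone_convergence_SUP)
      (auto simp: incseq_def le_fun_def split: split_indicator intro: order_trans)
  moreover have "(SUP n. f x * indicator {0..c n} x) = f x" for x
  proof (cases "x < 0")
    case False
    obtain N where N: "x \<le> c N"
      using assms(4) by (auto simp: filterlim_at_top eventually_sequentially)
    show ?thesis
    proof (rule antisym)
      show "f x \<le> (SUP n. f x * indicator {0..c n} x)"
        using N False by (intro SUP_upper2[where i=N]) auto
      show "(SUP n. f x * indicator {0..c n} x) \<le> f x"
        by (intro SUP_least) (auto split: split_indicator)
    qed
  qed (simp add: assms(2))
  ultimately show ?thesis by simp
qed

lemma nn_integral_sqrt_substitution:
  fixes f :: "real \<Rightarrow> ennreal"
  assumes [measurable]: "f \<in> borel_measurable borel"
  shows "(\<integral>\<^sup>+ x. f x * indicator {0<..} x \<partial>lborel) =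
    (\<integral>\<^sup>+ u. f (sqrt u) * ennreal (1 / (2 * sqrt u)) * indicator {0<..} u \<partial>lborel)"
proof -
  define g where "g u = f (sqrt u) * ennreal (1 / (2 * sqrt u)) * indicator {0<..} u" for u :: real
  have [measurable]: "g \<in> borel_measurable borel" unfolding g_def by measurable
  have c2: "incseq (\<lambda>n. (real (Suc n))\<^sup>2)"
    by (auto simp: incseq_def intro!: power_mono)
  have l1: "filterlim (\<lambda>n. real (Suc n)) at_top sequentially"
    by (rule filterlim_compose[OF filterlim_real_sequentially filterlim_Suc])
  then have l2: "filterlim (\<lambda>n. (real (Suc n))\<^sup>2) at_top sequentially"
    by (intro filterlim_pow_at_top) auto
  have eq: "(\<integral>\<^sup>+ u. g u * indicator {0..(real (Suc n))\<^sup>2} u \<partial>lborel) =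
      (\<integral>\<^sup>+ x. f x * indicator {0<..} x * indicator {0..real (Suc n)} x \<partial>lborel)" for n
  proof -
    have "(\<integral>\<^sup>+ u. g u * indicator {(0::real)\<^sup>2..(real (Suc n))\<^sup>2} u \<partial>lborel) =
       (\<integral>\<^sup>+ x. g (x\<^sup>2) * ennreal (2 * x) * indicator {0..real (Suc n)} x \<partial>lborel)"
      by (intro nn_integral_substitution_aux) (auto intro!: derivative_eq_intros continuous_intros)
    also have "\<dots> = (\<integral>\<^sup>+ x. f x * indicator {0<..} x * indicator {0..real (Suc n)} x \<partial>lborel)"
    proof (intro nn_integral_cong)
      fix x :: real
      have "ennreal (1 / (2 * x)) * ennreal (2 * x) = 1" if "0 < x"
        using that by (simp flip: ennreal_mult)
      then show "g (x\<^sup>2) * ennreal (2 * x) * indicator {0..real (Suc n)} x =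
          f x * indicator {0<..} x * indicator {0..real (Suc n)} x"
        by (cases "0 < x") (auto simp: g_def mult.assoc split: split_indicator)
    qed
    finally show ?thesis by simp
  qed
  have "(\<integral>\<^sup>+ x. f x * indicator {0<..} x \<partial>lborel) =
      (SUP n. \<integral>\<^sup>+ x. f x * indicator {0<..} x * indicator {0..real (Suc n)} x \<partial>lborel)"
    using l1 by (intro nn_integral_SUP_Icc) (auto simp: incseq_def)
  also have "\<dots> = (\<integral>\<^sup>+ u. g u \<partial>lborel)"
    unfolding eq[symmetric] by (intro nn_integral_SUP_Icc[symmetric] c2 l2) (auto simp: g_def)
  finally show ?thesis by (simp add: g_def)
qed

lemma ennreal_suminf_swap:
  fixes f :: "nat \<Rightarrow> nat \<Rightarrow> ennreal"
  shows "(\<Sum>i. \<Sum>j. f i j) = (\<Sum>j. \<Sum>i. f i j)"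
  using nn_integral_suminf[of "\<lambda>j i. f i j" "count_space UNIV"]
  by (simp add: nn_integral_count_space_nat)

text \<open>Cauchy product for a double series whose last factor depends only on the sum of the indices. In the
extended nonnegative reals no summability is at stake, so the mixtures below can be convolved freely.\<close>
lemma ennreal_Cauchy_regroup:
  fixes f g F :: "nat \<Rightarrow> ennreal"
  shows "(\<Sum>i. f i * (\<Sum>j. g j * F (i + j))) = (\<Sum>n. (\<Sum>i\<le>n. f i * g (n - i)) * F n)"
proof -
  have "(\<Sum>j. g j * F (i + j)) = (\<Sum>n. if i \<le> n then g (n - i) * F n else 0)" for i
  proof -
    have "(\<Sum>n. if i \<le> n then g (n - i) * F n else 0) =
        (\<Sum>n. if i \<le> n + i then g (n + i - i) * F (n + i) else 0) +
        (\<Sum>n<i. if i \<le> n then g (n - i) * F n else 0)"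
      by (intro suminf_offset summableI)
    also have "(\<Sum>n<i. if i \<le> n then g (n - i) * F n else 0) = 0"
      by (intro sum.neutral) auto
    finally show ?thesis by (simp add: add.commute)
  qed
  then have "(\<Sum>i. f i * (\<Sum>j. g j * F (i + j))) =
      (\<Sum>i. \<Sum>n. if i \<le> n then f i * g (n - i) * F n else 0)"
    by (simp add: if_distrib mult.assoc cong: if_cong flip: ennreal_suminf_cmult)
  also have "\<dots> = (\<Sum>n. \<Sum>i. if i \<le> n then f i * g (n - i) * F n else 0)"
    by (rule ennreal_suminf_swap)
  also have "\<dots> = (\<Sum>n. (\<Sum>i\<le>n. f i * g (n - i)) * F n)"
  proof (intro suminf_cong)
    fix n
    have "(\<Sum>i. if i \<le> n then f i * g (n - i) * F n else 0) =
        (\<Sum>i\<le>n. if i \<le> n then f i * g (n - i) * F n else 0)"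
      by (rule suminf_finite) auto
    then show "(\<Sum>i. if i \<le> n then f i * g (n - i) * F n else 0) = (\<Sum>i\<le>n. f i * g (n - i)) * F n"
      by (simp add: sum_distrib_right)
  qed
  finally show ?thesis .
qed

section \<open>Negative binomial mixtures of products of gamma laws\<close>

text \<open>The negative binomial probabilities with shape \<open>a\<close> and success probability \<open>1 - r\<close>, for real \<open>a\<close>.\<close>
definition nb_weight :: "real \<Rightarrow> real \<Rightarrow> nat \<Rightarrow> real" where
  "nb_weight a r k = (1 - r) powr a * r ^ k * pochhammer a k / fact k"

text \<open>Expectation of \<open>f\<close> under the mixture described at the top: given the negative binomial index \<open>k\<close>, the two
coordinates are independent gamma variables of shape \<open>a + k\<close>. Treating the law as a functional on nonnegative
functions replaces product measures by iterated integrals.\<close>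
definition gamma_mixture :: "real \<Rightarrow> real \<Rightarrow> (real \<times> real \<Rightarrow> ennreal) \<Rightarrow> ennreal" where
  "gamma_mixture a r f =
     (\<Sum>k. ennreal (nb_weight a r k) *
        (\<integral>\<^sup>+ u. ennreal (gamma_density (2 * (1 - r)) (a + real k) u) *
          (\<integral>\<^sup>+ v. ennreal (gamma_density (2 * (1 - r)) (a + real k) v) * f (u, v) \<partial>lborel) \<partial>lborel))"

lemma nb_weight_nonneg: "0 \<le> r \<Longrightarrow> 0 < a \<Longrightarrow> 0 \<le> nb_weight a r k"
  by (auto simp: nb_weight_def pochhammer_nonneg)

text \<open>The Vandermonde identity for rising factorials: negative binomial laws form a convolution semigroup in the shape.\<close>
lemma nb_weight_convolution:
  assumes "r < 1"
  shows "(\<Sum>i\<le>n. nb_weight a r i * nb_weight b r (n - i)) = nb_weight (a + b) r n"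
proof -
  have "nb_weight a r i * nb_weight b r (n - i) =
      (1 - r) powr (a + b) * r ^ n / fact n * (of_nat (n choose i) * pochhammer a i * pochhammer b (n - i))"
    if "i \<le> n" for i
  proof -
    have "r ^ i * r ^ (n - i) = r ^ n" using that by (simp flip: power_add)
    moreover have "real (n choose i) = fact n / (fact i * fact (n - i))"
      using that by (simp add: binomial_fact)
    ultimately show ?thesis
      using assms by (simp add: nb_weight_def powr_add field_simps)
  qed
  then have "(\<Sum>i\<le>n. nb_weight a r i * nb_weight b r (n - i)) =
      (\<Sum>i\<le>n. (1 - r) powr (a + b) * r ^ n / fact n * (of_nat (n choose i) * pochhammer a i * pochhammer b (n - i)))"
    by (intro sum.cong) auto
  also have "\<dots> = nb_weight (a + b) r n"
    unfolding sum_distrib_left[symmetric] pochhammer_binomial_sum[symmetric] nb_weight_def by simp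
  finally show ?thesis .
qed

text \<open>Two independent coordinates are convolved one after the other; Tonelli moves the integrals of the same
coordinate next to each other.\<close>
lemma gamma_density_pair_convolution:
  fixes f :: "real \<times> real \<Rightarrow> ennreal"
  assumes [measurable]: "f \<in> borel_measurable (borel \<Otimes>\<^sub>M borel)" and pos: "0 < a" "0 < b" "0 < \<theta>"
  shows "(\<integral>\<^sup>+ u. gamma_density \<theta> a u * (\<integral>\<^sup>+ v. gamma_density \<theta> a v *
           (\<integral>\<^sup>+ u'. gamma_density \<theta> b u' * (\<integral>\<^sup>+ v'. gamma_density \<theta> b v' * f (u + u', v + v')
             \<partial>lborel) \<partial>lborel) \<partial>lborel) \<partial>lborel) =
    (\<integral>\<^sup>+ u. gamma_density \<theta> (a + b) u * (\<integral>\<^sup>+ v. gamma_density \<theta> (a + b) v * f (u, v) \<partial>lborel) \<partial>lborel)"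
proof -
  have "(\<integral>\<^sup>+ v. gamma_density \<theta> a v *
           (\<integral>\<^sup>+ u'. gamma_density \<theta> b u' * (\<integral>\<^sup>+ v'. gamma_density \<theta> b v' * f (u + u', v + v')
             \<partial>lborel) \<partial>lborel) \<partial>lborel) =
      (\<integral>\<^sup>+ u'. gamma_density \<theta> b u' * (\<integral>\<^sup>+ v. gamma_density \<theta> (a + b) v * f (u + u', v) \<partial>lborel) \<partial>lborel)"
    (is "?l = ?r") for u
  proof -
    have "?l = (\<integral>\<^sup>+ v. (\<integral>\<^sup>+ u'. gamma_density \<theta> a v * (gamma_density \<theta> b u' *
        (\<integral>\<^sup>+ v'. gamma_density \<theta> b v' * f (u + u', v + v') \<partial>lborel)) \<partial>lborel) \<partial>lborel)"
      by (simp add: nn_integral_cmult)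
    also have "\<dots> = (\<integral>\<^sup>+ u'. (\<integral>\<^sup>+ v. gamma_density \<theta> a v * (gamma_density \<theta> b u' *
        (\<integral>\<^sup>+ v'. gamma_density \<theta> b v' * f (u + u', v + v') \<partial>lborel)) \<partial>lborel) \<partial>lborel)"
      by (rule lborel_pair.Fubini') measurable
    also have "\<dots> = (\<integral>\<^sup>+ u'. gamma_density \<theta> b u' * (\<integral>\<^sup>+ v. gamma_density \<theta> a v *
        (\<integral>\<^sup>+ v'. gamma_density \<theta> b v' * f (u + u', v + v') \<partial>lborel) \<partial>lborel) \<partial>lborel)"
      by (simp add: nn_integral_cmult mult.left_commute[of "ennreal (gamma_density \<theta> a _)"])
    also have "\<dots> = ?r"
      using pos nn_integral_gamma_density_convolution[of "\<lambda>v. f (u + _, v)" a b \<theta>] by simp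
    finally show ?thesis .
  qed
  then show ?thesis
    using pos nn_integral_gamma_density_convolution
      [of "\<lambda>u. \<integral>\<^sup>+ v. gamma_density \<theta> (a + b) v * f (u, v) \<partial>lborel" a b \<theta>] by simp
qed

text \<open>The shapes of the convolved gamma laws are \<open>a + b + (k + j)\<close>, so the double mixture over \<open>(k, j)\<close> only
sees \<open>k + j\<close>, and regrouping leaves the convolution of the two sequences of weights.\<close>
lemma gamma_mixture_convolution:
  fixes f :: "real \<times> real \<Rightarrow> ennreal"
  assumes [measurable]: "f \<in> borel_measurable (borel \<Otimes>\<^sub>M borel)"
    and pos: "0 < a" "0 < b" and r: "0 \<le> r" "r < 1"
  shows "gamma_mixture a r (\<lambda>(u, v). gamma_mixture b r (\<lambda>(u', v'). f (u + u', v + v'))) =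
    gamma_mixture (a + b) r f"
proof -
  define \<theta> where "\<theta> = 2 * (1 - r)"
  have \<theta>: "0 < \<theta>" using r by (simp add: \<theta>_def)
  define F where "F n = (\<integral>\<^sup>+ u. gamma_density \<theta> (a + b + real n) u *
      (\<integral>\<^sup>+ v. gamma_density \<theta> (a + b + real n) v * f (u, v) \<partial>lborel) \<partial>lborel)" for n
  define I where "I k g = (\<integral>\<^sup>+ u. gamma_density \<theta> (a + real k) u *
      (\<integral>\<^sup>+ v. gamma_density \<theta> (a + real k) v * g u v \<partial>lborel) \<partial>lborel)" for k and g :: "real \<Rightarrow> real \<Rightarrow> ennreal"
  define J where "J j u v = (\<integral>\<^sup>+ u'. gamma_density \<theta> (b + real j) u' *
      (\<integral>\<^sup>+ v'. gamma_density \<theta> (b + real j) v' * f (u + u', v + v') \<partial>lborel) \<partial>lborel)" for j u v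
  have J [measurable]: "(\<lambda>p. J j (fst p) (snd p)) \<in> borel_measurable (borel \<Otimes>\<^sub>M borel)" for j
    unfolding J_def by measurable
  have J' [measurable]: "(\<lambda>v. J j u v) \<in> borel_measurable borel" for j u
    unfolding J_def by measurable
  have IJ: "I k (J j) = F (k + j)" for k j
    unfolding I_def J_def F_def
    using gamma_density_pair_convolution[of f "a + real k" "b + real j" \<theta>] pos \<theta>
    by (simp add: algebra_simps)
  have "I k (\<lambda>u v. \<Sum>j. nb_weight b r j * J j u v) = (\<Sum>j. nb_weight b r j * I k (J j))" for k
  proof -
    have "I k (\<lambda>u v. \<Sum>j. nb_weight b r j * J j u v) =
       (\<integral>\<^sup>+ u. (\<integral>\<^sup>+ v. (\<Sum>j. gamma_density \<theta> (a + real k) u * (gamma_density \<theta> (a + real k) v * (nb_weight b r j * J j u v))) \<partial>lborel) \<partial>lborel)"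
      unfolding I_def by (simp add: nn_integral_cmult)
    also have "\<dots> = (\<integral>\<^sup>+ u. (\<Sum>j. \<integral>\<^sup>+ v. gamma_density \<theta> (a + real k) u * (gamma_density \<theta> (a + real k) v * (nb_weight b r j * J j u v)) \<partial>lborel) \<partial>lborel)"
      by (intro nn_integral_cong nn_integral_suminf) measurable
    also have "\<dots> = (\<Sum>j. \<integral>\<^sup>+ u. (\<integral>\<^sup>+ v. gamma_density \<theta> (a + real k) u * (gamma_density \<theta> (a + real k) v * (nb_weight b r j * J j u v)) \<partial>lborel) \<partial>lborel)"
      unfolding J_def by (intro nn_integral_suminf) measurable
    also have "\<dots> = (\<Sum>j. \<integral>\<^sup>+ u. (\<integral>\<^sup>+ v. nb_weight b r j * (gamma_density \<theta> (a + real k) u * (gamma_density \<theta> (a + real k) v * J j u v)) \<partial>lborel) \<partial>lborel)"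
      by (simp add: mult_ac)
    also have "\<dots> = (\<Sum>j. nb_weight b r j * I k (J j))"
      unfolding I_def J_def by (simp add: nn_integral_cmult)
    finally show ?thesis .
  qed
  moreover have "gamma_mixture a r (\<lambda>(u, v). gamma_mixture b r (\<lambda>(u', v'). f (u + u', v + v'))) =
      (\<Sum>k. nb_weight a r k * I k (\<lambda>u v. \<Sum>j. nb_weight b r j * J j u v))"
    by (simp add: gamma_mixture_def I_def J_def \<theta>_def)
  ultimately have "gamma_mixture a r (\<lambda>(u, v). gamma_mixture b r (\<lambda>(u', v'). f (u + u', v + v'))) =
      (\<Sum>k. nb_weight a r k * (\<Sum>j. nb_weight b r j * F (k + j)))"
    by (simp add: IJ)
  also have "\<dots> = (\<Sum>n. (\<Sum>i\<le>n. ennreal (nb_weight a r i) * ennreal (nb_weight b r (n - i))) * F n)"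
    by (rule ennreal_Cauchy_regroup)
  also have "\<dots> = (\<Sum>n. nb_weight (a + b) r n * F n)"
    using pos r by (simp add: ennreal_mult[symmetric] nb_weight_nonneg sum_ennreal nb_weight_convolution)
  also have "\<dots> = gamma_mixture (a + b) r f"
    by (simp add: gamma_mixture_def F_def \<theta>_def)
  finally show ?thesis .
qed

section \<open>Squares of a correlated standard normal pair\<close>

definition binormal_density :: "real \<Rightarrow> real \<times> real \<Rightarrow> real" where
  "binormal_density \<rho> = (\<lambda>(x, y). exp (- (x\<^sup>2 - 2 * \<rho> * x * y + y\<^sup>2) / (2 * (1 - \<rho>\<^sup>2))) / (2 * pi * sqrt (1 - \<rho>\<^sup>2)))"

lemma measurable_binormal_density [measurable]:
  "binormal_density \<rho> \<in> borel_measurable (borel \<Otimes>\<^sub>M borel)"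
  unfolding binormal_density_def by measurable

lemma binormal_density_nonneg: "\<rho>\<^sup>2 < 1 \<Longrightarrow> 0 \<le> binormal_density \<rho> p"
  by (auto simp: binormal_density_def split: prod.split)

lemma nn_integral_square_substitution:
  fixes f :: "real \<Rightarrow> ennreal"
  assumes [measurable]: "f \<in> borel_measurable borel"
  shows "(\<integral>\<^sup>+ x. f x \<partial>lborel) =
    (\<integral>\<^sup>+ u. (f (sqrt u) + f (- sqrt u)) * ennreal (1 / (2 * sqrt u)) * indicator {0<..} u \<partial>lborel)"
proof -
  have "(\<integral>\<^sup>+ x. f x \<partial>lborel) = (\<integral>\<^sup>+ x. f x * indicator {0<..} x + f x * indicator {..<0} x \<partial>lborel)"
  proof (intro nn_integral_cong_AE)
    show "AE x in lborel. f x = f x * indicator {0<..} x + f x * indicator {..<0} x"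
      using AE_lborel_singleton[of "0::real"] by eventually_elim (auto split: split_indicator)
  qed
  also have "\<dots> = (\<integral>\<^sup>+ x. f x * indicator {0<..} x \<partial>lborel) + (\<integral>\<^sup>+ x. f x * indicator {..<0} x \<partial>lborel)"
    by (rule nn_integral_add) auto
  also have "(\<integral>\<^sup>+ x. f x * indicator {..<0} x \<partial>lborel) = (\<integral>\<^sup>+ x. f (- x) * indicator {0<..} x \<partial>lborel)"
    by (subst nn_integral_real_affine[where c="-1" and t=0])
       (auto intro!: nn_integral_cong split: split_indicator)
  also have "(\<integral>\<^sup>+ x. f x * indicator {0<..} x \<partial>lborel) + (\<integral>\<^sup>+ x. f (- x) * indicator {0<..} x \<partial>lborel) =
      (\<integral>\<^sup>+ x. f x * indicator {0<..} x + f (- x) * indicator {0<..} x \<partial>lborel)"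
    by (rule nn_integral_add[symmetric]) auto
  also have "\<dots> = (\<integral>\<^sup>+ x. (f x + f (- x)) * indicator {0<..} x \<partial>lborel)"
    by (simp only: distrib_right)
  also have "\<dots> = (\<integral>\<^sup>+ u. (f (sqrt u) + f (- sqrt u)) * ennreal (1 / (2 * sqrt u)) * indicator {0<..} u \<partial>lborel)"
    by (rule nn_integral_sqrt_substitution) measurable
  finally show ?thesis .
qed

lemma cosh_sums_even: "(\<lambda>k. x ^ (2 * k) / fact (2 * k)) sums cosh (x::real)"
proof -
  have "(\<lambda>k. (\<lambda>n. if even n then x ^ n /\<^sub>R fact n else 0) (2 * k)) sums cosh x"
    using cosh_converges[of x]
    by (subst sums_mono_reindex) (auto simp: strict_mono_def elim!: evenE)
  then show ?thesis by (simp add: field_simps)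
qed

text \<open>By symmetry the four sign choices \<open>(\<plusminus>x, \<plusminus>y)\<close> contribute two equal pairs, hence a multiple of
\<open>cosh (\<rho> x y / (1 - \<rho>\<^sup>2))\<close>. The term of order \<open>2 k\<close> of its power series matches the \<open>k\<close>-th mixture component
because \<open>(2k)! = 4^k k! (1/2)_k\<close> and \<open>Gamma (1/2 + k) = sqrt pi (1/2)_k\<close>.\<close>
lemma binormal_squares_mixture_density:
  fixes u v :: real
  assumes uv: "0 < u" "0 < v" and \<rho>: "\<rho>\<^sup>2 < 1"
  defines "g \<equiv> (\<lambda>k. gamma_density (2 * (1 - \<rho>\<^sup>2)) (1/2 + real k))"
  shows "(\<lambda>k. nb_weight (1/2) (\<rho>\<^sup>2) k * (g k u * g k v)) sums
    ((2 * binormal_density \<rho> (sqrt u, sqrt v) + 2 * binormal_density \<rho> (sqrt u, - sqrt v)) / (4 * sqrt u * sqrt v))"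
proof -
  define s where "s = 1 - \<rho>\<^sup>2"
  have s: "0 < s" using \<rho> by (simp add: s_def)
  define E where "E = exp (- (u + v) / (2 * s))"
  define x where "x = \<rho> * sqrt u * sqrt v / s"
  have p1: "binormal_density \<rho> (sqrt u, sqrt v) = E * exp x / (2 * pi * sqrt s)"
  proof -
    have "- ((sqrt u)\<^sup>2 - 2 * \<rho> * sqrt u * sqrt v + (sqrt v)\<^sup>2) / (2 * s) = - (u + v) / (2 * s) + x"
      using uv s by (simp add: x_def field_simps)
    then show ?thesis unfolding binormal_density_def E_def by (simp add: exp_add s_def)
  qed
  have p2: "binormal_density \<rho> (sqrt u, - sqrt v) = E * exp (- x) / (2 * pi * sqrt s)"
  proof -
    have "- ((sqrt u)\<^sup>2 - 2 * \<rho> * sqrt u * (- sqrt v) + (- sqrt v)\<^sup>2) / (2 * s) = - (u + v) / (2 * s) + - x"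
      using uv s by (simp add: x_def field_simps)
    then show ?thesis unfolding binormal_density_def E_def split s_def[symmetric]
      by (simp only: exp_add)
  qed
  have closed_form: "(2 * binormal_density \<rho> (sqrt u, sqrt v) + 2 * binormal_density \<rho> (sqrt u, - sqrt v)) / (4 * sqrt u * sqrt v)
      = E / (2 * pi * sqrt s * sqrt u * sqrt v) * cosh x"
    unfolding p1 p2 using uv s by (simp add: cosh_def field_simps)
  have "nb_weight (1/2) (\<rho>\<^sup>2) k * (g k u * g k v) =
      E / (2 * pi * sqrt s * sqrt u * sqrt v) * (x ^ (2 * k) / fact (2 * k))" for k
  proof -
    have Gam: "Gamma (1/2 + real k) = sqrt pi * pochhammer (1/2) k"
    proof -
      have "(1/2::real) \<notin> \<int>\<^sub>\<le>\<^sub>0" by (auto elim!: nonpos_Ints_cases)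
      then show ?thesis using pochhammer_Gamma[of "1/2::real" k] by (simp add: Gamma_one_half_real)
    qed
    have pw: "t powr (1/2 + real k - 1) = t ^ k / sqrt t" if "0 < t" for t :: real
    proof -
      have "1/2 + real k - 1 = real k - 1/2" by simp
      then show ?thesis
        using that by (simp only: powr_diff powr_half_sqrt powr_realpow less_imp_le)
    qed
    have pw2: "(2 * s) powr (1/2 + real k) = sqrt (2 * s) * (2 * s) ^ k"
      using s by (simp add: powr_add powr_half_sqrt powr_realpow)
    have P: "pochhammer (1/2) k > (0::real)" by (simp add: pochhammer_pos)
    have e: "exp (- u / (2 * s)) * exp (- v / (2 * s)) = E"
      unfolding E_def exp_add[symmetric] by (simp add: add_divide_distrib diff_divide_distrib)
    have g: "g k t = (t ^ k / sqrt t * exp (- t / (2 * s))) / (sqrt (2 * s) * (2 * s) ^ k * (sqrt pi * pochhammer (1/2) k))"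
      if "0 < t" for t
      using that unfolding g_def gamma_density_def s_def[symmetric] Gam pw2 pw[OF that] by simp
    have "(sqrt (2 * s) * (2 * s) ^ k * (sqrt pi * pochhammer (1/2) k)) * (sqrt (2 * s) * (2 * s) ^ k * (sqrt pi * pochhammer (1/2) k)) =
      (sqrt (2 * s) * sqrt (2 * s)) * ((2 * s) ^ k * (2 * s) ^ k) * ((sqrt pi * sqrt pi) * (pochhammer (1/2) k * pochhammer (1/2) k))"
      by (simp only: mult_ac)
    also have "\<dots> = (2 * s) * (2 * s) ^ (2 * k) * (pi * (pochhammer (1/2) k)\<^sup>2)"
      using s by (simp only: power2_eq_square power_add mult_2[of k] real_sqrt_mult_self abs_of_pos mult_pos_pos pi_gt_zero zero_less_numeral)
    finally have "g k u * g k v = (u ^ k / sqrt u) * (v ^ k / sqrt v) * (exp (- u / (2 * s)) * exp (- v / (2 * s))) /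
        ((2 * s) * (2 * s) ^ (2 * k) * (pi * (pochhammer (1/2) k)\<^sup>2))"
      unfolding g[OF uv(1)] g[OF uv(2)] times_divide_times_eq by (simp add: mult_ac)
    also have "\<dots> = E * (u * v) ^ k / (sqrt u * sqrt v * (2 * s) * (2 * s) ^ (2 * k) * (pi * (pochhammer (1/2) k)\<^sup>2))"
      unfolding e by (simp add: power_mult_distrib mult_ac)
    finally have gg: "g k u * g k v = \<dots>" .
    have nb: "nb_weight (1/2) (\<rho>\<^sup>2) k = sqrt s * \<rho> ^ (2 * k) * pochhammer (1/2) k / fact k"
      unfolding nb_weight_def s_def[symmetric] using s by (simp add: powr_half_sqrt power_mult)
    have x2: "x ^ (2 * k) = \<rho> ^ (2 * k) * (u * v) ^ k / s ^ (2 * k)"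
      unfolding x_def using uv by (simp add: power_mult power_mult_distrib power_divide)
    have ss: "s = sqrt s * sqrt s" using s by simp
    have "nb_weight (1/2) (\<rho>\<^sup>2) k * (g k u * g k v) =
      E / (2 * pi * sqrt s * sqrt u * sqrt v) * (x ^ (2 * k) / (2 ^ (2 * k) * pochhammer (1/2) k * fact k))"
      unfolding gg nb x2 power_mult_distrib[of 2 s] using uv s P
      by (subst (2) ss) (simp add: field_simps power2_eq_square)
    then show ?thesis by (simp add: fact_double)
  qed
  then show ?thesis
    unfolding closed_form by (simp only: sums_mult cosh_sums_even)
qed

lemma nn_integral_binormal_squares:
  fixes f :: "real \<times> real \<Rightarrow> ennreal"
  assumes [measurable]: "f \<in> borel_measurable (borel \<Otimes>\<^sub>M borel)" and \<rho>: "\<rho>\<^sup>2 < 1"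
  shows "(\<integral>\<^sup>+ x. (\<integral>\<^sup>+ y. binormal_density \<rho> (x, y) * f (x\<^sup>2, y\<^sup>2) \<partial>lborel) \<partial>lborel) = gamma_mixture (1/2) (\<rho>\<^sup>2) f"
proof -
  define p where "p = binormal_density \<rho>"
  have [measurable]: "p \<in> borel_measurable (borel \<Otimes>\<^sub>M borel)" by (simp add: p_def)
  have p0: "0 \<le> p z" for z using binormal_density_nonneg[OF \<rho>] by (simp add: p_def)
  have psym: "p (- x, y) = p (x, - y)" "p (- x, - y) = p (x, y)" for x y
    by (simp_all add: p_def binormal_density_def)
  define g where "g = (\<lambda>k. gamma_density (2 * (1 - \<rho>\<^sup>2)) (1/2 + real k))"
  have [measurable]: "g k \<in> borel_measurable borel" for k by (simp add: g_def)
  have g0: "0 \<le> g k u" for k u by (simp add: g_def gamma_density_nonneg)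
  define w where "w = nb_weight (1/2) (\<rho>\<^sup>2)"
  have w0: "0 \<le> w k" for k by (simp add: w_def nb_weight_nonneg)
  define J where "J x = (\<integral>\<^sup>+ y. p (x, y) * f (x\<^sup>2, y\<^sup>2) \<partial>lborel)" for x
  have [measurable]: "J \<in> borel_measurable borel" unfolding J_def by measurable
  have J: "J x = (\<integral>\<^sup>+ v. (ennreal (p (x, sqrt v)) + ennreal (p (x, - sqrt v))) * ennreal (1 / (2 * sqrt v)) * f (x\<^sup>2, v) * indicator {0<..} v \<partial>lborel)" for x
    unfolding J_def by (subst nn_integral_square_substitution)
      (auto intro!: nn_integral_cong split: split_indicator simp: algebra_simps)
  have "(\<integral>\<^sup>+ x. (\<integral>\<^sup>+ y. p (x, y) * f (x\<^sup>2, y\<^sup>2) \<partial>lborel) \<partial>lborel) =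
      (\<integral>\<^sup>+ u. (J (sqrt u) + J (- sqrt u)) * ennreal (1 / (2 * sqrt u)) * indicator {0<..} u \<partial>lborel)"
    unfolding J_def[symmetric] by (rule nn_integral_square_substitution) simp
  also have "\<dots> = (\<integral>\<^sup>+ u. (\<integral>\<^sup>+ v. (\<Sum>k. w k * (g k u * (g k v * f (u, v)))) \<partial>lborel) \<partial>lborel)"
  proof (intro nn_integral_cong)
    fix u :: real
    show "(J (sqrt u) + J (- sqrt u)) * ennreal (1 / (2 * sqrt u)) * indicator {0<..} u =
      (\<integral>\<^sup>+ v. (\<Sum>k. w k * (g k u * (g k v * f (u, v)))) \<partial>lborel)"
    proof (cases "0 < u")
      case False
      then show ?thesis by (simp add: g_def gamma_density_def)
    next
      case u: True
      let ?B = "\<lambda>v. ((ennreal (p (sqrt u, sqrt v)) + ennreal (p (sqrt u, - sqrt v))) * ennreal (1 / (2 * sqrt v)) * f (u, v) * indicator {0<..} v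
           + (ennreal (p (sqrt u, - sqrt v)) + ennreal (p (sqrt u, sqrt v))) * ennreal (1 / (2 * sqrt v)) * f (u, v) * indicator {0<..} v)
           * ennreal (1 / (2 * sqrt u))"
      have "(J (sqrt u) + J (- sqrt u)) * ennreal (1 / (2 * sqrt u)) =
         (\<integral>\<^sup>+ v. ?B v \<partial>lborel)"
        unfolding J using u by (simp add: psym nn_integral_add nn_integral_multc)
      also have "\<dots> = (\<integral>\<^sup>+ v. (\<Sum>k. w k * (g k u * (g k v * f (u, v)))) \<partial>lborel)"
      proof (intro nn_integral_cong)
        fix v :: real
        show "?B v = (\<Sum>k. w k * (g k u * (g k v * f (u, v))))"
        proof (cases "0 < v")
          case False
          then show ?thesis by (simp add: g_def gamma_density_def)
        next
          case v: True
          have distrib: "ennreal (((A + B) * d + (B + A) * d) * c) * F =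
              ((ennreal A + ennreal B) * ennreal d * F + (ennreal B + ennreal A) * ennreal d * F) * ennreal c"
            if "0 \<le> A" "0 \<le> B" "0 \<le> c" "0 \<le> d" for A B c d F
          proof -
            have "((A + B) * d + (B + A) * d) * c = 2 * (A + B) * d * c" by (simp add: algebra_simps)
            then have "ennreal (((A + B) * d + (B + A) * d) * c) = 2 * (ennreal A + ennreal B) * ennreal d * ennreal c"
              using that by (simp only:) (simp add: ennreal_mult)
            then show ?thesis
              by (simp add: add.commute[of "ennreal B"] mult_2[symmetric] mult_ac)
          qed
          have S: "(\<Sum>k. ennreal (w k * (g k u * g k v))) =
              ennreal ((2 * p (sqrt u, sqrt v) + 2 * p (sqrt u, - sqrt v)) / (4 * sqrt u * sqrt v))"
            unfolding w_def g_def p_def using w0 g0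
            by (intro suminf_ennreal_eq binormal_squares_mixture_density u v \<rho>) (auto simp: w_def g_def)
          have "(\<Sum>k. w k * (g k u * (g k v * f (u, v)))) = (\<Sum>k. ennreal (w k * (g k u * g k v)) * f (u, v))"
            by (simp add: ennreal_mult w0 g0 mult.assoc)
          also have "\<dots> = ennreal ((2 * p (sqrt u, sqrt v) + 2 * p (sqrt u, - sqrt v)) / (4 * sqrt u * sqrt v)) * f (u, v)"
            by (simp add: S)
          also have "(2 * p (sqrt u, sqrt v) + 2 * p (sqrt u, - sqrt v)) / (4 * sqrt u * sqrt v) =
             ((p (sqrt u, sqrt v) + p (sqrt u, - sqrt v)) * (1 / (2 * sqrt v)) +
               (p (sqrt u, - sqrt v) + p (sqrt u, sqrt v)) * (1 / (2 * sqrt v))) * (1 / (2 * sqrt u))"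
            using u v by (simp add: field_simps)
          also have "ennreal \<dots> * f (u, v) =
             ((ennreal (p (sqrt u, sqrt v)) + ennreal (p (sqrt u, - sqrt v))) * ennreal (1 / (2 * sqrt v)) * f (u, v)
             + (ennreal (p (sqrt u, - sqrt v)) + ennreal (p (sqrt u, sqrt v))) * ennreal (1 / (2 * sqrt v)) * f (u, v)) * ennreal (1 / (2 * sqrt u))"
            using u v by (intro distrib p0) auto
          finally show ?thesis using v by simp
        qed
      qed
      finally show ?thesis using u by simp
    qed
  qed
  also have "\<dots> = (\<integral>\<^sup>+ u. (\<Sum>k. \<integral>\<^sup>+ v. w k * (g k u * (g k v * f (u, v))) \<partial>lborel) \<partial>lborel)"
    by (intro nn_integral_cong nn_integral_suminf) measurable
  also have "\<dots> = (\<Sum>k. \<integral>\<^sup>+ u. (\<integral>\<^sup>+ v. w k * (g k u * (g k v * f (u, v))) \<partial>lborel) \<partial>lborel)"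
    by (intro nn_integral_suminf) measurable
  also have "\<dots> = gamma_mixture (1/2) (\<rho>\<^sup>2) f"
    by (simp add: gamma_mixture_def w_def g_def nn_integral_cmult)
  finally show ?thesis by (simp add: p_def)
qed

section \<open>The joint law of two correlated sums of squares\<close>

text \<open>The Gram relations make \<open>\<Delta>\<^sup>2 = 1 - \<rho>\<^sup>2\<close>, and the quadratic form of the inverse matrix is that of the
correlated pair.\<close>
lemma std_normal_density_linear_change:
  assumes ab: "a\<^sup>2 + b\<^sup>2 = 1" and cd: "c\<^sup>2 + d\<^sup>2 = 1" and abcd: "a * c + b * d = \<rho>" and \<rho>: "\<rho>\<^sup>2 < 1"
  defines "\<Delta> \<equiv> a * d - b * c"
  shows "\<Delta>\<^sup>2 = 1 - \<rho>\<^sup>2"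
    and "std_normal_density ((d * x - b * y) / \<Delta>) * std_normal_density ((a * y - c * x) / \<Delta>) =
      \<bar>\<Delta>\<bar> * binormal_density \<rho> (x, y)"
proof -
  have "\<Delta>\<^sup>2 + \<rho>\<^sup>2 = (a\<^sup>2 + b\<^sup>2) * (c\<^sup>2 + d\<^sup>2)"
    unfolding \<Delta>_def abcd[symmetric] by (simp add: power2_eq_square algebra_simps)
  then show *: "\<Delta>\<^sup>2 = 1 - \<rho>\<^sup>2" by (simp add: ab cd)
  then have \<Delta>: "\<Delta> \<noteq> 0" using \<rho> by auto
  have D: "\<bar>\<Delta>\<bar> = sqrt (1 - \<rho>\<^sup>2)" using *[symmetric] by simp
  have num: "(d * x - b * y)\<^sup>2 + (a * y - c * x)\<^sup>2 = (c\<^sup>2 + d\<^sup>2) * x\<^sup>2 - 2 * (a * c + b * d) * x * y + (a\<^sup>2 + b\<^sup>2) * y\<^sup>2"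
    by (simp add: power2_eq_square algebra_simps)
  have "((d * x - b * y) / \<Delta>)\<^sup>2 + ((a * y - c * x) / \<Delta>)\<^sup>2 = (x\<^sup>2 - 2 * \<rho> * x * y + y\<^sup>2) / (1 - \<rho>\<^sup>2)"
    unfolding power_divide add_divide_distrib[symmetric] num ab cd abcd * by simp
  then have "- (((d * x - b * y) / \<Delta>)\<^sup>2 + ((a * y - c * x) / \<Delta>)\<^sup>2) / 2 = - (x\<^sup>2 - 2 * \<rho> * x * y + y\<^sup>2) / (2 * (1 - \<rho>\<^sup>2))"
    by (simp only: minus_divide_left divide_divide_eq_left mult.commute)
  then have e: "- ((d * x - b * y) / \<Delta>)\<^sup>2 / 2 + - ((a * y - c * x) / \<Delta>)\<^sup>2 / 2 =
      - (x\<^sup>2 - 2 * \<rho> * x * y + y\<^sup>2) / (2 * (1 - \<rho>\<^sup>2))"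
    by (simp only: minus_add_distrib add_divide_distrib)
  have pi: "sqrt (2 * pi) * sqrt (2 * pi) = 2 * pi" by simp
  have "std_normal_density ((d * x - b * y) / \<Delta>) * std_normal_density ((a * y - c * x) / \<Delta>) =
      1 / (sqrt (2 * pi) * sqrt (2 * pi)) * (exp (- ((d * x - b * y) / \<Delta>)\<^sup>2 / 2) * exp (- ((a * y - c * x) / \<Delta>)\<^sup>2 / 2))"
    unfolding std_normal_density_def by simp
  also have "\<dots> = 1 / (2 * pi) * exp (- (x\<^sup>2 - 2 * \<rho> * x * y + y\<^sup>2) / (2 * (1 - \<rho>\<^sup>2)))"
    unfolding exp_add[symmetric] e pi ..
  also have "\<dots> = \<bar>\<Delta>\<bar> * binormal_density \<rho> (x, y)"
    unfolding D using \<rho> by (simp add: binormal_density_def)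
  finally show "std_normal_density ((d * x - b * y) / \<Delta>) * std_normal_density ((a * y - c * x) / \<Delta>) =
      \<bar>\<Delta>\<bar> * binormal_density \<rho> (x, y)" .
qed

text \<open>Two successive one-dimensional affine substitutions, first in \<open>z\<close> and then in \<open>w\<close>, carry out the linear change
of variables. The first one divides by \<open>a\<close>; if \<open>a = 0\<close> then \<open>b \<noteq> 0\<close> and the roles of \<open>z\<close> and \<open>w\<close> are
exchanged.\<close>
lemma nn_integral_std_normal_linear_image:
  fixes f :: "real \<times> real \<Rightarrow> ennreal"
  assumes [measurable]: "f \<in> borel_measurable (borel \<Otimes>\<^sub>M borel)"
    and ab: "a\<^sup>2 + b\<^sup>2 = 1" and cd: "c\<^sup>2 + d\<^sup>2 = 1" and abcd: "a * c + b * d = \<rho>" and \<rho>: "\<rho>\<^sup>2 < 1"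
  shows "(\<integral>\<^sup>+ z. (\<integral>\<^sup>+ w. ennreal (std_normal_density z * std_normal_density w) * f (a * z + b * w, c * z + d * w) \<partial>lborel) \<partial>lborel) =
    (\<integral>\<^sup>+ x. (\<integral>\<^sup>+ y. ennreal (binormal_density \<rho> (x, y)) * f (x, y) \<partial>lborel) \<partial>lborel)"
proof -
  let ?J = "\<lambda>a b c d z w. ennreal (std_normal_density z * std_normal_density w) * f (a * z + b * w, c * z + d * w)"
  let ?R = "\<integral>\<^sup>+ x. (\<integral>\<^sup>+ y. ennreal (binormal_density \<rho> (x, y)) * f (x, y) \<partial>lborel) \<partial>lborel"
  have main: "(\<integral>\<^sup>+ w. (\<integral>\<^sup>+ z. ?J a b c d z w \<partial>lborel) \<partial>lborel) =
    ?R"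
    if ab: "a\<^sup>2 + b\<^sup>2 = 1" and cd: "c\<^sup>2 + d\<^sup>2 = 1" and abcd: "a * c + b * d = \<rho>" and a: "a \<noteq> 0" for a b c d
  proof -
    define \<Delta> where "\<Delta> = a * d - b * c"
    note lin = std_normal_density_linear_change[OF ab cd abcd \<rho>, folded \<Delta>_def]
    have \<Delta>: "\<Delta> \<noteq> 0" using lin(1) \<rho> by auto
    define n where "n = std_normal_density"
    have [measurable]: "n \<in> borel_measurable borel" by (simp add: n_def)
    let ?M = "\<lambda>x w. ennreal \<bar>1 / a\<bar> * (ennreal (n ((x - b * w) / a) * n w) * f (x, (c * x + \<Delta> * w) / a))"
    let ?P = "\<lambda>x y. ennreal \<bar>1 / a\<bar> * (ennreal (n ((d * x - b * y) / \<Delta>) * n ((a * y - c * x) / \<Delta>)) * f (x, y))"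
    have "(\<integral>\<^sup>+ w. (\<integral>\<^sup>+ z. ennreal (n z * n w) * f (a * z + b * w, c * z + d * w) \<partial>lborel) \<partial>lborel) =
      (\<integral>\<^sup>+ w. (\<integral>\<^sup>+ x. ?M x w \<partial>lborel) \<partial>lborel)"
    proof (rule nn_integral_cong)
      fix w :: real
      have e: "a * ((x - b * w) / a) + b * w = x" "c * ((x - b * w) / a) + d * w = (c * x + \<Delta> * w) / a"
        "- b * w / a + 1 / a * x = (x - b * w) / a" for x
        using a by (auto simp: \<Delta>_def field_simps)
      have "(\<integral>\<^sup>+ z. ennreal (n z * n w) * f (a * z + b * w, c * z + d * w) \<partial>lborel) =
        ennreal \<bar>1 / a\<bar> * (\<integral>\<^sup>+ x. ennreal (n ((x - b * w) / a) * n w) * f (x, (c * x + \<Delta> * w) / a) \<partial>lborel)"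
        using a by (subst nn_integral_real_affine[where c="1/a" and t="- b * w / a"], measurable)
          (simp_all only: e divide_eq_0_iff one_neq_zero simp_thms)
      also have "\<dots> = (\<integral>\<^sup>+ x. ?M x w \<partial>lborel)"
        by (rule nn_integral_cmult[symmetric]) measurable
      finally show "(\<integral>\<^sup>+ z. ennreal (n z * n w) * f (a * z + b * w, c * z + d * w) \<partial>lborel) =
        (\<integral>\<^sup>+ x. ?M x w \<partial>lborel)" .
    qed
    also have "\<dots> = (\<integral>\<^sup>+ x. (\<integral>\<^sup>+ w. ?M x w \<partial>lborel) \<partial>lborel)"
      by (rule lborel_pair.Fubini') measurable
    also have "\<dots> = ?R"
    proof (rule nn_integral_cong)
      fix x :: real
      have e: "(c * x + \<Delta> * ((a * y - c * x) / \<Delta>)) / a = y" "(x - b * ((a * y - c * x) / \<Delta>)) / a = (d * x - b * y) / \<Delta>"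
         "- c * x / \<Delta> + a / \<Delta> * y = (a * y - c * x) / \<Delta>" for y
        using a \<Delta> by (auto simp: field_simps) (auto simp: \<Delta>_def algebra_simps)
      have "(\<integral>\<^sup>+ w. ?M x w \<partial>lborel) =
          ennreal \<bar>a / \<Delta>\<bar> * (\<integral>\<^sup>+ y. ?P x y \<partial>lborel)"
        using a \<Delta> by (subst nn_integral_real_affine[where c="a / \<Delta>" and t="- c * x / \<Delta>"], measurable) (simp_all only: e divide_eq_0_iff simp_thms)
      also have "\<dots> = (\<integral>\<^sup>+ y. ennreal \<bar>a / \<Delta>\<bar> * (?P x y) \<partial>lborel)"
        by (rule nn_integral_cmult[symmetric]) measurable
      also have "\<dots> = (\<integral>\<^sup>+ y. ennreal (binormal_density \<rho> (x, y)) * f (x, y) \<partial>lborel)"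
      proof (rule nn_integral_cong)
        fix y :: real
        have "ennreal \<bar>a / \<Delta>\<bar> * ennreal \<bar>1 / a\<bar> * ennreal (\<bar>\<Delta>\<bar> * binormal_density \<rho> (x, y)) = ennreal (\<bar>a / \<Delta>\<bar> * \<bar>1 / a\<bar> * (\<bar>\<Delta>\<bar> * binormal_density \<rho> (x, y)))"
          using binormal_density_nonneg[OF \<rho>] by (simp only: ennreal_mult abs_ge_zero mult_nonneg_nonneg)
        also have "\<bar>a / \<Delta>\<bar> * \<bar>1 / a\<bar> * (\<bar>\<Delta>\<bar> * binormal_density \<rho> (x, y)) = binormal_density \<rho> (x, y)"
          using a \<Delta> by (simp add: abs_divide)
        finally show "ennreal \<bar>a / \<Delta>\<bar> * (?P x y) =
            ennreal (binormal_density \<rho> (x, y)) * f (x, y)"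
          unfolding n_def lin(2) mult.assoc[symmetric] by (simp only:)
      qed
      finally show "(\<integral>\<^sup>+ w. ?M x w \<partial>lborel) =
          (\<integral>\<^sup>+ y. ennreal (binormal_density \<rho> (x, y)) * f (x, y) \<partial>lborel)" .
    qed
    finally show ?thesis by (simp add: n_def)
  qed
  show ?thesis
  proof (cases "a = 0")
    case False
    have "(\<integral>\<^sup>+ z. (\<integral>\<^sup>+ w. ?J a b c d z w \<partial>lborel) \<partial>lborel) =
      (\<integral>\<^sup>+ w. (\<integral>\<^sup>+ z. ?J a b c d z w \<partial>lborel) \<partial>lborel)"
      by (rule lborel_pair.Fubini') measurable
    with main[OF ab cd abcd False] show ?thesis by simp
  next
    case True
    then have b: "b \<noteq> 0" using ab by auto
    have ab': "b\<^sup>2 + a\<^sup>2 = 1" "d\<^sup>2 + c\<^sup>2 = 1" "b * d + a * c = \<rho>"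
      using ab cd abcd by (simp_all add: add.commute)
    have "(\<integral>\<^sup>+ z. (\<integral>\<^sup>+ w. ?J a b c d z w \<partial>lborel) \<partial>lborel) =
      (\<integral>\<^sup>+ z. (\<integral>\<^sup>+ w. ?J b a d c w z \<partial>lborel) \<partial>lborel)"
      by (intro nn_integral_cong) (simp add: ac_simps)
    then show ?thesis
      unfolding main[OF ab' b] .
  qed
qed

abbreviation "N01 \<equiv> std_normal_distribution"

lemma std_normal_product_integral:
  fixes f g :: "real \<Rightarrow> real"
  assumes f: "integrable N01 f" and g: "integrable N01 g"
  shows "has_bochner_integral (N01 \<Otimes>\<^sub>M N01) (\<lambda>(z, w). f z * g w)
     (integral\<^sup>L N01 f * integral\<^sup>L N01 g)"
proof -
  interpret N: real_distribution N01 by (rule real_dist_normal_dist)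
  interpret P: pair_prob_space N01 N01 ..
  note [measurable] = borel_measurable_integrable[OF f] borel_measurable_integrable[OF g]
  have int: "integrable (N01 \<Otimes>\<^sub>M N01) (\<lambda>(z, w). f z * g w)"
  proof (rule P.Fubini_integrable)
    show "(\<lambda>(z, w). f z * g w) \<in> borel_measurable (N01 \<Otimes>\<^sub>M N01)"
      by measurable
    show "integrable N01 (\<lambda>x. \<integral>y. norm (case (x, y) of (z, w) \<Rightarrow> f z * g w) \<partial>N01)"
      using f by (simp add: abs_mult)
    show "AE x in N01. integrable N01 (\<lambda>y. case (x, y) of (z, w) \<Rightarrow> f z * g w)"
      using g by simp
  qed
  moreover have "integral\<^sup>L (N01 \<Otimes>\<^sub>M N01) (\<lambda>(z, w). f z * g w) =
      integral\<^sup>L N01 f * integral\<^sup>L N01 g"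
    using P.integral_fst'[OF int] by simp
  ultimately show ?thesis by (simp add: has_bochner_integral_iff)
qed


lemma std_normal_bilinear_integral:
  "has_bochner_integral (N01 \<Otimes>\<^sub>M N01)
     (\<lambda>(z, w). (\<alpha> + a * z + b * w) * (\<beta> + c * z + d * w)) (\<alpha> * \<beta> + a * c + b * d)"
proof -
  interpret N: real_distribution N01 by (rule real_dist_normal_dist)
  have i0: "integrable N01 (\<lambda>x. 1 :: real)" "integral\<^sup>L N01 (\<lambda>x. 1 :: real) = 1"
    using N.prob_space by simp_all
  have i1: "integrable N01 (\<lambda>x. x)" "integral\<^sup>L N01 (\<lambda>x. x) = 0"
    using integrable_std_normal_distribution_moment[of 1] integral_std_normal_distribution_moment_odd[of 1] by simp_all
  have i2: "integrable N01 (\<lambda>x. x\<^sup>2)" "integral\<^sup>L N01 (\<lambda>x. x\<^sup>2) = 1"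
    using std_normal_distribution_even_moments[of 1] by (simp_all add: fact_numeral)
  note h = std_normal_product_integral[OF i0(1) i0(1)] std_normal_product_integral[OF i1(1) i0(1)]
    std_normal_product_integral[OF i0(1) i1(1)] std_normal_product_integral[OF i1(1) i1(1)]
    std_normal_product_integral[OF i2(1) i0(1)] std_normal_product_integral[OF i0(1) i2(1)]
  note h = h[unfolded i0(2) i1(2) i2(2) case_prod_beta]
  have "has_bochner_integral (N01 \<Otimes>\<^sub>M N01)
     (\<lambda>p. (\<alpha> * \<beta>) * (1 * 1) + (\<alpha> * c + \<beta> * a) * (fst p * 1) + (\<alpha> * d + \<beta> * b) * (1 * snd p)
        + (a * d + b * c) * (fst p * snd p) + (a * c) * ((fst p)\<^sup>2 * 1) + (b * d) * (1 * (snd p)\<^sup>2))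
     ((\<alpha> * \<beta>) * (1 * 1) + (\<alpha> * c + \<beta> * a) * (0 * 1) + (\<alpha> * d + \<beta> * b) * (1 * 0)
        + (a * d + b * c) * (0 * 0) + (a * c) * (1 * 1) + (b * d) * (1 * 1))"
    by (intro has_bochner_integral_add has_bochner_integral_mult_right h)
  then show ?thesis
    by (rule has_bochner_integral_cong[THEN iffD1, rotated 3])
       (auto simp: power2_eq_square algebra_simps)
qed

text \<open>The law of a Gaussian vector is given only as some affine image of independent standard normals. The
marginals and the correlation force the shift to vanish and the coefficients to satisfy the Gram relations, and by
\<open>nn_integral_std_normal_linear_image\<close> these determine the density.\<close>
lemma gaussian_pair_law:
  fixes f :: "real \<times> real \<Rightarrow> ennreal"
  assumes M: "prob_space M" and G: "bivariate_gaussian M X Y"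
    and X: "distributed M lborel X (\<lambda>x. ennreal (std_normal_density x))"
    and Y: "distributed M lborel Y (\<lambda>x. ennreal (std_normal_density x))"
    and corr: "correlation M X Y = \<rho>" and \<rho>: "\<rho>\<^sup>2 < 1"
    and [measurable]: "f \<in> borel_measurable (borel \<Otimes>\<^sub>M borel)"
  shows "(\<integral>\<^sup>+ \<omega>. f (X \<omega>, Y \<omega>) \<partial>M) =
    (\<integral>\<^sup>+ x. (\<integral>\<^sup>+ y. ennreal (binormal_density \<rho> (x, y)) * f (x, y) \<partial>lborel) \<partial>lborel)"
proof -
  interpret N: real_distribution N01 by (rule real_dist_normal_dist)
  let ?N2 = "N01 \<Otimes>\<^sub>M N01"
  have [measurable]: "X \<in> borel_measurable M" "Y \<in> borel_measurable M"
    using G by (auto simp: bivariate_gaussian_def)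
  obtain \<mu> \<nu> a b c d where law:
    "distr M (borel \<Otimes>\<^sub>M borel) (\<lambda>\<omega>. (X \<omega>, Y \<omega>)) =
        distr ?N2 (borel \<Otimes>\<^sub>M borel) (\<lambda>(z, w). (\<mu> + a * z + b * w, \<nu> + c * z + d * w))"
    using G unfolding bivariate_gaussian_def by auto
  have transfer: "(\<integral>\<omega>. g (X \<omega>, Y \<omega>) \<partial>M) = (\<integral>(z, w). g (\<mu> + a * z + b * w, \<nu> + c * z + d * w) \<partial>?N2)"
    if [measurable]: "g \<in> borel_measurable (borel \<Otimes>\<^sub>M borel)" for g :: "real \<times> real \<Rightarrow> real"
  proof -
    have "(\<integral>\<omega>. g (X \<omega>, Y \<omega>) \<partial>M) = (\<integral>p. g p \<partial>distr M (borel \<Otimes>\<^sub>M borel) (\<lambda>\<omega>. (X \<omega>, Y \<omega>)))"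
      by (subst integral_distr) auto
    also have "\<dots> = (\<integral>(z, w). g (\<mu> + a * z + b * w, \<nu> + c * z + d * w) \<partial>?N2)"
      unfolding law by (subst integral_distr) (auto simp: split_beta')
    finally show ?thesis .
  qed
  have marginal: "(\<integral>\<omega>. g (Z \<omega>) \<partial>M) = integral\<^sup>L N01 g"
    if [measurable]: "g \<in> borel_measurable borel"
      and Z: "distributed M lborel Z (\<lambda>x. ennreal (std_normal_density x))" for g :: "real \<Rightarrow> real" and Z
    using distributed_integral[OF Z, of g] by (simp add: integral_density)
  have moments: "integral\<^sup>L N01 (\<lambda>x. x) = 0" "integral\<^sup>L N01 (\<lambda>x. x\<^sup>2) = 1"
    using std_normal_distribution_even_moments[of 1] integral_std_normal_distribution_moment_odd[of 1]
    by (simp_all add: fact_numeral)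
  have E: "(\<integral>\<omega>. X \<omega> \<partial>M) = 0" "(\<integral>\<omega>. Y \<omega> \<partial>M) = 0" "(\<integral>\<omega>. (X \<omega>)\<^sup>2 \<partial>M) = 1" "(\<integral>\<omega>. (Y \<omega>)\<^sup>2 \<partial>M) = 1"
    using marginal[OF _ X, of "\<lambda>x. x"] marginal[OF _ Y, of "\<lambda>x. x"]
      marginal[OF _ X, of "\<lambda>x. x\<^sup>2"] marginal[OF _ Y, of "\<lambda>x. x\<^sup>2"] by (simp_all add: moments)
  note bil = std_normal_bilinear_integral[THEN has_bochner_integral_integral_eq]
  have \<mu>: "\<mu> = 0"
    using transfer[of fst] E(1) bil[of \<mu> a b 1 0 0] by (simp add: case_prod_beta)
  have \<nu>: "\<nu> = 0"
    using transfer[of snd] E(2) bil[of \<nu> c d 1 0 0] by (simp add: case_prod_beta)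
  have ab: "a\<^sup>2 + b\<^sup>2 = 1"
    using transfer[of "\<lambda>p. (fst p)\<^sup>2"] E(3) bil[of \<mu> a b \<mu> a b]
    by (simp add: case_prod_beta power2_eq_square \<mu>)
  have cd: "c\<^sup>2 + d\<^sup>2 = 1"
    using transfer[of "\<lambda>p. (snd p)\<^sup>2"] E(4) bil[of \<nu> c d \<nu> c d]
    by (simp add: case_prod_beta power2_eq_square \<nu>)
  have "(\<integral>\<omega>. X \<omega> * Y \<omega> \<partial>M) = \<rho>"
    using corr by (simp add: correlation_def E)
  then have abcd: "a * c + b * d = \<rho>"
    using transfer[of "\<lambda>p. fst p * snd p"] bil[of \<mu> a b \<nu> c d]
    by (simp add: case_prod_beta \<mu> \<nu>)
  have "(\<integral>\<^sup>+ \<omega>. f (X \<omega>, Y \<omega>) \<partial>M) = (\<integral>\<^sup>+ p. f p \<partial>distr M (borel \<Otimes>\<^sub>M borel) (\<lambda>\<omega>. (X \<omega>, Y \<omega>)))"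
    by (subst nn_integral_distr) auto
  also have "\<dots> = (\<integral>\<^sup>+ p. f (a * fst p + b * snd p, c * fst p + d * snd p) \<partial>?N2)"
    unfolding law by (subst nn_integral_distr) (auto simp: case_prod_beta \<mu> \<nu>)
  also have "\<dots> = (\<integral>\<^sup>+ z. (\<integral>\<^sup>+ w. f (a * z + b * w, c * z + d * w) \<partial>N01) \<partial>N01)"
    by (subst N.nn_integral_fst[symmetric]) auto
  also have "\<dots> = (\<integral>\<^sup>+ z. ennreal (std_normal_density z) * (\<integral>\<^sup>+ w. ennreal (std_normal_density w) * f (a * z + b * w, c * z + d * w) \<partial>lborel) \<partial>lborel)"
    by (simp add: nn_integral_density)
  also have "\<dots> = (\<integral>\<^sup>+ z. (\<integral>\<^sup>+ w. ennreal (std_normal_density z * std_normal_density w) * f (a * z + b * w, c * z + d * w) \<partial>lborel) \<partial>lborel)"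
    by (simp add: nn_integral_cmult[symmetric] ennreal_mult mult.assoc)
  also have "\<dots> = (\<integral>\<^sup>+ x. (\<integral>\<^sup>+ y. ennreal (binormal_density \<rho> (x, y)) * f (x, y) \<partial>lborel) \<partial>lborel)"
    by (rule nn_integral_std_normal_linear_image[OF _ ab cd abcd \<rho>]) measurable
  finally show ?thesis .
qed

lemma (in prob_space) nn_integral_indep_pair:
  assumes indep: "indep_var S X T Y" and [measurable]: "f \<in> borel_measurable (S \<Otimes>\<^sub>M T)"
  shows "(\<integral>\<^sup>+ \<omega>. f (X \<omega>, Y \<omega>) \<partial>M) = (\<integral>\<^sup>+ \<omega>. (\<integral>\<^sup>+ \<omega>'. f (X \<omega>, Y \<omega>') \<partial>M) \<partial>M)"
proof -
  have XY [measurable]: "random_variable S X" "random_variable T Y"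
    using indep by (auto dest: indep_var_rv1 indep_var_rv2)
  interpret T: prob_space "distr M T Y" by (rule prob_space_distr) measurable
  have "(\<integral>\<^sup>+ \<omega>. f (X \<omega>, Y \<omega>) \<partial>M) = (\<integral>\<^sup>+ p. f p \<partial>distr M (S \<Otimes>\<^sub>M T) (\<lambda>\<omega>. (X \<omega>, Y \<omega>)))"
    by (subst nn_integral_distr) auto
  also have "\<dots> = (\<integral>\<^sup>+ p. f p \<partial>(distr M S X \<Otimes>\<^sub>M distr M T Y))"
    using indep by (simp add: indep_var_distribution_eq)
  also have "\<dots> = (\<integral>\<^sup>+ x. (\<integral>\<^sup>+ y. f (x, y) \<partial>distr M T Y) \<partial>distr M S X)"
    by (subst T.nn_integral_fst[symmetric]) (auto cong: measurable_cong_sets)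
  also have "\<dots> = (\<integral>\<^sup>+ x. (\<integral>\<^sup>+ \<omega>'. f (x, Y \<omega>') \<partial>M) \<partial>distr M S X)"
    by (intro nn_integral_cong nn_integral_distr) auto
  also have "\<dots> = (\<integral>\<^sup>+ \<omega>. (\<integral>\<^sup>+ \<omega>'. f (X \<omega>, Y \<omega>') \<partial>M) \<partial>M)"
    by (subst nn_integral_distr) auto
  finally show ?thesis .
qed

lemma measurable_gamma_mixture:
  fixes f :: "(real \<times> real) \<times> (real \<times> real) \<Rightarrow> ennreal"
  assumes [measurable]: "f \<in> borel_measurable ((borel \<Otimes>\<^sub>M borel) \<Otimes>\<^sub>M (borel \<Otimes>\<^sub>M borel))"
  shows "(\<lambda>p. gamma_mixture a r (\<lambda>q. f (p, q))) \<in> borel_measurable (borel \<Otimes>\<^sub>M borel)"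
  unfolding gamma_mixture_def by measurable

lemma (in prob_space) gaussian_pair_squares_law:
  fixes f :: "real \<times> real \<Rightarrow> ennreal"
  assumes "bivariate_gaussian M X Y"
    and "distributed M lborel X (\<lambda>x. ennreal (std_normal_density x))"
    and "distributed M lborel Y (\<lambda>x. ennreal (std_normal_density x))"
    and "correlation M X Y = \<rho>" and \<rho>: "\<rho>\<^sup>2 < 1"
    and [measurable]: "f \<in> borel_measurable (borel \<Otimes>\<^sub>M borel)"
  shows "(\<integral>\<^sup>+ \<omega>. f ((X \<omega>)\<^sup>2, (Y \<omega>)\<^sup>2) \<partial>M) = gamma_mixture (1/2) (\<rho>\<^sup>2) f"
proof -
  have "(\<integral>\<^sup>+ \<omega>. f ((X \<omega>)\<^sup>2, (Y \<omega>)\<^sup>2) \<partial>M) = (\<integral>\<^sup>+ \<omega>. (\<lambda>(x, y). f (x\<^sup>2, y\<^sup>2)) (X \<omega>, Y \<omega>) \<partial>M)" by simp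
  also have "\<dots> = (\<integral>\<^sup>+ x. (\<integral>\<^sup>+ y. ennreal (binormal_density \<rho> (x, y)) * (\<lambda>(x, y). f (x\<^sup>2, y\<^sup>2)) (x, y) \<partial>lborel) \<partial>lborel)"
    by (rule gaussian_pair_law[OF prob_space_axioms]) (use assms in auto)
  also have "\<dots> = gamma_mixture (1/2) (\<rho>\<^sup>2) f"
    using nn_integral_binormal_squares[OF _ \<rho>, of f] by simp
  finally show ?thesis .
qed

text \<open>Induction over the summands: independence turns the law of the sum into a convolution, and the mixtures form a
semigroup.\<close>
lemma (in prob_space) sum_of_squares_law:
  fixes f :: "real \<times> real \<Rightarrow> ennreal"
  assumes "finite I" "I \<noteq> {}"
    and "indep_vars (\<lambda>_. borel \<Otimes>\<^sub>M borel) (\<lambda>i \<omega>. (X1 i \<omega>, X2 i \<omega>)) I"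
    and "\<And>i. i \<in> I \<Longrightarrow> bivariate_gaussian M (X1 i) (X2 i)"
    and "\<And>i. i \<in> I \<Longrightarrow> distributed M lborel (X1 i) (\<lambda>x. ennreal (std_normal_density x))"
    and "\<And>i. i \<in> I \<Longrightarrow> distributed M lborel (X2 i) (\<lambda>x. ennreal (std_normal_density x))"
    and "\<And>i. i \<in> I \<Longrightarrow> correlation M (X1 i) (X2 i) = \<rho>"
    and \<rho>: "\<rho>\<^sup>2 < 1"
    and "f \<in> borel_measurable (borel \<Otimes>\<^sub>M borel)"
  shows "(\<integral>\<^sup>+ \<omega>. f (\<Sum>i\<in>I. (X1 i \<omega>)\<^sup>2, \<Sum>i\<in>I. (X2 i \<omega>)\<^sup>2) \<partial>M) = gamma_mixture (real (card I) / 2) (\<rho>\<^sup>2) f"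
  using assms
proof (induction I arbitrary: f rule: finite_ne_induct)
  case (singleton i)
  then show ?case using gaussian_pair_squares_law[of "X1 i" "X2 i" \<rho> f] by simp
next
  case (insert i I)
  note [measurable] = insert.prems(7)
  have r: "0 \<le> \<rho>\<^sup>2" by simp
  have one: "(\<integral>\<^sup>+ \<omega>. g ((X1 i \<omega>)\<^sup>2, (X2 i \<omega>)\<^sup>2) \<partial>M) = gamma_mixture (1/2) (\<rho>\<^sup>2) g"
    if "g \<in> borel_measurable (borel \<Otimes>\<^sub>M borel)" for g :: "real \<times> real \<Rightarrow> ennreal"
    using insert.prems that by (intro gaussian_pair_squares_law) auto
  have IH: "(\<integral>\<^sup>+ \<omega>. g (\<Sum>i\<in>I. (X1 i \<omega>)\<^sup>2, \<Sum>i\<in>I. (X2 i \<omega>)\<^sup>2) \<partial>M) = gamma_mixture (real (card I) / 2) (\<rho>\<^sup>2) g"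
    if "g \<in> borel_measurable (borel \<Otimes>\<^sub>M borel)" for g :: "real \<times> real \<Rightarrow> ennreal"
    using insert.prems that by (intro insert.IH indep_vars_subset[OF insert.prems(1)]) auto
  have "indep_var (borel \<Otimes>\<^sub>M borel) ((\<lambda>h. ((fst (h i))\<^sup>2, (snd (h i))\<^sup>2)) \<circ> (\<lambda>\<omega>. restrict (\<lambda>i. (X1 i \<omega>, X2 i \<omega>)) {i}))
      (borel \<Otimes>\<^sub>M borel) ((\<lambda>h. (\<Sum>i\<in>I. (fst (h i))\<^sup>2, \<Sum>i\<in>I. (snd (h i))\<^sup>2)) \<circ> (\<lambda>\<omega>. restrict (\<lambda>i. (X1 i \<omega>, X2 i \<omega>)) I))"
    using insert.hyps
    by (intro indep_var_compose[OF indep_var_restrict[OF insert.prems(1)]]) (auto, measurable)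
  then have indep: "indep_var (borel \<Otimes>\<^sub>M borel) (\<lambda>\<omega>. ((X1 i \<omega>)\<^sup>2, (X2 i \<omega>)\<^sup>2))
      (borel \<Otimes>\<^sub>M borel) (\<lambda>\<omega>. (\<Sum>i\<in>I. (X1 i \<omega>)\<^sup>2, \<Sum>i\<in>I. (X2 i \<omega>)\<^sup>2))"
    by (simp add: comp_def)
  define h where "h = (\<lambda>q. f (fst (fst q) + fst (snd q), snd (fst q) + snd (snd q)))"
  have [measurable]: "h \<in> borel_measurable ((borel \<Otimes>\<^sub>M borel) \<Otimes>\<^sub>M (borel \<Otimes>\<^sub>M borel))"
    unfolding h_def by measurable
  have "(\<integral>\<^sup>+ \<omega>. f (\<Sum>i\<in>insert i I. (X1 i \<omega>)\<^sup>2, \<Sum>i\<in>insert i I. (X2 i \<omega>)\<^sup>2) \<partial>M) =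
      (\<integral>\<^sup>+ \<omega>. h (((X1 i \<omega>)\<^sup>2, (X2 i \<omega>)\<^sup>2), (\<Sum>i\<in>I. (X1 i \<omega>)\<^sup>2, \<Sum>i\<in>I. (X2 i \<omega>)\<^sup>2)) \<partial>M)"
    using insert.hyps by (simp add: h_def)
  also have "\<dots> = (\<integral>\<^sup>+ \<omega>. (\<integral>\<^sup>+ \<omega>'. h (((X1 i \<omega>)\<^sup>2, (X2 i \<omega>)\<^sup>2), (\<Sum>i\<in>I. (X1 i \<omega>')\<^sup>2, \<Sum>i\<in>I. (X2 i \<omega>')\<^sup>2)) \<partial>M) \<partial>M)"
    by (rule nn_integral_indep_pair[OF indep]) measurable
  also have "\<dots> = (\<integral>\<^sup>+ \<omega>. gamma_mixture (real (card I) / 2) (\<rho>\<^sup>2) (\<lambda>q. h (((X1 i \<omega>)\<^sup>2, (X2 i \<omega>)\<^sup>2), q)) \<partial>M)"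
    by (intro nn_integral_cong IH) measurable
  also have "\<dots> = gamma_mixture (1/2) (\<rho>\<^sup>2) (\<lambda>p. gamma_mixture (real (card I) / 2) (\<rho>\<^sup>2) (\<lambda>q. h (p, q)))"
    by (intro one measurable_gamma_mixture) measurable
  also have "\<dots> = gamma_mixture (1/2 + real (card I) / 2) (\<rho>\<^sup>2) f"
    using insert.hyps \<rho> by (subst gamma_mixture_convolution[symmetric]) (auto simp: h_def split_beta' card_gt_0_iff)
  also have "1/2 + real (card I) / 2 = real (card (insert i I)) / 2"
    using insert.hyps by (simp add: field_simps)
  finally show ?case .
qed

section \<open>Density and distribution function of the pair\<close>

text \<open>The confluent hypergeometric limit function; up to a power factor and a constant, \<open>hyp0F1 a (z\<^sup>2 / 4)\<close> is the
modified Bessel function of order \<open>a - 1\<close>.\<close>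
definition hyp0F1 :: "real \<Rightarrow> real \<Rightarrow> real" where
  "hyp0F1 a w = (\<Sum>k. w ^ k / (fact k * pochhammer a k))"

lemma summable_hyp0F1:
  fixes a w :: real
  assumes "1 \<le> a"
  shows "summable (\<lambda>k. w ^ k / (fact k * pochhammer a k))"
proof (rule summable_comparison_test')
  show "summable (\<lambda>k. \<bar>w\<bar> ^ k / fact k)"
    using summable_exp[of "\<bar>w\<bar>"] by (simp add: field_simps)
  fix k :: nat
  have "1 \<le> pochhammer a k"
  proof (induction k)
    case (Suc k)
    have "1 * 1 \<le> pochhammer a k * (a + real k)"
      using Suc assms by (intro mult_mono) auto
    then show ?case by (simp add: pochhammer_Suc)
  qed simp
  then have "\<bar>w\<bar> ^ k / (fact k * pochhammer a k) \<le> \<bar>w\<bar> ^ k / (fact k * 1)"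
    by (intro divide_left_mono mult_left_mono) auto
  then show "norm (w ^ k / (fact k * pochhammer a k)) \<le> \<bar>w\<bar> ^ k / fact k"
    using \<open>1 \<le> pochhammer a k\<close> by (simp add: abs_mult power_abs)
qed

lemma continuous_hyp0F1:
  assumes "1 \<le> a"
  shows "continuous_on S (hyp0F1 a)"
proof -
  have "isCont (\<lambda>w. \<Sum>k. (1 / (fact k * pochhammer a k)) * w ^ k) w" for w
    by (rule isCont_powser_converges_everywhere) (use summable_hyp0F1[OF assms] in auto)
  then show ?thesis
    unfolding hyp0F1_def[abs_def] by (intro continuous_at_imp_continuous_on) simp
qed

lemma hyp0F1_nonneg:
  assumes "1 \<le> a" "0 \<le> w"
  shows "0 \<le> hyp0F1 a w"
  unfolding hyp0F1_def using assms
  by (intro suminf_nonneg summable_hyp0F1) (auto intro!: divide_nonneg_nonneg mult_nonneg_nonneg pochhammer_nonneg)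

text \<open>The parameter \<open>r\<close> stands for \<open>\<rho>\<^sup>2\<close>. The factor \<open>(u v) powr (m/2 - 1)\<close> is written as a natural power of a
square root because \<open>0 powr 0 = 0\<close> would destroy continuity on the axes when \<open>m = 2\<close>.\<close>
definition chi2_pair_density :: "nat \<Rightarrow> real \<Rightarrow> real \<Rightarrow> real \<Rightarrow> real" where
  "chi2_pair_density m r u v =
     (1 - r) powr (real m / 2) / ((2 * (1 - r)) ^ m * (Gamma (real m / 2))\<^sup>2)
       * sqrt (u * v) ^ (m - 2) * exp (- (u + v) / (2 * (1 - r)))
       * hyp0F1 (real m / 2) (r * (u * v) / (2 * (1 - r))\<^sup>2)"

lemma chi2_pair_density_commute: "chi2_pair_density m r u v = chi2_pair_density m r v u"
  by (simp add: chi2_pair_density_def mult.commute add.commute)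

lemma chi2_pair_density_nonneg:
  assumes "2 \<le> m" "0 \<le> r" "r < 1" "0 \<le> u" "0 \<le> v"
  shows "0 \<le> chi2_pair_density m r u v"
proof -
  have "0 \<le> hyp0F1 (real m / 2) (r * (u * v) / (2 * (1 - r))\<^sup>2)"
    using assms by (intro hyp0F1_nonneg) auto
  then show ?thesis
    using assms by (auto simp: chi2_pair_density_def intro!: mult_nonneg_nonneg)
qed

lemma continuous_on_chi2_pair_density [continuous_intros]:
  assumes "2 \<le> m" "r < 1" "continuous_on S f" "continuous_on S g"
  shows "continuous_on S (\<lambda>x. chi2_pair_density m r (f x) (g x))"
proof -
  have "continuous_on S (\<lambda>x. hyp0F1 (real m / 2) (r * (f x * g x) / (2 * (1 - r))\<^sup>2))"
    using assms by (intro continuous_on_compose2[OF continuous_hyp0F1[of _ UNIV]] continuous_intros) auto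
  then show ?thesis
    unfolding chi2_pair_density_def using assms(2-) by (intro continuous_intros) auto
qed

lemma measurable_chi2_pair_density:
  assumes "2 \<le> m" "r < 1"
  shows "(\<lambda>(u, v). chi2_pair_density m r u v) \<in> borel_measurable (borel \<Otimes>\<^sub>M borel)"
  unfolding borel_prod case_prod_beta using assms
  by (intro borel_measurable_continuous_onI continuous_intros) auto

lemma nb_gamma_sums_chi2_pair_density:
  assumes m: "2 \<le> m" and r: "0 \<le> r" "r < 1" and uv: "0 < u" "0 < v"
  defines "a \<equiv> real m / 2"
  defines "g \<equiv> (\<lambda>k. gamma_density (2 * (1 - r)) (a + real k))"
  shows "(\<lambda>k. nb_weight a r k * (g k u * g k v)) sums chi2_pair_density m r u v"
proof -
  define \<theta> where "\<theta> = 2 * (1 - r)"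
  have \<theta>: "0 < \<theta>" using r by (simp add: \<theta>_def)
  have a: "1 \<le> a" using m by (simp add: a_def)
  define E where "E = exp (- (u + v) / \<theta>)"
  define w where "w = r * (u * v) / \<theta>\<^sup>2"
  have Ga: "Gamma a > 0" using a by (intro Gamma_real_pos) simp
  have pw: "t powr (a - 1) = sqrt t ^ (m - 2)" if "0 < t" for t
  proof -
    have "a - 1 = real (m - 2) / 2" using m by (simp add: a_def field_simps)
    then have "t powr (a - 1) = (t powr (1/2)) powr real (m - 2)"
      by (simp only: powr_powr) simp
    then show ?thesis using that by (simp only: powr_half_sqrt powr_realpow less_imp_le real_sqrt_gt_zero)
  qed
  have pw2: "\<theta> powr a * \<theta> powr a = \<theta> ^ m"
    using \<theta> powr_realpow[of \<theta> m] by (simp add: a_def flip: powr_add)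
  have P: "pochhammer a k > 0" for k using a by (intro pochhammer_pos) simp
  have Gam: "Gamma (a + real k) = Gamma a * pochhammer a k" for k
  proof -
    have "a \<notin> \<int>\<^sub>\<le>\<^sub>0" using a by (auto elim!: nonpos_Ints_cases)
    then show ?thesis using pochhammer_Gamma[of a k] Ga by simp
  qed
  have g: "g k t = sqrt t ^ (m - 2) * t ^ k * exp (- t / \<theta>) / (\<theta> powr a * \<theta> ^ k * (Gamma a * pochhammer a k))"
    if "0 < t" for t k
  proof -
    have "t powr (a + real k - 1) = t powr (a - 1) * t ^ k"
      using that by (simp add: powr_realpow[symmetric] powr_add[symmetric] algebra_simps)
    then show ?thesis
      using that \<theta> unfolding g_def gamma_density_def \<theta>_def[symmetric] Gam
      by (simp add: pw powr_add powr_realpow)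
  qed
  have term_eq: "nb_weight a r k * (g k u * g k v) =
      (1 - r) powr a / (\<theta> ^ m * (Gamma a)\<^sup>2) * sqrt (u * v) ^ (m - 2) * E * (w ^ k / (fact k * pochhammer a k))" for k
  proof -
    have e: "exp (- u / \<theta>) * exp (- v / \<theta>) = E"
      by (simp add: E_def add_divide_distrib diff_divide_distrib flip: exp_add)
    have wk: "w ^ k = r ^ k * (u ^ k * v ^ k) / (\<theta> ^ k * \<theta> ^ k)"
      by (simp add: w_def power_divide power_mult_distrib power2_eq_square)
    have "g k u * g k v = (sqrt u ^ (m - 2) * sqrt v ^ (m - 2)) * (u ^ k * v ^ k) * (exp (- u / \<theta>) * exp (- v / \<theta>)) /
        ((\<theta> powr a * \<theta> powr a) * (\<theta> ^ k * \<theta> ^ k) * ((Gamma a)\<^sup>2 * (pochhammer a k)\<^sup>2))"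
      unfolding g[OF uv(1)] g[OF uv(2)] times_divide_times_eq power2_eq_square by (simp only: mult_ac)
    also have "\<dots> = sqrt (u * v) ^ (m - 2) * (u ^ k * v ^ k) * E /
        (\<theta> ^ m * (\<theta> ^ k * \<theta> ^ k) * ((Gamma a)\<^sup>2 * (pochhammer a k)\<^sup>2))"
      unfolding e pw2 by (simp add: real_sqrt_mult power_mult_distrib)
    finally show ?thesis
      unfolding nb_weight_def wk using P[of k] Ga \<theta>
      by (simp add: field_simps power2_eq_square)
  qed
  have "(\<lambda>k. w ^ k / (fact k * pochhammer a k)) sums hyp0F1 a w"
    unfolding hyp0F1_def by (intro summable_sums summable_hyp0F1 a)
  then have "(\<lambda>k. nb_weight a r k * (g k u * g k v)) sums
      ((1 - r) powr a / (\<theta> ^ m * (Gamma a)\<^sup>2) * sqrt (u * v) ^ (m - 2) * E * hyp0F1 a w)"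
    unfolding term_eq by (intro sums_mult)
  then show ?thesis
    by (simp add: chi2_pair_density_def a_def \<theta>_def E_def w_def)
qed

lemma gamma_mixture_eq_density:
  fixes f :: "real \<times> real \<Rightarrow> ennreal"
  assumes m: "2 \<le> m" and r: "0 \<le> r" "r < 1" and [measurable]: "f \<in> borel_measurable (borel \<Otimes>\<^sub>M borel)"
  shows "gamma_mixture (real m / 2) r f =
    (\<integral>\<^sup>+ u. (\<integral>\<^sup>+ v. ennreal (chi2_pair_density m r u v) * indicator {0<..} u * indicator {0<..} v * f (u, v) \<partial>lborel) \<partial>lborel)"
proof -
  define a where "a = real m / 2"
  have a: "0 < a" using m by (simp add: a_def)
  define g where "g = (\<lambda>k. gamma_density (2 * (1 - r)) (a + real k))"
  have [measurable]: "g k \<in> borel_measurable borel" for k by (simp add: g_def)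
  have g0: "0 \<le> g k u" for k u using a by (simp add: g_def gamma_density_nonneg)
  define w where "w = nb_weight a r"
  have w0: "0 \<le> w k" for k using a r by (simp add: w_def nb_weight_nonneg)
  have "gamma_mixture a r f = (\<Sum>k. \<integral>\<^sup>+ u. (\<integral>\<^sup>+ v. w k * (g k u * (g k v * f (u, v))) \<partial>lborel) \<partial>lborel)"
    by (simp add: gamma_mixture_def w_def g_def nn_integral_cmult)
  also have "\<dots> = (\<integral>\<^sup>+ u. (\<Sum>k. \<integral>\<^sup>+ v. w k * (g k u * (g k v * f (u, v))) \<partial>lborel) \<partial>lborel)"
    by (intro nn_integral_suminf[symmetric]) measurable
  also have "\<dots> = (\<integral>\<^sup>+ u. (\<integral>\<^sup>+ v. (\<Sum>k. w k * (g k u * (g k v * f (u, v)))) \<partial>lborel) \<partial>lborel)"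
    by (rule nn_integral_cong, rule nn_integral_suminf[symmetric]) measurable
  also have "\<dots> = (\<integral>\<^sup>+ u. (\<integral>\<^sup>+ v. ennreal (chi2_pair_density m r u v) * indicator {0<..} u * indicator {0<..} v * f (u, v) \<partial>lborel) \<partial>lborel)"
  proof (rule nn_integral_cong, rule nn_integral_cong)
    fix u v :: real
    show "(\<Sum>k. w k * (g k u * (g k v * f (u, v)))) =
        ennreal (chi2_pair_density m r u v) * indicator {0<..} u * indicator {0<..} v * f (u, v)"
    proof (cases "0 < u \<and> 0 < v")
      case False
      then have "g k u = 0 \<or> g k v = 0" for k by (auto simp: g_def gamma_density_def)
      then have "w k * (g k u * (g k v * f (u, v))) = 0" for k
        by (metis ennreal_0 mult_zero_left mult_zero_right)
      then have "(\<Sum>k. w k * (g k u * (g k v * f (u, v)))) = 0"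
        by (simp only: suminf_zero)
      then show ?thesis using False by auto
    next
      case True
      have S: "(\<Sum>k. ennreal (w k * (g k u * g k v))) = ennreal (chi2_pair_density m r u v)"
        using nb_gamma_sums_chi2_pair_density[OF m r, of u v] True w0 g0
        by (intro suminf_ennreal_eq) (auto simp: w_def g_def a_def)
      have "(\<Sum>k. w k * (g k u * (g k v * f (u, v)))) = (\<Sum>k. ennreal (w k * (g k u * g k v)) * f (u, v))"
        by (simp add: ennreal_mult w0 g0 mult.assoc)
      then show ?thesis using True by (simp add: S)
    qed
  qed
  finally show ?thesis by (simp add: a_def)
qed

text \<open>Integrating a mixture component removes the factor in \<open>v\<close>, and what remains is an exponential series in
\<open>r u / (2 (1 - r))\<close>; it changes the rate from \<open>1 / (2 (1 - r))\<close> to \<open>1/2\<close>. Thus each coordinate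
has the chi-square law.\<close>
lemma chi2_pair_density_marginal:
  assumes m: "2 \<le> m" and r: "0 \<le> r" "r < 1" and u: "0 < u"
  shows "(\<integral>\<^sup>+ v. ennreal (chi2_pair_density m r u v) * indicator {0<..} v \<partial>lborel) = gamma_density 2 (real m / 2) u"
proof -
  define a where "a = real m / 2"
  have a: "0 < a" using m by (simp add: a_def)
  define g where "g = (\<lambda>k. gamma_density (2 * (1 - r)) (a + real k))"
  have [measurable]: "g k \<in> borel_measurable borel" for k by (simp add: g_def)
  have g0: "0 \<le> g k u" for k u using a by (simp add: g_def gamma_density_nonneg)
  define w where "w = nb_weight a r"
  have w0: "0 \<le> w k" for k using a r by (simp add: w_def nb_weight_nonneg)
  have "(\<integral>\<^sup>+ v. ennreal (chi2_pair_density m r u v) * indicator {0<..} v \<partial>lborel) =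
      (\<integral>\<^sup>+ v. (\<Sum>k. ennreal (w k * g k u) * ennreal (g k v)) \<partial>lborel)"
  proof (rule nn_integral_cong)
    fix v :: real
    show "ennreal (chi2_pair_density m r u v) * indicator {0<..} v = (\<Sum>k. ennreal (w k * g k u) * ennreal (g k v))"
    proof (cases "0 < v")
      case False
      then show ?thesis by (simp add: g_def gamma_density_def)
    next
      case True
      have "(\<Sum>k. ennreal (w k * (g k u * g k v))) = ennreal (chi2_pair_density m r u v)"
        using nb_gamma_sums_chi2_pair_density[OF m r u True] w0 g0
        by (intro suminf_ennreal_eq) (auto simp: w_def g_def a_def)
      then show ?thesis using True by (simp add: ennreal_mult w0 g0 mult.assoc)
    qed
  qed
  also have "\<dots> = (\<Sum>k. \<integral>\<^sup>+ v. ennreal (w k * g k u) * ennreal (g k v) \<partial>lborel)"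
    by (rule nn_integral_suminf) measurable
  also have "\<dots> = (\<Sum>k. ennreal (w k * g k u))"
    using a r by (simp add: nn_integral_cmult g_def nn_integral_gamma_density)
  also have "\<dots> = ennreal (gamma_density 2 a u)"
  proof (rule suminf_ennreal_eq)
    define \<theta> where "\<theta> = 2 * (1 - r)"
    have \<theta>: "0 < \<theta>" using r by (simp add: \<theta>_def)
    have Ga: "Gamma a > 0" using a by (intro Gamma_real_pos) simp
    have term_eq: "w k * g k u = (1 - r) powr a * u powr (a - 1) * exp (- u / \<theta>) / (\<theta> powr a * Gamma a) * ((r * u / \<theta>) ^ k / fact k)" for k
    proof -
      have "a \<notin> \<int>\<^sub>\<le>\<^sub>0" using a by (auto elim!: nonpos_Ints_cases)
      then have Gam: "Gamma (a + real k) = Gamma a * pochhammer a k"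
        using pochhammer_Gamma[of a k] Ga by simp
      have P: "pochhammer a k > 0" using a by (intro pochhammer_pos) simp
      have "u powr (a + real k - 1) = u powr (a - 1) * u ^ k"
        using u by (simp add: powr_realpow[symmetric] powr_add[symmetric] algebra_simps)
      then show ?thesis
        using u \<theta> Ga P unfolding w_def nb_weight_def g_def gamma_density_def \<theta>_def[symmetric] Gam
        by (simp add: powr_add powr_realpow power_divide power_mult_distrib mult_ac)
    qed
    have "(\<lambda>k. (r * u / \<theta>) ^ k / fact k) sums exp (r * u / \<theta>)"
      using exp_converges[of "r * u / \<theta>"] by (simp add: field_simps)
    then have "(\<lambda>k. w k * g k u) sums
        ((1 - r) powr a * u powr (a - 1) * exp (- u / \<theta>) / (\<theta> powr a * Gamma a) * exp (r * u / \<theta>))"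
      unfolding term_eq by (intro sums_mult)
    also have "(1 - r) powr a * u powr (a - 1) * exp (- u / \<theta>) / (\<theta> powr a * Gamma a) * exp (r * u / \<theta>) =
        gamma_density 2 a u"
    proof -
      have "- u / \<theta> + r * u / \<theta> = (- u) * (1 - r) / (2 * (1 - r))"
        unfolding add_divide_distrib[symmetric] \<theta>_def by (simp add: algebra_simps)
      also have "\<dots> = - u / 2" using r by (intro frac_eq_eq[THEN iffD2]) (auto simp: algebra_simps)
      finally have "- u / \<theta> + r * u / \<theta> = - u / 2" .
      then have "exp (- u / \<theta>) * exp (r * u / \<theta>) = exp (- u / 2)" by (simp flip: exp_add)
      moreover have "\<theta> powr a = 2 powr a * (1 - r) powr a" unfolding \<theta>_def by (rule powr_mult)
      ultimately show ?thesis using u r by (simp add: gamma_density_def field_simps)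
    qed
    finally show "(\<lambda>k. w k * g k u) sums gamma_density 2 a u" .
  qed (use w0 g0 in auto)
  finally show ?thesis by (simp add: a_def)
qed

lemma nn_integral_Icc_eq_integral:
  fixes f :: "real \<Rightarrow> real"
  assumes "continuous_on {0..c} f" "\<And>x. 0 \<le> x \<Longrightarrow> x \<le> c \<Longrightarrow> 0 \<le> f x"
  shows "(\<integral>\<^sup>+ x. ennreal (f x) * indicator {0<..} x * indicator {..c} x \<partial>lborel) = ennreal (integral {0..c} f)"
proof -
  have "(f has_integral integral {0..c} f) {0..c}"
    using assms by (intro integrable_integral integrable_continuous_real)
  then have "(\<integral>\<^sup>+ x. ennreal (indicator {0..c} x * f x) \<partial>lborel) = ennreal (integral {0..c} f)"
    using assms(2) by (intro nn_integral_has_integral_lebesgue) auto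
  moreover have "(\<integral>\<^sup>+ x. ennreal (indicator {0..c} x * f x) \<partial>lborel) =
      (\<integral>\<^sup>+ x. ennreal (f x) * indicator {0<..} x * indicator {..c} x \<partial>lborel)"
  proof (rule nn_integral_cong_AE)
    show "AE x in lborel. ennreal (indicator {0..c} x * f x) = ennreal (f x) * indicator {0<..} x * indicator {..c} x"
      using AE_lborel_singleton[of "0::real"] by eventually_elim (auto split: split_indicator)
  qed
  ultimately show ?thesis by simp
qed

text \<open>The derivative of the joint distribution function in its first argument.\<close>
definition chi2_pair_partial :: "nat \<Rightarrow> real \<Rightarrow> real \<Rightarrow> real \<Rightarrow> real" where
  "chi2_pair_partial m r u v = integral {0..v} (chi2_pair_density m r u)"

definition chi2_pair_cdf :: "nat \<Rightarrow> real \<Rightarrow> real \<Rightarrow> real \<Rightarrow> real" where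
  "chi2_pair_cdf m r u v = integral {0..u} (\<lambda>s. chi2_pair_partial m r s v)"

lemma chi2_pair_partial_nonneg:
  assumes "2 \<le> m" "0 \<le> r" "r < 1" "0 \<le> u"
  shows "0 \<le> chi2_pair_partial m r u v"
  unfolding chi2_pair_partial_def using assms
  by (intro integral_nonneg integrable_continuous_real continuous_intros chi2_pair_density_nonneg) auto

lemma chi2_pair_partial_eq_nn_integral:
  assumes "2 \<le> m" "0 \<le> r" "r < 1" "0 \<le> u"
  shows "ennreal (chi2_pair_partial m r u v) =
    (\<integral>\<^sup>+ t. ennreal (chi2_pair_density m r u t) * indicator {0<..} t * indicator {..v} t \<partial>lborel)"
  unfolding chi2_pair_partial_def using assms
  by (intro nn_integral_Icc_eq_integral[symmetric] continuous_intros chi2_pair_density_nonneg) auto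

lemma continuous_on_chi2_pair_partial:
  assumes "2 \<le> m" "r < 1"
  shows "continuous_on S (\<lambda>u. chi2_pair_partial m r u v)"
proof -
  have "continuous_on S (\<lambda>u. integral (cbox 0 v) (chi2_pair_density m r u))"
    using assms by (intro integral_continuous_on_param) (auto simp: case_prod_beta intro!: continuous_intros)
  then show ?thesis by (simp add: chi2_pair_partial_def)
qed

lemma DERIV_integral_interior:
  fixes f :: "real \<Rightarrow> real"
  assumes "continuous_on {a..b} f" "a < x" "x < b"
  shows "((\<lambda>x. integral {a..x} f) has_real_derivative f x) (at x)"
proof -
  have "((\<lambda>x. integral {a..x} f) has_real_derivative f x) (at x within {a..b})"
    using assms by (intro integral_has_real_derivative) auto
  moreover have "at x within {a..b} = at x" using assms by (intro at_within_Icc_at) auto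
  ultimately show ?thesis by simp
qed

lemma DERIV_integral_Icc:
  fixes f :: "real \<Rightarrow> real"
  assumes "continuous_on {0..} f" "0 < x"
  shows "((\<lambda>x. integral {0..x} f) has_real_derivative f x) (at x)"
  using assms by (intro DERIV_integral_interior[of 0 "x + 1"]) (auto intro: continuous_on_subset)

lemma DERIV_chi2_pair_cdf:
  assumes "2 \<le> m" "r < 1" "0 < u"
  shows "((\<lambda>u. chi2_pair_cdf m r u v) has_real_derivative chi2_pair_partial m r u v) (at u)"
  unfolding chi2_pair_cdf_def using assms by (intro DERIV_integral_Icc continuous_on_chi2_pair_partial)

lemma DERIV_chi2_pair_partial:
  assumes "2 \<le> m" "r < 1" "0 < v"
  shows "((\<lambda>v. chi2_pair_partial m r u v) has_real_derivative chi2_pair_density m r u v) (at v)"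
  unfolding chi2_pair_partial_def using assms by (intro DERIV_integral_Icc continuous_intros) auto

lemma chi2_pair_cdf_commute:
  assumes "2 \<le> m" "r < 1"
  shows "chi2_pair_cdf m r u v = chi2_pair_cdf m r v u"
proof -
  have "integral (cbox 0 u) (\<lambda>s. integral (cbox 0 v) (chi2_pair_density m r s)) =
      integral (cbox 0 v) (\<lambda>t. integral (cbox 0 u) (\<lambda>s. chi2_pair_density m r s t))"
    using assms by (intro integral_swap_continuous) (auto simp: case_prod_beta intro!: continuous_intros)
  moreover have "(\<lambda>s. chi2_pair_density m r s t) = chi2_pair_density m r t" for t
    by (intro ext chi2_pair_density_commute)
  ultimately show ?thesis
    by (simp add: chi2_pair_cdf_def chi2_pair_partial_def)
qed

lemma emeasure_pair_law:
  assumes [measurable]: "Z1 \<in> borel_measurable M" "Z2 \<in> borel_measurable M"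
    and law: "\<And>f. f \<in> borel_measurable (borel \<Otimes>\<^sub>M borel) \<Longrightarrow> (\<integral>\<^sup>+ \<omega>. f (Z1 \<omega>, Z2 \<omega>) \<partial>M) = L f"
    and [measurable]: "B \<in> sets (borel \<Otimes>\<^sub>M borel)"
  shows "emeasure M {\<omega> \<in> space M. (Z1 \<omega>, Z2 \<omega>) \<in> B} = L (indicator B)"
proof -
  have "emeasure M {\<omega> \<in> space M. (Z1 \<omega>, Z2 \<omega>) \<in> B} = (\<integral>\<^sup>+ \<omega>. indicator {\<omega> \<in> space M. (Z1 \<omega>, Z2 \<omega>) \<in> B} \<omega> \<partial>M)"
    by (rule nn_integral_indicator[symmetric]) measurable
  also have "\<dots> = (\<integral>\<^sup>+ \<omega>. indicator B (Z1 \<omega>, Z2 \<omega>) \<partial>M)"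
    by (intro nn_integral_cong) (auto split: split_indicator)
  also have "\<dots> = L (indicator B)"
    by (rule law) measurable
  finally show ?thesis .
qed

lemma joint_cdf_eq_chi2_pair_cdf:
  assumes M: "prob_space M" and m: "2 \<le> m" and r: "0 \<le> r" "r < 1"
    and [measurable]: "Z1 \<in> borel_measurable M" "Z2 \<in> borel_measurable M"
    and law: "\<And>f. f \<in> borel_measurable (borel \<Otimes>\<^sub>M borel) \<Longrightarrow>
       (\<integral>\<^sup>+ \<omega>. f (Z1 \<omega>, Z2 \<omega>) \<partial>M) = gamma_mixture (real m / 2) r f"
  shows "joint_cdf M Z1 Z2 u v = chi2_pair_cdf m r u v"
proof -
  interpret prob_space M by fact
  note [measurable] = measurable_chi2_pair_density[OF m r(2)]
  have "ennreal (joint_cdf M Z1 Z2 u v) = emeasure M {\<omega> \<in> space M. (Z1 \<omega>, Z2 \<omega>) \<in> {..u} \<times> {..v}}"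
    by (simp add: joint_cdf_def emeasure_eq_measure)
  also have "\<dots> = gamma_mixture (real m / 2) r (indicator ({..u} \<times> {..v}))"
    by (rule emeasure_pair_law[where L="gamma_mixture (real m / 2) r", OF _ _ law])
       (auto intro!: pair_measureI)
  also have "\<dots> = (\<integral>\<^sup>+ s. (\<integral>\<^sup>+ t. ennreal (chi2_pair_density m r s t) * indicator {0<..} s * indicator {0<..} t * indicator ({..u} \<times> {..v}) (s, t) \<partial>lborel) \<partial>lborel)"
    by (rule gamma_mixture_eq_density[OF m r]) measurable
  also have "\<dots> = (\<integral>\<^sup>+ s. ennreal (chi2_pair_partial m r s v) * indicator {0<..} s * indicator {..u} s \<partial>lborel)"
  proof (rule nn_integral_cong)
    fix s :: real
    show "(\<integral>\<^sup>+ t. ennreal (chi2_pair_density m r s t) * indicator {0<..} s * indicator {0<..} t * indicator ({..u} \<times> {..v}) (s, t) \<partial>lborel) =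
       ennreal (chi2_pair_partial m r s v) * indicator {0<..} s * indicator {..u} s"
      using m r by (cases "0 < s \<and> s \<le> u")
        (auto simp: chi2_pair_partial_eq_nn_integral indicator_times intro!: nn_integral_cong)
  qed
  also have "\<dots> = ennreal (chi2_pair_cdf m r u v)"
    unfolding chi2_pair_cdf_def using m r
    by (intro nn_integral_Icc_eq_integral continuous_on_chi2_pair_partial chi2_pair_partial_nonneg) auto
  finally have "ennreal (joint_cdf M Z1 Z2 u v) = ennreal (chi2_pair_cdf m r u v)" .
  moreover have "0 \<le> chi2_pair_cdf m r u v"
    unfolding chi2_pair_cdf_def using m r
    by (intro integral_nonneg integrable_continuous_real continuous_on_chi2_pair_partial chi2_pair_partial_nonneg) auto
  ultimately show ?thesis
    by (simp add: joint_cdf_def)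
qed

text \<open>The complement of the quadrant is split into \<open>{s > u}\<close>, whose probability is a marginal integral, and
\<open>{s \<le> u, t > v}\<close>, where integrating over \<open>s\<close> first leaves the partial derivative by symmetry. So
exceedance probabilities inherit their limits from those of the two integrands.\<close>
lemma joint_survival_eq:
  assumes M: "prob_space M" and m: "2 \<le> m" and r: "0 \<le> r" "r < 1"
    and [measurable]: "Z1 \<in> borel_measurable M" "Z2 \<in> borel_measurable M"
    and law: "\<And>f. f \<in> borel_measurable (borel \<Otimes>\<^sub>M borel) \<Longrightarrow>
       (\<integral>\<^sup>+ \<omega>. f (Z1 \<omega>, Z2 \<omega>) \<partial>M) = gamma_mixture (real m / 2) r f"
    and uv: "0 \<le> u" "0 \<le> v"
  shows "ennreal (1 - joint_cdf M Z1 Z2 u v) =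
    (\<integral>\<^sup>+ s. ennreal (gamma_density 2 (real m / 2) s) * indicator {u<..} s \<partial>lborel) +
    (\<integral>\<^sup>+ t. ennreal (chi2_pair_partial m r t u) * indicator {v<..} t \<partial>lborel)"
proof -
  interpret prob_space M by fact
  let ?p = "\<lambda>s t. ennreal (chi2_pair_density m r s t) * indicator {0<..} t * indicator {u<..} s"
  let ?q = "\<lambda>s t. ennreal (chi2_pair_density m r s t) * indicator {0<..} s * indicator {..u} s * indicator {v<..} t"
  let ?g = "chi2_pair_density m r"
  note [measurable] = measurable_chi2_pair_density[OF m r(2)]
  have [measurable]: "(\<lambda>p. ?g (fst p) (snd p)) \<in> borel_measurable (borel \<Otimes>\<^sub>M borel)"
    using measurable_chi2_pair_density[OF m r(2)] by (simp add: case_prod_beta)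
  define B where "B = {..u} \<times> {..v}"
  have [measurable]: "B \<in> sets (borel \<Otimes>\<^sub>M borel)" unfolding B_def by measurable
  have B' [measurable]: "- B \<in> sets (borel \<Otimes>\<^sub>M borel)"
    using sets.compl_sets[of B "borel \<Otimes>\<^sub>M borel"] by (simp add: space_pair_measure Compl_eq_Diff_UNIV)
  have "1 - joint_cdf M Z1 Z2 u v = prob (space M - {\<omega> \<in> space M. Z1 \<omega> \<le> u \<and> Z2 \<omega> \<le> v})"
    unfolding joint_cdf_def by (subst prob_compl) auto
  also have "space M - {\<omega> \<in> space M. Z1 \<omega> \<le> u \<and> Z2 \<omega> \<le> v} = {\<omega> \<in> space M. (Z1 \<omega>, Z2 \<omega>) \<in> - B}"
    by (auto simp: B_def)
  finally have "ennreal (1 - joint_cdf M Z1 Z2 u v) = emeasure M {\<omega> \<in> space M. (Z1 \<omega>, Z2 \<omega>) \<in> - B}"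
    by (simp add: emeasure_eq_measure)
  also have "\<dots> = gamma_mixture (real m / 2) r (indicator (- B))"
    by (rule emeasure_pair_law[where L="gamma_mixture (real m / 2) r", OF _ _ law]) (simp_all add: B')
  also have "\<dots> = (\<integral>\<^sup>+ s. (\<integral>\<^sup>+ t. ennreal (?g s t) * indicator {0<..} s * indicator {0<..} t * indicator (- B) (s, t) \<partial>lborel) \<partial>lborel)"
    by (rule gamma_mixture_eq_density[OF m r]) measurable
  also have "\<dots> = (\<integral>\<^sup>+ s. (\<integral>\<^sup>+ t. ?p s t + ?q s t \<partial>lborel) \<partial>lborel)"
    using uv by (intro nn_integral_cong) (auto simp: B_def split: split_indicator)
  also have "\<dots> = (\<integral>\<^sup>+ s. (\<integral>\<^sup>+ t. ?p s t \<partial>lborel) +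
       (\<integral>\<^sup>+ t. ?q s t \<partial>lborel) \<partial>lborel)"
    by (rule nn_integral_cong, rule nn_integral_add) measurable
  also have "\<dots> = (\<integral>\<^sup>+ s. (\<integral>\<^sup>+ t. ?p s t \<partial>lborel) \<partial>lborel) +
       (\<integral>\<^sup>+ s. (\<integral>\<^sup>+ t. ?q s t \<partial>lborel) \<partial>lborel)"
    by (rule nn_integral_add) measurable
  also have "(\<integral>\<^sup>+ s. (\<integral>\<^sup>+ t. ?p s t \<partial>lborel) \<partial>lborel) =
       (\<integral>\<^sup>+ s. ennreal (gamma_density 2 (real m / 2) s) * indicator {u<..} s \<partial>lborel)"
    using uv m r by (intro nn_integral_cong)
      (auto simp: chi2_pair_density_marginal nn_integral_multc split: split_indicator)
  also have "(\<integral>\<^sup>+ s. (\<integral>\<^sup>+ t. ?q s t \<partial>lborel) \<partial>lborel) =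
       (\<integral>\<^sup>+ t. (\<integral>\<^sup>+ s. ?q s t \<partial>lborel) \<partial>lborel)"
    by (rule lborel_pair.Fubini') measurable
  also have "\<dots> = (\<integral>\<^sup>+ t. (\<integral>\<^sup>+ s. ennreal (?g t s) * indicator {0<..} s * indicator {..u} s * indicator {v<..} t \<partial>lborel) \<partial>lborel)"
    by (subst chi2_pair_density_commute) (rule refl)
  also have "\<dots> = (\<integral>\<^sup>+ t. ennreal (chi2_pair_partial m r t u) * indicator {v<..} t \<partial>lborel)"
    using uv m r by (intro nn_integral_cong)
      (auto simp: chi2_pair_partial_eq_nn_integral nn_integral_multc split: split_indicator)
  finally show ?thesis .
qed

section \<open>Recovering a continuous density from its distribution function\<close>

text \<open>The indicator of a half-open rectangle is an alternating sum of four quadrant indicators. Passing to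
increments confines the integral to a rectangle on which \<open>h\<close> is continuous, where it can be iterated.\<close>
lemma pdf_rectangle_increment:
  assumes pdf: "is_pdf_of h F" and cont: "continuous_on ({x1..x2} \<times> {y1..y2}) (\<lambda>(x, y). h x y)"
    and le: "x1 \<le> x2" "y1 \<le> y2"
  shows "F x2 y2 - F x1 y2 - F x2 y1 + F x1 y1 = integral {x1..x2} (\<lambda>x. integral {y1..y2} (h x))"
proof -
  define q where "q = (\<lambda>(x, y). h x y)"
  define f where "f x y p = indicator ({..x} \<times> {..y}) p *\<^sub>R q p" for x y p
  have int: "integrable lborel (f x y)" and F: "F x y = integral\<^sup>L lborel (f x y)" for x y
    using pdf unfolding is_pdf_of_def set_integrable_def set_lebesgue_integral_def f_def q_def by auto
  define g where "g p = f x2 y2 p - f x1 y2 p - f x2 y1 p + f x1 y1 p" for p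
  have g: "g p = indicator ({x1<..x2} \<times> {y1<..y2}) p * q p" for p
    using le by (cases p) (auto simp: g_def f_def split: split_indicator)
  have "integrable lborel g"
    unfolding g_def by (intro Bochner_Integration.integrable_add Bochner_Integration.integrable_diff int)
  then have "(g has_integral integral\<^sup>L lborel g) UNIV"
    by (rule has_integral_integral_lborel)
  also have "integral\<^sup>L lborel g = F x2 y2 - F x1 y2 - F x2 y1 + F x1 y1"
    unfolding g_def F by (simp add: int)
  finally have 1: "(g has_integral F x2 y2 - F x1 y2 - F x2 y1 + F x1 y1) UNIV" .
  \<comment> \<open>The half-open and the closed rectangle differ by two null lines.\<close>
  let ?N = "{p :: real \<times> real. p \<bullet> (1, 0) = x1} \<union> {p. p \<bullet> (0, 1) = y1}"
  have N: "negligible ?N"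
    by (intro negligible_Un negligible_standard_hyperplane) (auto simp: Basis_prod_def)
  have "((\<lambda>p. if p \<in> cbox (x1, y1) (x2, y2) then q p else 0) has_integral F x2 y2 - F x1 y2 - F x2 y1 + F x1 y1) UNIV"
    by (rule has_integral_spike[OF N _ 1]) (auto simp: g cbox_Pair_eq split: split_indicator)
  then have "(q has_integral F x2 y2 - F x1 y2 - F x2 y1 + F x1 y1) (cbox (x1, y1) (x2, y2))"
    by (simp only: has_integral_restrict_UNIV)
  then have "F x2 y2 - F x1 y2 - F x2 y1 + F x1 y1 = integral (cbox (x1, y1) (x2, y2)) q"
    by (simp add: integral_unique)
  also have "\<dots> = integral (cbox x1 x2) (\<lambda>x. integral (cbox y1 y2) (\<lambda>y. q (x, y)))"
    using cont by (intro integral_prod_continuous) (simp add: q_def cbox_Pair_eq)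
  finally show ?thesis by (simp add: q_def)
qed

text \<open>Rectangle increments are differentiated first in \<open>x\<close> and then in \<open>y\<close>. Each step is the fundamental theorem
of calculus for the continuous density \<open>h\<close>.\<close>
lemma continuous_pdf_eq_mixed_derivative:
  assumes pdf: "is_pdf_of h F" and cont: "continuous_on {(x, y). c < x \<and> c < y} (\<lambda>(x, y). h x y)"
    and P: "\<And>x y. c < x \<Longrightarrow> c < y \<Longrightarrow> ((\<lambda>x. F x y) has_real_derivative P x y) (at x)"
    and D: "\<And>x y. c < x \<Longrightarrow> c < y \<Longrightarrow> ((\<lambda>y. P x y) has_real_derivative D x y) (at y)"
    and xy: "c < x" "c < y"
  shows "h x y = D x y"
proof -
  have box: "continuous_on ({x1..x2} \<times> {y1..y2}) (\<lambda>(x, y). h x y)" if "c < x1" "c < y1" for x1 x2 y1 y2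
    using cont by (rule continuous_on_subset) (use that in auto)
  have sec: "continuous_on {y1..y2} (h x)" if "c < x" "c < y1" for x y1 y2
    using that by (intro continuous_on_compose2[OF box[of x y1 x y2], of _ "\<lambda>y. (x, y)", simplified] continuous_intros) auto
  define y1 where "y1 = (c + y) / 2"
  define x1 where "x1 = (c + x) / 2"
  have y1: "c < y1" "y1 < y" and x1: "c < x1" "x1 < x" using xy by (auto simp: x1_def y1_def)
  have P_diff: "P x y2 - P x y1 = integral {y1..y2} (h x)" if "y1 \<le> y2" for y2
  proof -
    define k where "k s = integral {y1..y2} (h s)" for s
    have "continuous_on {x1..x + 1} (\<lambda>s. integral (cbox y1 y2) (h s))"
      using box[of x1 y1 "x + 1" y2] x1 y1 by (intro integral_continuous_on_param) simp
    then have k: "continuous_on {x1..x + 1} k" by (simp add: k_def[abs_def])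
    \<comment> \<open>Both \<open>P x y2 - P x y1\<close> and \<open>k x\<close> are the derivative of \<open>R\<close> at \<open>x\<close>.\<close>
    define R where "R s = F s y2 - F s y1" for s
    have "(R has_real_derivative P x y2 - P x y1) (at x)"
      unfolding R_def using xy y1 that by (intro derivative_intros P) auto
    moreover have "(R has_real_derivative k x) (at x)"
    proof -
      have "((\<lambda>s. R x1 + integral {x1..s} k) has_real_derivative k x) (at x)"
        using DERIV_integral_interior[OF k] x1 by (auto intro!: derivative_eq_intros)
      moreover have "eventually (\<lambda>s. R x1 + integral {x1..s} k = R s) (nhds x)"
      proof -
        have "eventually (\<lambda>s. s \<in> {x1<..}) (nhds x)"
          using x1 by (intro eventually_nhds_in_open) auto
        then show ?thesis
        proof eventually_elim
          case (elim s)
          then show ?case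
            using pdf_rectangle_increment[OF pdf box, of x1 y1 s y2] x1 y1 that
            by (simp add: R_def k_def[abs_def])
        qed
      qed
      ultimately show ?thesis
        by (subst (asm) DERIV_cong_ev) auto
    qed
    ultimately show ?thesis by (metis DERIV_unique k_def)
  qed
  have "((\<lambda>y2. P x y1 + integral {y1..y2} (h x)) has_real_derivative h x y) (at y)"
    using DERIV_integral_interior[OF sec[of x y1 "y + 1"]] xy y1 by (auto intro!: derivative_eq_intros)
  moreover have "eventually (\<lambda>y2. P x y1 + integral {y1..y2} (h x) = P x y2) (nhds y)"
  proof -
    have "eventually (\<lambda>s. s \<in> {y1<..}) (nhds y)"
      using y1 by (intro eventually_nhds_in_open) auto
    then show ?thesis
    proof eventually_elim
      case (elim y2)
      then show ?case using P_diff[of y2] by simp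
    qed
  qed
  ultimately have "((\<lambda>y2. P x y2) has_real_derivative h x y) (at y)"
    by (subst (asm) DERIV_cong_ev) auto
  with D[OF xy] show ?thesis by (metis DERIV_unique)
qed

section \<open>The growth of the hypergeometric series\<close>

lemma has_bochner_integral_Gamma:
  fixes p :: real
  assumes "-1 < p"
  shows "has_bochner_integral lborel (\<lambda>w::real. indicator {0<..} w * (w powr p * exp (- w))) (Gamma (p + 1))"
proof (rule has_bochner_integral_nn_integral)
  have G: "Gamma (p + 1) > 0" using assms by (intro Gamma_real_pos) simp
  then show "0 \<le> Gamma (p + 1)" by simp
  have "ennreal (indicator {0<..} w * (w powr p * exp (- w))) = ennreal (Gamma (p + 1)) * ennreal (gamma_density 1 (p + 1) w)" for w :: real
    using G by (auto simp: gamma_density_def ennreal_mult[symmetric] split: split_indicator)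
  then have "(\<integral>\<^sup>+ w. ennreal (indicator {0<..} w * (w powr p * exp (- w))) \<partial>lborel) =
      ennreal (Gamma (p + 1)) * (\<integral>\<^sup>+ w. ennreal (gamma_density 1 (p + 1) w) \<partial>lborel)"
    by (simp add: nn_integral_cmult)
  then show "(\<integral>\<^sup>+ w. ennreal (indicator {0<..} w * (w powr p * exp (- w))) \<partial>lborel) = ennreal (Gamma (p + 1))"
    using assms nn_integral_gamma_density[of "p + 1" 1] by simp
qed auto

text \<open>Euler's integral: up to a constant, \<open>1 / (a)_k\<close> is a Beta integral divided by \<open>(1/2)_k\<close>, and \<open>k! (1/2)_k = (2k)! / 4^k\<close> turns the
series under the integral into that of the hyperbolic cosine.\<close>
lemma hyp0F1_Beta_integral:
  assumes a: "1 \<le> a" and z: "0 < z"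
  shows "(\<integral>\<^sup>+ t. ennreal (indicator {0<..<1} t * (t powr (- 1/2) * (1 - t) powr (a - 3/2) * cosh (z * sqrt t))) \<partial>lborel) =
    ennreal (sqrt pi * Gamma (a - 1/2) / Gamma a * hyp0F1 a (z\<^sup>2 / 4))"
proof -
  let ?h = "\<lambda>t. ennreal (indicator {0<..<1} t * (t powr (- 1/2) * (1 - t) powr (a - 3/2) * cosh (z * sqrt t)))"
  have G: "Gamma a > 0" "Gamma (a - 1/2) > 0" using a by (auto intro!: Gamma_real_pos)
  define c where "c k = z ^ (2 * k) / fact (2 * k)" for k
  have c0: "0 \<le> c k" for k using z by (simp add: c_def)
  define q where "q k t = indicator {0<..<1} t * (t powr (real k + 1/2 - 1) * (1 - t) powr (a - 1/2 - 1))" for k and t :: real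
  have [measurable]: "q k \<in> borel_measurable borel" for k unfolding q_def by measurable
  have q0: "0 \<le> q k t" for k t by (auto simp: q_def)
  have "(\<integral>\<^sup>+ t. ?h t \<partial>lborel) =
      (\<integral>\<^sup>+ t. (\<Sum>k. ennreal (c k) * ennreal (q k t)) \<partial>lborel)"
  proof (rule nn_integral_cong)
    fix t :: real
    have "(\<Sum>k. ennreal (c k * q k t)) =
       ?h t"
    proof (rule suminf_ennreal_eq)
      have "c k * q k t = indicator {0<..<1} t * (t powr (- 1/2) * (1 - t) powr (a - 3/2)) * ((z * sqrt t) ^ (2 * k) / fact (2 * k))" for k
      proof (cases "t \<in> {0<..<1}")
        case True
        have 1: "t powr (real k + 1/2 - 1) = t powr (- 1/2) * t ^ k"
          using True powr_add[of t "real k" "- 1/2"] by (simp add: powr_realpow)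
        have 2: "(z * sqrt t) ^ (2 * k) = z ^ (2 * k) * t ^ k"
          using True by (simp add: power_mult_distrib power_mult)
        have 3: "a - 1/2 - 1 = a - 3/2" by simp
        show ?thesis unfolding c_def q_def 1 2 3 by simp
      qed (simp add: q_def)
      then have "(\<lambda>k. c k * q k t) sums (indicator {0<..<1} t * (t powr (- 1/2) * (1 - t) powr (a - 3/2)) * cosh (z * sqrt t))"
        by (simp only: sums_mult cosh_sums_even)
      then show "(\<lambda>k. c k * q k t) sums (indicator {0<..<1} t * (t powr (- 1/2) * (1 - t) powr (a - 3/2) * cosh (z * sqrt t)))"
        by (simp add: mult.assoc)
    qed (use c0 q0 in auto)
    then show "?h t =
        (\<Sum>k. ennreal (c k) * ennreal (q k t))"
      by (simp add: ennreal_mult c0 q0)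
  qed
  also have "\<dots> = (\<Sum>k. ennreal (c k) * (\<integral>\<^sup>+ t. ennreal (q k t) \<partial>lborel))"
    by (subst nn_integral_suminf) (auto simp: nn_integral_cmult)
  also have "\<dots> = (\<Sum>k. ennreal (c k * Beta (real k + 1/2) (a - 1/2)))"
  proof (rule suminf_cong)
    fix k
    have "(\<integral>\<^sup>+ t. ennreal (q k t) \<partial>lborel) = ennreal (Beta (real k + 1/2) (a - 1/2))"
      unfolding q_def
    proof (rule nn_integral_has_integral_lebesgue)
      show "((\<lambda>t. t powr (real k + 1/2 - 1) * (1 - t) powr (a - 1/2 - 1)) has_integral Beta (real k + 1/2) (a - 1/2)) {0<..<1}"
        using has_integral_Beta_real[of "real k + 1/2" "a - 1/2"] a by (simp add: has_integral_Icc_iff_Ioo)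
    qed auto
    then show "ennreal (c k) * (\<integral>\<^sup>+ t. ennreal (q k t) \<partial>lborel) = ennreal (c k * Beta (real k + 1/2) (a - 1/2))"
      by (simp add: ennreal_mult' c0)
  qed
  also have "\<dots> = ennreal (sqrt pi * Gamma (a - 1/2) / Gamma a * hyp0F1 a (z\<^sup>2 / 4))"
  proof (rule suminf_ennreal_eq)
    have eq: "c k * Beta (real k + 1/2) (a - 1/2) = sqrt pi * Gamma (a - 1/2) / Gamma a * ((z\<^sup>2 / 4) ^ k / (fact k * pochhammer a k))" for k
    proof -
      have "(1/2::real) \<notin> \<int>\<^sub>\<le>\<^sub>0" "a \<notin> \<int>\<^sub>\<le>\<^sub>0" using a by (auto elim!: nonpos_Ints_cases)
      then have Gam: "Gamma (real k + 1/2) = sqrt pi * pochhammer (1/2) k" "Gamma (real k + 1/2 + (a - 1/2)) = Gamma a * pochhammer a k"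
        using pochhammer_Gamma[of "1/2::real" k] pochhammer_Gamma[of a k] G by (simp_all add: Gamma_one_half_real add.commute)
      have P: "pochhammer a k > 0" "pochhammer (1/2) k > (0::real)" using a by (auto intro!: pochhammer_pos)
      have F: "fact (2 * k) = (4 ^ k * pochhammer (1/2) k * fact k :: real)"
        using fact_double[of k, where ?'a=real] by (simp add: power_mult)
      show ?thesis
        unfolding c_def Beta_def Gam F using G P by (simp add: field_simps power_mult power_divide flip: power_mult)
    qed
    show "(\<lambda>k. c k * Beta (real k + 1/2) (a - 1/2)) sums (sqrt pi * Gamma (a - 1/2) / Gamma a * hyp0F1 a (z\<^sup>2 / 4))"
      unfolding eq hyp0F1_def by (intro sums_mult summable_sums summable_hyp0F1 a)
    show "0 \<le> c k * Beta (real k + 1/2) (a - 1/2)" for k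
      using a c0[of k] by (auto simp: Beta_def intro!: mult_nonneg_nonneg divide_nonneg_nonneg Gamma_real_nonneg)
  qed
  finally show ?thesis .
qed

text \<open>After \<open>t = x\<^sup>2\<close> the mass of the integral sits at \<open>x = 1\<close> for large \<open>z\<close>. The substitution \<open>x = 1 - w / z\<close> magnifies
that end point, and the powers of \<open>z\<close> on the left are exactly those that it releases.\<close>
lemma hyp0F1_Laplace_integral:
  assumes a: "1 \<le> a" and z: "0 < z"
  shows "hyp0F1 a (z\<^sup>2 / 4) * exp (- z) * z powr (a - 1/2) * (sqrt pi * Gamma (a - 1/2) / Gamma a) =
    (\<integral>w. indicator {0<..<z} w * ((w * (2 - w / z)) powr (a - 3/2) * (exp (- w) + exp (w - 2 * z))) \<partial>lborel)"
proof -
  define p where "p = a - 3/2"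
  have G: "Gamma a > 0" "Gamma (a - 1/2) > 0" using a by (auto intro!: Gamma_real_pos)
  define f where "f x = indicator {..<1} x * (2 * (1 - x\<^sup>2) powr p * cosh (z * x))" for x :: real
  let ?h = "\<lambda>t. ennreal (indicator {0<..<1} t * (t powr (- 1/2) * (1 - t) powr (a - 3/2) * cosh (z * sqrt t)))"
  let ?W = "\<lambda>w. ennreal (indicator {0<..<z} w * ((w * (2 - w / z)) powr p * (exp (- w) + exp (w - 2 * z))))"
  let ?U = "\<lambda>w. ennreal (f (1 + (- 1 / z) * w)) * indicator {0<..} (1 + (- 1 / z) * w)"
  have [measurable]: "f \<in> borel_measurable borel" unfolding f_def cosh_def by measurable
  have f0: "0 \<le> f x" for x by (auto simp: f_def)
  \<comment> \<open>The normalising factor is moved under the integral.\<close>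
  define e where "e = exp (- z) * z powr (a - 1/2)"
  have e0: "0 \<le> e" by (simp add: e_def)
  have "(\<integral>\<^sup>+ t. ?h t \<partial>lborel) =
     (\<integral>\<^sup>+ t. ennreal (f (sqrt t)) * ennreal (1 / (2 * sqrt t)) * indicator {0<..} t \<partial>lborel)"
  proof (rule nn_integral_cong)
    fix t :: real
    show "?h t =
        ennreal (f (sqrt t)) * ennreal (1 / (2 * sqrt t)) * indicator {0<..} t"
    proof (cases "0 < t \<and> t < 1")
      case True
      have "t powr (- 1/2) = 1 / sqrt t"
        using True powr_minus[of t "1/2"] by (simp add: powr_half_sqrt field_simps)
      then have "t powr (- 1/2) * (1 - t) powr (a - 3/2) * cosh (z * sqrt t) = f (sqrt t) * (1 / (2 * sqrt t))"
        using True by (simp add: f_def p_def)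
      then show ?thesis using True f0 by (simp add: ennreal_mult del: times_divide_eq_right)
    qed (auto simp: f_def split: split_indicator)
  qed
  also have "\<dots> = (\<integral>\<^sup>+ x. ennreal (f x) * indicator {0<..} x \<partial>lborel)"
    by (rule nn_integral_sqrt_substitution[symmetric]) measurable
  also have "\<dots> = ennreal \<bar>- 1 / z\<bar> * (\<integral>\<^sup>+ w. ?U w \<partial>lborel)"
    using z by (intro nn_integral_real_affine) auto
  finally have "ennreal (sqrt pi * Gamma (a - 1/2) / Gamma a * hyp0F1 a (z\<^sup>2 / 4)) =
      ennreal (1 / z) * (\<integral>\<^sup>+ w. ?U w \<partial>lborel)"
    using hyp0F1_Beta_integral[OF a z] z by simp
  then have "ennreal e * ennreal (sqrt pi * Gamma (a - 1/2) / Gamma a * hyp0F1 a (z\<^sup>2 / 4)) =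
      ennreal (e / z) * (\<integral>\<^sup>+ w. ?U w \<partial>lborel)"
    using e0 z by (simp add: mult.assoc[symmetric] ennreal_mult[symmetric])
  also have "\<dots> = (\<integral>\<^sup>+ w. ennreal (e / z) * (?U w) \<partial>lborel)"
    by (rule nn_integral_cmult[symmetric]) measurable
  also have "\<dots> = (\<integral>\<^sup>+ w. ?W w \<partial>lborel)"
  proof (rule nn_integral_cong)
    fix w :: real
    show "ennreal (e / z) * (?U w) =
       ?W w"
    proof (cases "0 < w \<and> w < z")
      case True
      have sq: "1 - (1 + (- 1 / z) * w)\<^sup>2 = (w * (2 - w / z)) / z"
        using z by (simp add: power2_eq_square field_simps)
      have pos: "0 < w * (2 - w / z)" using True by (intro mult_pos_pos) (auto simp: field_simps)
      have zz: "z powr (a - 1/2) = z * z powr p"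
        using z powr_add[of z 1 p] by (simp add: p_def)
      have ch: "exp (- z) * (2 * cosh (z * (1 + (- 1 / z) * w))) = exp (- w) + exp (w - 2 * z)"
      proof -
        have "z * (1 + (- 1 / z) * w) = z - w" using z by (simp add: field_simps)
        then show ?thesis by (simp add: cosh_def distrib_left flip: exp_add)
      qed
      have "e / z * f (1 + (- 1 / z) * w) = z powr p * ((w * (2 - w / z)) / z) powr p * (exp (- z) * (2 * cosh (z * (1 + (- 1 / z) * w))))"
        using True z unfolding f_def sq e_def zz by (simp add: field_simps)
      also have "z powr p * ((w * (2 - w / z)) / z) powr p = (w * (2 - w / z)) powr p"
        using z pos by (simp add: powr_divide)
      finally have *: "e / z * f (1 + (- 1 / z) * w) = (w * (2 - w / z)) powr p * (exp (- w) + exp (w - 2 * z))"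
        unfolding ch .
      have "0 < 1 + (- 1 / z) * w" using True by (simp add: field_simps)
      then show ?thesis
        using True z e0 f0 *[symmetric] by (simp add: ennreal_mult[symmetric])
    next
      case False
      then have "\<not> (0 < 1 + (- 1 / z) * w \<and> 1 + (- 1 / z) * w < 1)"
        using z by (auto simp: field_simps)
      then show ?thesis using False by (auto simp: f_def split: split_indicator)
    qed
  qed
  finally have nn: "ennreal (e * (sqrt pi * Gamma (a - 1/2) / Gamma a * hyp0F1 a (z\<^sup>2 / 4))) =
      (\<integral>\<^sup>+ w. ?W w \<partial>lborel)"
    by (simp only: ennreal_mult'[OF e0])
  have "0 \<le> hyp0F1 a (z\<^sup>2 / 4)" using a by (intro hyp0F1_nonneg) auto
  then have "0 \<le> e * (sqrt pi * Gamma (a - 1/2) / Gamma a * hyp0F1 a (z\<^sup>2 / 4))"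
    using e0 G by (intro mult_nonneg_nonneg divide_nonneg_nonneg) auto
  moreover have "(\<integral>w. indicator {0<..<z} w * ((w * (2 - w / z)) powr p * (exp (- w) + exp (w - 2 * z))) \<partial>lborel) =
      enn2real (\<integral>\<^sup>+ w. ?W w \<partial>lborel)"
    by (rule integral_eq_nn_integral) auto
  ultimately have "e * (sqrt pi * Gamma (a - 1/2) / Gamma a * hyp0F1 a (z\<^sup>2 / 4)) =
      (\<integral>w. indicator {0<..<z} w * ((w * (2 - w / z)) powr p * (exp (- w) + exp (w - 2 * z))) \<partial>lborel)"
    unfolding nn[symmetric] by (simp only: enn2real_ennreal)
  then show ?thesis
    unfolding p_def e_def by (simp add: mult_ac)
qed

text \<open>As \<open>z\<close> grows, the integrand of the previous lemma converges to \<open>(2 w) powr (a - 3/2) * exp (- w)\<close>. Since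
\<open>w \<le> w (2 - w / z) \<le> 2 w\<close>, a multiple of the limit dominates, whatever the sign of \<open>a - 3/2\<close>.\<close>
lemma hyp0F1_asymptotics:
  assumes a: "1 \<le> a"
  shows "((\<lambda>z. hyp0F1 a (z\<^sup>2 / 4) * exp (- z) * z powr (a - 1/2)) \<longlongrightarrow> Gamma a * 2 powr (a - 3/2) / sqrt pi) at_top"
proof -
  define p where "p = a - 3/2"
  have p: "-1 < p" using a by (simp add: p_def)
  have G: "Gamma a > 0" "Gamma (a - 1/2) > 0" using a by (auto intro!: Gamma_real_pos)
  define C where "C = sqrt pi * Gamma (a - 1/2) / Gamma a"
  have C: "C \<noteq> 0" using G by (simp add: C_def)
  define s where "s z w = indicator {0<..<z} w * ((w * (2 - w / z)) powr p * (exp (- w) + exp (w - 2 * z)))" for z w :: real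
  define f where "f w = indicator {0<..} w * ((2 * w) powr p * exp (- w))" for w :: real
  define W where "W w = 2 * (1 + 2 powr p) * (indicator {0<..} w * (w powr p * exp (- w)))" for w :: real
  note Gint = has_bochner_integral_Gamma[OF p]
  have f_eq: "f w = 2 powr p * (indicator {0<..} w * (w powr p * exp (- w)))" for w
    by (auto simp: f_def powr_mult split: split_indicator)
  have "((\<lambda>z. integral\<^sup>L lborel (s z)) \<longlongrightarrow> integral\<^sup>L lborel f) at_top"
  proof (rule integral_dominated_convergence_at_top)
    show "f \<in> borel_measurable lborel" "\<And>z. s z \<in> borel_measurable lborel"
      unfolding f_def s_def by measurable
    show "integrable lborel W"
      unfolding W_def using Gint by (intro integrable_mult_right) (simp add: has_bochner_integral_iff)
    show "AE w in lborel. ((\<lambda>z. s z w) \<longlongrightarrow> f w) at_top"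
    proof (rule AE_I2)
      fix w :: real
      show "((\<lambda>z. s z w) \<longlongrightarrow> f w) at_top"
      proof (cases "0 < w")
        case False
        then show ?thesis by (simp add: s_def f_def)
      next
        case True
        have "((\<lambda>z. (w * (2 - w / z)) powr p * (exp (- w) + exp (w - 2 * z))) \<longlongrightarrow> (w * (2 - 0)) powr p * (exp (- w) + 0)) at_top"
        proof (intro tendsto_intros)
          show "((\<lambda>z. w / z) \<longlongrightarrow> 0) at_top"
            by (rule tendsto_divide_0[OF tendsto_const]) (rule filterlim_at_top_imp_at_infinity[OF filterlim_ident])
          have "filterlim (\<lambda>z::real. w - 2 * z) at_bot at_top"
            by real_asymp
          then show "((\<lambda>z. exp (w - 2 * z)) \<longlongrightarrow> 0) at_top"
            by (rule filterlim_compose[OF exp_at_bot])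
        qed (use True in auto)
        moreover have "eventually (\<lambda>z. (w * (2 - w / z)) powr p * (exp (- w) + exp (w - 2 * z)) = s z w) at_top"
          using eventually_gt_at_top[of w] by eventually_elim (use True in \<open>simp add: s_def\<close>)
        ultimately have "((\<lambda>z. s z w) \<longlongrightarrow> (w * (2 - 0)) powr p * (exp (- w) + 0)) at_top"
          by (rule Lim_transform_eventually)
        then show ?thesis using True by (simp add: f_def mult.commute)
      qed
    qed
    show "eventually (\<lambda>z. AE w in lborel. norm (s z w) \<le> W w) at_top"
    proof (intro always_eventually allI AE_I2)
      fix z w :: real
      show "norm (s z w) \<le> W w"
      proof (cases "0 < w \<and> w < z")
        case False
        then show ?thesis by (auto simp: s_def W_def split: split_indicator)
      next
        case True
        have lo: "w \<le> w * (2 - w / z)" and hi: "w * (2 - w / z) \<le> 2 * w"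
          using True by (auto simp: field_simps)
        have "(w * (2 - w / z)) powr p \<le> w powr p + (2 * w) powr p"
        proof (cases "0 \<le> p")
          case True
          have "(w * (2 - w / z)) powr p \<le> (2 * w) powr p"
            using True hi order_trans[OF _ lo, of 0] \<open>0 < w \<and> w < z\<close> by (intro powr_mono2) auto
          then show ?thesis by (simp add: add_increasing)
        next
          case False
          have "(w * (2 - w / z)) powr p \<le> w powr p"
            using False hi lo \<open>0 < w \<and> w < z\<close> by (intro powr_mono2') auto
          then show ?thesis by (simp add: add_increasing2)
        qed
        also have "\<dots> = (1 + 2 powr p) * w powr p" by (simp add: powr_mult distrib_right)
        finally have 1: "(w * (2 - w / z)) powr p \<le> (1 + 2 powr p) * w powr p" .
        have 2: "exp (- w) + exp (w - 2 * z) \<le> 2 * exp (- w)" using True by simp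
        have "s z w \<le> ((1 + 2 powr p) * w powr p) * (2 * exp (- w))"
          using True mult_mono[OF 1 2] by (simp add: s_def add_nonneg_nonneg)
        moreover have "0 \<le> s z w" by (auto simp: s_def add_nonneg_nonneg split: split_indicator)
        ultimately show ?thesis using True by (simp add: W_def algebra_simps)
      qed
    qed
  qed
  also have "integral\<^sup>L lborel f = 2 powr p * Gamma (a - 1/2)"
    unfolding f_eq using Gint by (simp add: has_bochner_integral_iff p_def)
  finally have "((\<lambda>z. integral\<^sup>L lborel (s z) / C) \<longlongrightarrow> 2 powr p * Gamma (a - 1/2) / C) at_top"
    by (intro tendsto_intros) (use C in auto)
  moreover have "eventually (\<lambda>z. integral\<^sup>L lborel (s z) / C = hyp0F1 a (z\<^sup>2 / 4) * exp (- z) * z powr (a - 1/2)) at_top"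
    using eventually_gt_at_top[of 0]
  proof eventually_elim
    case (elim z)
    then show ?case
      using hyp0F1_Laplace_integral[OF a elim] C unfolding s_def[abs_def] p_def C_def by (simp add: field_simps)
  qed
  ultimately have "((\<lambda>z. hyp0F1 a (z\<^sup>2 / 4) * exp (- z) * z powr (a - 1/2)) \<longlongrightarrow> 2 powr p * Gamma (a - 1/2) / C) at_top"
    by (rule Lim_transform_eventually)
  moreover have "2 powr p * Gamma (a - 1/2) / C = Gamma a * 2 powr (a - 3/2) / sqrt pi"
    using G by (simp add: C_def p_def field_simps)
  ultimately show ?thesis by simp
qed

section \<open>The Huesler-Reiss distribution\<close>

text \<open>The two ingredients of the limit law: \<open>HR_partial l x y + HR_partial l y x\<close> is its exponent, and \<open>HR_density\<close>
is the negative of the mixed derivative of the exponent, the density of the exponent measure.\<close>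
definition HR_partial :: "real \<Rightarrow> real \<Rightarrow> real \<Rightarrow> real" where
  "HR_partial l x y = exp (- x) * std_normal_cdf (sqrt l / 2 + (y - x) / sqrt l)"

definition HR_density :: "real \<Rightarrow> real \<Rightarrow> real \<Rightarrow> real" where
  "HR_density l x y = exp (- x) * (1 / sqrt l * std_normal_density (sqrt l / 2 + (y - x) / sqrt l))"

lemma HR_cdf_eq: "HR_cdf l x y = exp (- (HR_partial l x y + HR_partial l y x))"
  by (simp add: HR_cdf_def HR_partial_def)

lemma HR_pdf_eq: "HR_pdf l x y = HR_cdf l x y * (HR_density l x y + HR_partial l x y * HR_partial l y x)"
  by (simp add: HR_pdf_def HR_density_def HR_partial_def algebra_simps)

lemma HR_density_nonneg: "0 < l \<Longrightarrow> 0 \<le> HR_density l x y"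
  by (simp add: HR_density_def)

text \<open>Completing the square makes the symmetry in \<open>x\<close> and \<open>y\<close> visible.\<close>
lemma HR_density_eq:
  assumes "0 < l"
  shows "HR_density l x y = exp (- (x + y) / 2 - l / 8 - (x - y)\<^sup>2 / (2 * l)) / sqrt (2 * pi) / sqrt l"
proof -
  have square: "(q / 2 + d / q)\<^sup>2 = q\<^sup>2 / 4 + d + d\<^sup>2 / q\<^sup>2" if "q \<noteq> 0" for q d :: real
    using that by (simp add: power2_eq_square field_simps)
  have "(sqrt l / 2 + (y - x) / sqrt l)\<^sup>2 = (sqrt l)\<^sup>2 / 4 + (y - x) + (y - x)\<^sup>2 / (sqrt l)\<^sup>2"
    using assms by (intro square) simp
  also have "\<dots> = l / 4 + (y - x) + (x - y)\<^sup>2 / l"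
    using assms by (simp add: power2_commute)
  finally have "- x + - (sqrt l / 2 + (y - x) / sqrt l)\<^sup>2 / 2 = - (x + y) / 2 - l / 8 - (x - y)\<^sup>2 / (2 * l)"
    by (simp only:) (simp add: field_simps)
  then have "exp (- (x + y) / 2 - l / 8 - (x - y)\<^sup>2 / (2 * l)) = exp (- x) * exp (- (sqrt l / 2 + (y - x) / sqrt l)\<^sup>2 / 2)"
    by (simp only: exp_add[symmetric])
  then show ?thesis
    by (simp add: HR_density_def std_normal_density_def)
qed

lemma HR_density_commute: "0 < l \<Longrightarrow> HR_density l x y = HR_density l y x"
  by (simp add: HR_density_eq power2_commute add.commute)

lemma DERIV_std_normal_cdf: "(std_normal_cdf has_real_derivative std_normal_density z) (at z)"
proof -
  interpret N: real_distribution N01 by (rule real_dist_normal_dist)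
  have cont: "continuous_on {z - 1..z + 1} std_normal_density"
    unfolding std_normal_density_def by (intro continuous_intros) auto
  have eq: "std_normal_cdf (z - 1) + integral {z - 1..y} std_normal_density = std_normal_cdf y" if "z - 1 < y" for y
  proof -
    have "continuous_on {z - 1..y} std_normal_density"
      unfolding std_normal_density_def by (intro continuous_intros) auto
    then have int: "(std_normal_density has_integral integral {z - 1..y} std_normal_density) {z - 1..y}"
      by (intro integrable_integral integrable_continuous_real)
    have "emeasure N01 {z - 1<..y} = (\<integral>\<^sup>+ x. ennreal (std_normal_density x) * indicator {z - 1<..y} x \<partial>lborel)"
      by (subst emeasure_density) auto
    also have "\<dots> = (\<integral>\<^sup>+ x. ennreal (indicator {z - 1..y} x * std_normal_density x) \<partial>lborel)"
    proof (rule nn_integral_cong_AE)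
      show "AE x in lborel. ennreal (std_normal_density x) * indicator {z - 1<..y} x = ennreal (indicator {z - 1..y} x * std_normal_density x)"
        using AE_lborel_singleton[of "z - 1"] by eventually_elim (auto split: split_indicator)
    qed
    also have "\<dots> = ennreal (integral {z - 1..y} std_normal_density)"
      by (rule nn_integral_has_integral_lebesgue[OF _ int]) simp
    finally have "measure N01 {z - 1<..y} = integral {z - 1..y} std_normal_density"
      by (simp add: measure_def has_integral_nonneg[OF int])
    then show ?thesis using N.cdf_diff_eq[OF that] by simp
  qed
  have "((\<lambda>y. std_normal_cdf (z - 1) + integral {z - 1..y} std_normal_density) has_real_derivative std_normal_density z) (at z)"
    using DERIV_integral_interior[OF cont, of z] by (auto intro!: derivative_eq_intros)
  moreover have "eventually (\<lambda>y. std_normal_cdf (z - 1) + integral {z - 1..y} std_normal_density = std_normal_cdf y) (nhds z)"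
  proof -
    have "eventually (\<lambda>y. y \<in> {z - 1<..}) (nhds z)" by (intro eventually_nhds_in_open) auto
    then show ?thesis by eventually_elim (use eq in auto)
  qed
  ultimately show ?thesis by (subst (asm) DERIV_cong_ev) auto
qed

lemma std_normal_cdf_nonneg: "0 \<le> std_normal_cdf z"
  by (simp add: cdf_def)

lemma HR_partial_nonneg: "0 \<le> HR_partial l x y"
  by (simp add: HR_partial_def std_normal_cdf_nonneg)

lemma measurable_std_normal_cdf [measurable]: "std_normal_cdf \<in> borel_measurable borel"
  by (intro borel_measurable_continuous_onI DERIV_continuous_on) (auto intro: DERIV_std_normal_cdf)

lemma HR_partial_tendsto: "0 < l \<Longrightarrow> ((\<lambda>y. HR_partial l x y) \<longlongrightarrow> exp (- x)) at_top"
proof -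
  assume l: "0 < l"
  interpret N: real_distribution N01 by (rule real_dist_normal_dist)
  have "filterlim (\<lambda>y. (sqrt l / 2 - x / sqrt l) + (1 / sqrt l) * y) at_top at_top"
    using l by (intro filterlim_tendsto_add_at_top[OF tendsto_const]
      filterlim_tendsto_pos_mult_at_top[OF tendsto_const _ filterlim_ident]) auto
  moreover have "(\<lambda>y. (sqrt l / 2 - x / sqrt l) + (1 / sqrt l) * y) = (\<lambda>y. sqrt l / 2 + (y - x) / sqrt l)"
    by (simp add: diff_divide_distrib algebra_simps)
  ultimately have "filterlim (\<lambda>y. sqrt l / 2 + (y - x) / sqrt l) at_top at_top" by simp
  then have "((\<lambda>y. std_normal_cdf (sqrt l / 2 + (y - x) / sqrt l)) \<longlongrightarrow> 1) at_top"
    by (rule filterlim_compose[OF N.cdf_lim_at_top_prob])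
  from tendsto_mult[OF tendsto_const this, of "exp (- x)"] show ?thesis by (simp add: HR_partial_def)
qed

lemma nn_integral_HR_density_Iic:
  assumes l: "0 < l"
  shows "(\<integral>\<^sup>+ t. ennreal (HR_density l x t) * indicator {..y} t \<partial>lborel) = ennreal (HR_partial l x y)"
proof -
  interpret N: real_distribution N01 by (rule real_dist_normal_dist)
  define c where "c = sqrt l / 2 - x / sqrt l"
  have z: "sqrt l / 2 + (t - x) / sqrt l = c + (1 / sqrt l) * t" for t by (simp add: c_def diff_divide_distrib)
  define z where "z = c + (1 / sqrt l) * y"
  have "ennreal (std_normal_cdf z) = emeasure N01 {..z}"
    by (simp add: cdf_def N.emeasure_eq_measure)
  also have "\<dots> = (\<integral>\<^sup>+ t. ennreal (std_normal_density t) * indicator {..z} t \<partial>lborel)"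
    by (subst emeasure_density) auto
  also have "\<dots> = ennreal \<bar>1 / sqrt l\<bar> * (\<integral>\<^sup>+ t. ennreal (std_normal_density (c + (1 / sqrt l) * t)) * indicator {..z} (c + (1 / sqrt l) * t) \<partial>lborel)"
    using l by (intro nn_integral_real_affine) auto
  finally have 1: "ennreal (std_normal_cdf z) = ennreal (1 / sqrt l) * (\<integral>\<^sup>+ t. ennreal (std_normal_density (c + (1 / sqrt l) * t)) * indicator {..z} (c + (1 / sqrt l) * t) \<partial>lborel)"
    using l by simp
  have "ennreal (HR_partial l x y) = ennreal (exp (- x)) * ennreal (std_normal_cdf z)"
    unfolding HR_partial_def z z_def by (simp add: ennreal_mult std_normal_cdf_nonneg)
  also have "\<dots> = ennreal (exp (- x) * (1 / sqrt l)) * (\<integral>\<^sup>+ t. ennreal (std_normal_density (c + (1 / sqrt l) * t)) * indicator {..z} (c + (1 / sqrt l) * t) \<partial>lborel)"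
    unfolding 1 using l by (simp add: ennreal_mult' mult.assoc del: times_divide_eq_right mult_1_right)
  also have "\<dots> = (\<integral>\<^sup>+ t. ennreal (exp (- x) * (1 / sqrt l)) * (ennreal (std_normal_density (c + (1 / sqrt l) * t)) * indicator {..z} (c + (1 / sqrt l) * t)) \<partial>lborel)"
    by (rule nn_integral_cmult[symmetric]) measurable
  also have "\<dots> = (\<integral>\<^sup>+ t. ennreal (HR_density l x t) * indicator {..y} t \<partial>lborel)"
  proof (rule nn_integral_cong)
    fix t :: real
    have "c + (1 / sqrt l) * t \<le> z \<longleftrightarrow> t \<le> y" using l by (simp add: z_def field_simps)
    then show "ennreal (exp (- x) * (1 / sqrt l)) * (ennreal (std_normal_density (c + (1 / sqrt l) * t)) * indicator {..z} (c + (1 / sqrt l) * t)) =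
        ennreal (HR_density l x t) * indicator {..y} t"
      using l unfolding HR_density_def z by (auto simp: ennreal_mult[symmetric] mult.assoc split: split_indicator)
  qed
  finally show ?thesis by simp
qed

lemma nn_integral_HR_density:
  assumes l: "0 < l"
  shows "(\<integral>\<^sup>+ t. ennreal (HR_density l x t) \<partial>lborel) = ennreal (exp (- x))"
proof -
  have [measurable]: "HR_density l x \<in> borel_measurable borel"
    unfolding HR_density_def[abs_def] by measurable
  have "(\<lambda>n. \<integral>\<^sup>+ t. ennreal (HR_density l x t) * indicator {..real n} t \<partial>lborel) \<longlonglongrightarrow> (\<integral>\<^sup>+ t. ennreal (HR_density l x t) \<partial>lborel)"
  proof (rule nn_integral_LIMSEQ)
    show "incseq (\<lambda>n t. ennreal (HR_density l x t) * indicator {..real n} t)"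
      by (auto simp: incseq_def le_fun_def split: split_indicator)
    fix t :: real
    obtain N where "t \<le> real N" using real_arch_simple by blast
    then have "eventually (\<lambda>n. ennreal (HR_density l x t) * indicator {..real n} t = ennreal (HR_density l x t)) sequentially"
      by (auto intro!: eventually_sequentiallyI[of N])
    then show "(\<lambda>n. ennreal (HR_density l x t) * indicator {..real n} t) \<longlonglongrightarrow> ennreal (HR_density l x t)"
      by (rule tendsto_eventually)
  qed measurable
  moreover have "(\<lambda>n. ennreal (HR_partial l x (real n))) \<longlonglongrightarrow> ennreal (exp (- x))"
    by (intro tendsto_ennrealI filterlim_compose[OF HR_partial_tendsto[OF l] filterlim_real_sequentially])
  ultimately show ?thesis
    unfolding nn_integral_HR_density_Iic[OF l] by (rule LIMSEQ_unique)
qed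

lemma DERIV_HR_partial:
  assumes "0 < l"
  shows "((\<lambda>t. HR_partial l x t) has_real_derivative HR_density l x t) (at t)"
    and "((\<lambda>t. HR_partial l t x) has_real_derivative (- HR_partial l t x - HR_density l t x)) (at t)"
proof -
  have q: "sqrt l \<noteq> 0" using assms by simp
  have inner: "((\<lambda>t. c + (t - x) / q) has_real_derivative 1 / q) (at t)"
    "((\<lambda>t. c + (x - t) / q) has_real_derivative - (1 / q)) (at t)" if "q \<noteq> 0" for c q :: real
    using that by (auto intro!: derivative_eq_intros simp: field_simps)
  have "((\<lambda>t. sqrt l / 2 + (t - x) / sqrt l) has_real_derivative 1 / sqrt l) (at t)"
    by (rule inner(1)[OF q])
  from DERIV_cmult[OF DERIV_chain2[OF DERIV_std_normal_cdf this], of "exp (- x)"]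
  show "((\<lambda>t. HR_partial l x t) has_real_derivative HR_density l x t) (at t)"
    by (simp add: HR_partial_def HR_density_def)
  have "((\<lambda>t. sqrt l / 2 + (x - t) / sqrt l) has_real_derivative - (1 / sqrt l)) (at t)"
    by (rule inner(2)[OF q])
  note d = DERIV_chain2[OF DERIV_std_normal_cdf this]
  have "((\<lambda>t. exp (- t)) has_real_derivative - exp (- t)) (at t)"
    by (auto intro!: derivative_eq_intros)
  from DERIV_mult[OF this d]
  show "((\<lambda>t. HR_partial l t x) has_real_derivative (- HR_partial l t x - HR_density l t x)) (at t)"
    unfolding HR_partial_def HR_density_def by (rule DERIV_cong) (simp add: algebra_simps)
qed

lemma HR_partial_tendsto_0: "((\<lambda>t. HR_partial l t x) \<longlongrightarrow> 0) at_top"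
proof (rule tendsto_sandwich[OF _ _ tendsto_const])
  interpret N: real_distribution N01 by (rule real_dist_normal_dist)
  show "((\<lambda>t::real. exp (- t)) \<longlongrightarrow> 0) at_top"
    by (rule filterlim_compose[OF exp_at_bot filterlim_uminus_at_bot_at_top])
  show "eventually (\<lambda>t. HR_partial l t x \<le> exp (- t)) at_top"
    unfolding HR_partial_def using N.cdf_bounded_prob by (intro always_eventually allI mult_left_le) auto
qed (simp add: HR_partial_nonneg)

text \<open>The two normal density terms cancel by the symmetry of \<open>HR_density\<close>.\<close>
lemma DERIV_HR_exponent:
  assumes l: "0 < l"
  shows "((\<lambda>t. - (HR_partial l x t + HR_partial l t x)) has_real_derivative HR_partial l t x) (at t)"
proof -
  have "((\<lambda>t. - (HR_partial l x t + HR_partial l t x)) has_real_derivative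
      (- (HR_density l x t + (- HR_partial l t x - HR_density l t x)))) (at t)"
    by (intro DERIV_minus DERIV_add DERIV_HR_partial[OF l])
  then show ?thesis by (simp add: HR_density_commute[OF l, of x])
qed

lemma nn_integral_HR_partial_Ici:
  assumes l: "0 < l"
  shows "(\<integral>\<^sup>+ t. ennreal (HR_partial l t x) * indicator {y..} t \<partial>lborel) =
    ennreal (HR_partial l x y + HR_partial l y x - exp (- x))"
proof -
  have [measurable]: "(\<lambda>t. HR_partial l t x) \<in> borel_measurable borel"
    unfolding HR_partial_def by measurable
  have "((\<lambda>t. - (HR_partial l x t + HR_partial l t x)) \<longlongrightarrow> - (exp (- x) + 0)) at_top"
    by (intro tendsto_intros HR_partial_tendsto HR_partial_tendsto_0 l)
  then have "(\<integral>\<^sup>+ t. ennreal (HR_partial l t x) * indicator {y..} t \<partial>lborel) =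
      ennreal (- (exp (- x) + 0) - - (HR_partial l x y + HR_partial l y x))"
    by (intro nn_integral_FTC_atLeast DERIV_HR_exponent l HR_partial_nonneg) auto
  then show ?thesis by (simp add: algebra_simps)
qed

text \<open>The exponent decreases in its second argument towards its one-dimensional limit.\<close>
lemma HR_exponent_ge_exp:
  assumes l: "0 < l"
  shows "exp (- x) \<le> HR_partial l x y + HR_partial l y x"
proof (rule tendsto_upperbound)
  show "((\<lambda>t. HR_partial l x t + HR_partial l t x) \<longlongrightarrow> exp (- x)) at_top"
    using tendsto_add[OF HR_partial_tendsto[OF l] HR_partial_tendsto_0] by simp
  show "eventually (\<lambda>t. HR_partial l x t + HR_partial l t x \<le> HR_partial l x y + HR_partial l y x) at_top"
    using eventually_ge_at_top[of y]
  proof eventually_elim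
    case (elim t)
    have "- (HR_partial l x y + HR_partial l y x) \<le> - (HR_partial l x t + HR_partial l t x)"
      by (rule DERIV_nonneg_imp_nondecreasing[OF elim]) (use DERIV_HR_exponent[OF l] HR_partial_nonneg in blast)
    then show ?case by simp
  qed
qed simp

section \<open>Powers close to one and convergence in the mean\<close>

lemma power_one_minus_tendsto_exp:
  fixes p :: "nat \<Rightarrow> real"
  assumes p: "\<And>n. 0 \<le> p n" "\<And>n. p n \<le> 1" and lim: "(\<lambda>n. real n * (1 - p n)) \<longlonglongrightarrow> V"
  shows "(\<lambda>n. p n ^ n) \<longlonglongrightarrow> exp (- V)"
proof -
  have "eventually (\<lambda>n. norm (p n ^ n - (1 + (- V) / real n) ^ n) \<le> norm (V - real n * (1 - p n))) sequentially"
  proof -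
    obtain N :: nat where N: "\<bar>V\<bar> \<le> real N" using real_arch_simple by blast
    have "eventually (\<lambda>n. n \<ge> max 1 N) sequentially" by (rule eventually_ge_at_top)
    then show ?thesis
    proof eventually_elim
      case (elim n)
      then have n: "1 \<le> real n" "\<bar>V\<bar> \<le> real n" using N by auto
      have 0: "0 \<le> V \<Longrightarrow> norm (1 + (- V) / real n) \<le> 1"
        using n by (auto simp: field_simps abs_if)
      show ?case
      proof (cases "0 \<le> V")
        case True
        have "norm (p n ^ n - (1 + (- V) / real n) ^ n) \<le> real n * norm (p n - (1 + (- V) / real n))"
          using p[of n] 0[OF True] by (intro norm_power_diff) auto
        also have "\<dots> = norm (real n * (p n - (1 + (- V) / real n)))"
          by (simp add: abs_mult)
        also have "real n * (p n - (1 + (- V) / real n)) = V - real n * (1 - p n)"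
          using n by (simp add: field_simps)
        finally show ?thesis .
      next
        case False
        have "0 \<le> V" using p by (intro LIMSEQ_le_const[OF lim]) auto
        with False show ?thesis by simp
      qed
    qed
  qed
  moreover have "(\<lambda>n. norm (V - real n * (1 - p n))) \<longlonglongrightarrow> 0"
    using tendsto_norm[OF tendsto_diff[OF tendsto_const lim, of V]] by simp
  ultimately have "(\<lambda>n. p n ^ n - (1 + (- V) / real n) ^ n) \<longlonglongrightarrow> 0"
    by (rule Lim_null_comparison)
  from tendsto_add[OF this tendsto_exp_limit_sequentially[of "- V"]] show ?thesis by simp
qed

text \<open>Convergence of the densities and of the total masses forces convergence on every measurable set.\<close>
lemma Scheffe_tendsto_set_integral:
  fixes F :: "nat \<Rightarrow> 'a \<Rightarrow> real"
  assumes F: "\<And>n. integrable M (F n)" "\<And>n x. 0 \<le> F n x" and f: "integrable M f" "\<And>x. 0 \<le> f x"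
    and lim: "\<And>x. (\<lambda>n. F n x) \<longlonglongrightarrow> f x"
    and mass: "(\<lambda>n. integral\<^sup>L M (F n)) \<longlonglongrightarrow> integral\<^sup>L M f"
    and E: "E \<in> sets M"
  shows "(\<lambda>n. \<integral>x. F n x * indicator E x \<partial>M) \<longlonglongrightarrow> (\<integral>x. f x * indicator E x \<partial>M)"
proof -
  have "(\<lambda>n. \<integral>\<^sup>+ x. norm (F n x) \<partial>M) = (\<lambda>n. ennreal (integral\<^sup>L M (F n)))"
    using F by (intro ext) (simp add: nn_integral_eq_integral)
  moreover have "(\<integral>\<^sup>+ x. norm (f x) \<partial>M) = ennreal (integral\<^sup>L M f)"
    using f by (simp add: nn_integral_eq_integral)
  ultimately have "limsup (\<lambda>n. \<integral>\<^sup>+ x. norm (F n x) \<partial>M) \<le> (\<integral>\<^sup>+ x. norm (f x) \<partial>M)"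
    using lim_imp_Limsup[OF _ tendsto_ennrealI[OF mass]] by simp
  then have L1: "(\<lambda>n. \<integral>\<^sup>+ x. norm (F n x - f x) \<partial>M) \<longlonglongrightarrow> 0"
    using F f lim by (intro Scheffe_lemma1) auto
  have "(\<lambda>n. \<integral>\<^sup>+ x. norm (F n x - f x) \<partial>M) = (\<lambda>n. ennreal (\<integral>x. norm (F n x - f x) \<partial>M))"
    using F f by (intro ext nn_integral_eq_integral) auto
  with L1 have L1': "(\<lambda>n. \<integral>x. norm (F n x - f x) \<partial>M) \<longlonglongrightarrow> 0"
    by (simp add: ennreal_tendsto_0_iff)
  have int: "integrable M (\<lambda>x. F n x * indicator E x)" "integrable M (\<lambda>x. f x * indicator E x)" for n
    using F f E by (auto intro!: integrable_real_mult_indicator)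
  have "norm ((\<integral>x. F n x * indicator E x \<partial>M) - (\<integral>x. f x * indicator E x \<partial>M)) \<le> (\<integral>x. norm (F n x - f x) \<partial>M)" for n
  proof -
    have "norm ((\<integral>x. F n x * indicator E x \<partial>M) - (\<integral>x. f x * indicator E x \<partial>M)) = norm (\<integral>x. F n x * indicator E x - f x * indicator E x \<partial>M)"
      using int by simp
    also have "\<dots> \<le> (\<integral>x. norm (F n x * indicator E x - f x * indicator E x) \<partial>M)"
      by (rule integral_norm_bound)
    also have "\<dots> \<le> (\<integral>x. norm (F n x - f x) \<partial>M)"
      using int F f by (intro integral_mono) (auto split: split_indicator)
    finally show ?thesis .
  qed
  then have "(\<lambda>n. (\<integral>x. F n x * indicator E x \<partial>M) - (\<integral>x. f x * indicator E x \<partial>M)) \<longlonglongrightarrow> 0"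
    by (intro Lim_null_comparison[OF always_eventually L1']) auto
  then show ?thesis by (simp add: LIM_zero_iff)
qed

section \<open>The normalised density under the Huesler-Reiss condition\<close>

text \<open>The exponents \<open>z = sqrt r * S / s\<close> and \<open>(u + v) / (2 s)\<close> of the density are both of order \<open>1 / s\<^sup>2\<close> in the
regime considered below, while their difference is of order \<open>1 / s\<close>. The identity isolates the linear term
\<open>(u + v) / 4\<close>; in the remaining terms only \<open>\<delta> = (sqrt u - sqrt v)\<^sup>2\<close>, \<open>\<delta> / s\<close> and \<open>S s\<close> occur, all of which converge.
Here \<open>\<delta>\<close> is rationalised so that it is governed by the bounded difference \<open>u - v\<close>.\<close>
lemma exponent_identity:
  fixes u v s r :: real
  assumes "0 < u" "0 < v" "0 < r" "r < 1" "s = 1 - r"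
  defines "S \<equiv> sqrt (u * v)" and "\<delta> \<equiv> (u - v)\<^sup>2 / (u + v + 2 * sqrt (u * v))"
  shows "sqrt r * S / s - (u + v) / (2 * s) =
    - (u + v) / 4 + \<delta> / 4 - S * s / (2 * (1 + sqrt r)\<^sup>2) - \<delta> / (2 * s)"
proof -
  define q where "q = sqrt r"
  have q: "0 < q" "q < 1" "q\<^sup>2 = r" using assms by (auto simp: q_def)
  have s: "s = (1 - q) * (1 + q)" using assms(5) q by (simp add: power2_eq_square algebra_simps)
  have S: "S\<^sup>2 = u * v" "0 < S" using assms by (auto simp: S_def)
  have den: "0 < u + v + 2 * S" using assms S by (simp add: add_pos_pos)
  have "(u + v + 2 * S) * (u + v - 2 * S) = (u - v)\<^sup>2"
    using S by (simp add: power2_eq_square algebra_simps)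
  then have \<delta>: "\<delta> = u + v - 2 * S"
    using den by (simp add: \<delta>_def S_def[symmetric] field_simps)
  have s0: "s \<noteq> 0" "1 + q \<noteq> 0" "1 - q \<noteq> 0" using q s by auto
  have "sqrt r * S / s - (u + v) / (2 * s) = - S / (1 + q) - \<delta> / (2 * s)"
  proof -
    have "S * (1 - q) / s = S / (1 + q)" unfolding s using s0 by simp
    moreover have "S * (1 - q) / s = S / s - q * S / s" by (simp add: algebra_simps diff_divide_distrib)
    moreover have "\<delta> / (2 * s) = (u + v) / (2 * s) - S / s" unfolding \<delta> by (simp add: diff_divide_distrib)
    ultimately show ?thesis by (simp add: q_def)
  qed
  also have "- S / (1 + q) = - S / 2 - S * s / (2 * (1 + q)\<^sup>2)"
  proof -
    have "S * s / (2 * (1 + q)\<^sup>2) = S * (1 - q) / (2 * (1 + q))"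
      unfolding s power2_eq_square using s0 by simp
    then show ?thesis using s0 by (simp add: field_simps)
  qed
  also have "- S / 2 = - (u + v) / 4 + \<delta> / 4" unfolding \<delta> by (simp add: field_simps)
  finally show ?thesis by (simp add: q_def)
qed

lemma collect_powers:
  fixes s S \<beta> a :: real
  assumes "0 < s" "0 < S" "0 < \<beta>"
  shows "4 * (s powr a / (2 * s) powr (2 * a)) * S powr (2 * a - 2) * (S powr (1/2 - a) * s powr (a - 1/2)) =
    2 powr (1 - a) * (S / \<beta>) powr (a - 1) * (\<beta> / 2) powr (a - 1) / sqrt (S * s)"
proof -
  define X Y Z L where "X = ln S" and "Y = ln s" and "Z = ln \<beta>" and "L = ln (2::real)"
  have e: "S = exp X" "s = exp Y" "\<beta> = exp Z" "(2::real) = exp L"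
    using assms by (simp_all add: X_def Y_def Z_def L_def)
  have pw: "exp x powr q = exp (q * x)" for x q :: real by (simp add: powr_def)
  have sq: "sqrt (exp x) = exp (x / 2)" for x :: real
    by (rule real_sqrt_unique) (simp_all add: power2_eq_square flip: exp_add)
  have four: "exp (2 * L) = 4" unfolding mult_2 exp_add e(4)[symmetric] by simp
  have "exp (2 * L) * (exp Y powr a / (exp L * exp Y) powr (2 * a)) * exp X powr (2 * a - 2) * (exp X powr (1/2 - a) * exp Y powr (a - 1/2)) =
    exp L powr (1 - a) * (exp X / exp Z) powr (a - 1) * (exp Z / exp L) powr (a - 1) / sqrt (exp X * exp Y)"
    unfolding exp_add[symmetric] exp_diff[symmetric] pw sq
    by (simp add: algebra_simps add_divide_distrib)
  then show ?thesis unfolding four e(4)[symmetric] unfolding e(1-3) .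
qed

text \<open>The sequence \<open>r\<close> stands for the squared correlations.\<close>
locale husler_reiss_regime =
  fixes m :: nat and l :: real and r :: "nat \<Rightarrow> real"
  assumes m: "2 \<le> m" and l: "0 < l" and r: "\<And>n. 1 \<le> n \<Longrightarrow> 0 < r n \<and> r n < 1"
    and lim: "(\<lambda>n. norm_b m n * (1 - r n)) \<longlonglongrightarrow> l"
begin

abbreviation "a \<equiv> real m / 2"
abbreviation "b \<equiv> norm_b m"
abbreviation "t \<equiv> norm_t m"
abbreviation dens :: "nat \<Rightarrow> real \<Rightarrow> real \<Rightarrow> real" where "dens n \<equiv> chi2_pair_density m (r n)"
abbreviation part :: "nat \<Rightarrow> real \<Rightarrow> real \<Rightarrow> real" where "part n \<equiv> chi2_pair_partial m (r n)"

lemma a: "1 \<le> a" using m by simp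

lemma t_eq: "t n x = 2 * x + b n"
  by (simp add: norm_t_def norm_a_def)

lemma Gamma_a: "Gamma a > 0" using a by (intro Gamma_real_pos) simp

lemma b_over_ln: "(\<lambda>n. b n / 2 / ln (real n)) \<longlonglongrightarrow> 1"
proof -
  have "(\<lambda>n. 1 + (a - 1) * (ln (ln (real n)) / ln (real n)) - ln (Gamma a) * (1 / ln (real n))) \<longlonglongrightarrow> 1 + (a - 1) * 0 - ln (Gamma a) * 0"
    by (intro tendsto_intros) real_asymp+
  moreover have "eventually (\<lambda>n. 1 + (a - 1) * (ln (ln (real n)) / ln (real n)) - ln (Gamma a) * (1 / ln (real n)) = b n / 2 / ln (real n)) sequentially"
    using eventually_ge_at_top[of 2]
  proof eventually_elim
    case (elim n)
    then have "ln (real n) \<noteq> 0" by simp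
    then show ?case unfolding norm_b_def by (simp add: field_simps)
  qed
  ultimately show ?thesis using Lim_transform_eventually by fastforce
qed

lemma b_at_top: "filterlim b at_top sequentially"
proof -
  have "filterlim (\<lambda>n. b n / 2 / ln (real n) * (2 * ln (real n))) at_top sequentially"
  proof (rule filterlim_tendsto_pos_mult_at_top[OF b_over_ln])
    show "filterlim (\<lambda>n. 2 * ln (real n)) at_top sequentially" by real_asymp
  qed simp
  moreover have "eventually (\<lambda>n. b n / 2 / ln (real n) * (2 * ln (real n)) = b n) sequentially"
    using eventually_ge_at_top[of 2] by eventually_elim auto
  ultimately show ?thesis by (rule filterlim_mono_eventually[OF _ order_refl order_refl])
qed

lemma t_at_top: "filterlim (\<lambda>n. t n x) at_top sequentially"
  unfolding t_eq by (intro filterlim_tendsto_add_at_top[OF tendsto_const] b_at_top)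

lemma b_pos: "eventually (\<lambda>n. 0 < b n) sequentially"
  using b_at_top by (simp add: filterlim_at_top_dense)

lemma t_pos: "eventually (\<lambda>n. 0 < t n x) sequentially"
  using t_at_top[of x] by (simp add: filterlim_at_top_dense)

lemma t_over_b: "(\<lambda>n. t n x / b n) \<longlonglongrightarrow> 1"
proof -
  have "(\<lambda>n. 2 * x / b n + 1) \<longlonglongrightarrow> 0 + 1"
    by (intro tendsto_intros tendsto_divide_0[OF tendsto_const] filterlim_at_top_imp_at_infinity b_at_top)
  moreover have "eventually (\<lambda>n. 2 * x / b n + 1 = t n x / b n) sequentially"
    using b_pos by eventually_elim (simp add: t_eq add_divide_distrib)
  ultimately show ?thesis using Lim_transform_eventually by fastforce
qed

lemma s_lim: "(\<lambda>n. 1 - r n) \<longlonglongrightarrow> 0"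
proof -
  have "(\<lambda>n. b n * (1 - r n) / b n) \<longlonglongrightarrow> 0"
    by (rule tendsto_divide_0[OF lim]) (intro filterlim_at_top_imp_at_infinity b_at_top)
  moreover have "eventually (\<lambda>n. b n * (1 - r n) / b n = 1 - r n) sequentially"
    using b_pos by eventually_elim simp
  ultimately show ?thesis by (rule Lim_transform_eventually)
qed

lemma r_lim: "r \<longlonglongrightarrow> 1"
  using tendsto_diff[OF tendsto_const[of 1] s_lim] by simp

lemma t_times_s: "(\<lambda>n. t n x * (1 - r n)) \<longlonglongrightarrow> l"
proof -
  have "(\<lambda>n. 2 * x * (1 - r n) + b n * (1 - r n)) \<longlonglongrightarrow> 2 * x * 0 + l"
    by (intro tendsto_intros s_lim lim)
  then show ?thesis by (simp add: t_eq distrib_right)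
qed

text \<open>The constant that the normalisation \<open>b_n\<close> is designed to send to \<open>1\<close>: up to asymptotic equivalence it is \<open>n\<close>
times the chi-square tail at \<open>b_n\<close>.\<close>
definition K where "K n = real n * exp (- b n / 2) * (b n / 2) powr (a - 1) / Gamma a"

lemma K_lim: "K \<longlonglongrightarrow> 1"
proof -
  have "(\<lambda>n. (b n / 2 / ln (real n)) powr (a - 1)) \<longlonglongrightarrow> 1 powr (a - 1)"
    by (intro tendsto_intros b_over_ln) auto
  moreover have "eventually (\<lambda>n. (b n / 2 / ln (real n)) powr (a - 1) = K n) sequentially"
    using eventually_ge_at_top[of 2] b_pos
  proof eventually_elim
    case (elim n)
    have L: "0 < ln (real n)" using elim by simp
    have "- b n / 2 = - ln (real n) + - ((a - 1) * ln (ln (real n))) + ln (Gamma a)"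
      unfolding norm_b_def by (simp add: field_simps)
    then have "exp (- b n / 2) = exp (- ln (real n)) * exp (- ((a - 1) * ln (ln (real n)))) * exp (ln (Gamma a))"
      by (simp only: exp_add)
    also have "\<dots> = Gamma a / (real n * ln (real n) powr (a - 1))"
      using elim L Gamma_a by (simp add: exp_minus powr_def field_simps)
    finally have e: "exp (- b n / 2) = Gamma a / (real n * ln (real n) powr (a - 1))" .
    show ?case
      unfolding K_def e using elim Gamma_a by (simp add: powr_divide powr_mult)
  qed
  ultimately show ?thesis using Lim_transform_eventually by fastforce
qed

lemma marginal_eq:
  assumes "0 < b n" "0 < t n x"
  shows "2 * real n * gamma_density 2 a (t n x) = exp (- x) * K n * (t n x / b n) powr (a - 1)"
proof -
  have e: "exp (- t n x / 2) = exp (- x) * exp (- b n / 2)"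
    by (simp add: t_eq add_divide_distrib diff_divide_distrib flip: exp_add)
  have "(2::real) powr a = 2 * 2 powr (a - 1)"
    using powr_add[of 2 1 "a - 1"] by simp
  then have "2 * real n * gamma_density 2 a (t n x) =
      real n * t n x powr (a - 1) * exp (- t n x / 2) / (2 powr (a - 1) * Gamma a)"
    using assms by (simp add: gamma_density_def)
  then show ?thesis
    unfolding e K_def using assms Gamma_a by (simp add: powr_divide)
qed

lemma marginal_lim: "(\<lambda>n. 2 * real n * gamma_density 2 a (t n x)) \<longlonglongrightarrow> exp (- x)"
proof -
  have "(\<lambda>n. exp (- x) * K n * (t n x / b n) powr (a - 1)) \<longlonglongrightarrow> exp (- x) * 1 * 1 powr (a - 1)"
    by (intro tendsto_intros K_lim t_over_b) auto
  moreover have "eventually (\<lambda>n. exp (- x) * K n * (t n x / b n) powr (a - 1) = 2 * real n * gamma_density 2 a (t n x)) sequentially"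
    using b_pos t_pos[of x] by eventually_elim (simp add: marginal_eq)
  ultimately show ?thesis using Lim_transform_eventually by fastforce
qed

text \<open>The polynomial factor \<open>(t_n(x) / b_n) powr (a - 1)\<close> is at most \<open>exp (2 x (a - 1) / b_n)\<close>, which for large
\<open>n\<close> costs at most half of the exponential decay.\<close>
lemma marginal_bound:
  "eventually (\<lambda>n. \<forall>x. 2 * real n * gamma_density 2 a (t n x) \<le> 2 * (exp (- x / 2) + exp (- x))) sequentially"
proof -
  have "eventually (\<lambda>n. K n < 2) sequentially"
    using order_tendstoD(2)[OF K_lim, of 2] by simp
  moreover have "eventually (\<lambda>n. 4 * (a - 1) \<le> b n) sequentially"
    using b_at_top by (simp add: filterlim_at_top)
  ultimately show ?thesis
    using b_pos
  proof eventually_elim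
    case (elim n)
    have K0: "0 \<le> K n" unfolding K_def using Gamma_a by simp
    show ?case
    proof
      fix x
      show "2 * real n * gamma_density 2 a (t n x) \<le> 2 * (exp (- x / 2) + exp (- x))"
      proof (cases "0 < t n x")
        case False
        then show ?thesis by (simp add: gamma_density_def add_nonneg_nonneg)
      next
        case True
        have "t n x / b n = 1 + 2 * x / b n" using elim by (simp add: t_eq add_divide_distrib)
        also have "\<dots> \<le> exp (2 * x / b n)" by (rule exp_ge_add_one_self)
        finally have "(t n x / b n) powr (a - 1) \<le> exp (2 * x / b n) powr (a - 1)"
          using True elim a by (intro powr_mono2) auto
        also have "\<dots> = exp (2 * x / b n * (a - 1))" by (simp add: powr_def mult.commute)
        finally have "exp (- x) * (t n x / b n) powr (a - 1) \<le> exp (- x) * exp (2 * x / b n * (a - 1))"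
          by (intro mult_left_mono) auto
        also have "\<dots> = exp (- x + 2 * x / b n * (a - 1))" by (simp only: exp_add)
        also have "\<dots> \<le> exp (- x / 2) + exp (- x)"
        proof (cases "0 \<le> x")
          case True
          have "x * (4 * (a - 1)) \<le> x * b n" using True elim by (intro mult_left_mono) auto
          then have "2 * x / b n * (a - 1) \<le> x / 2" using elim by (simp add: field_simps)
          then have "exp (- x + 2 * x / b n * (a - 1)) \<le> exp (- x / 2)" by simp
          then show ?thesis by (simp add: add_increasing2)
        next
          case False
          have "2 * x / b n * (a - 1) \<le> 0"
            using False elim a by (intro mult_nonpos_nonneg[OF divide_nonpos_pos]) auto
          then have "exp (- x + 2 * x / b n * (a - 1)) \<le> exp (- x)" by simp
          then show ?thesis by (simp add: add_increasing)
        qed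
        finally have 1: "exp (- x) * (t n x / b n) powr (a - 1) \<le> exp (- x / 2) + exp (- x)" .
        have "2 * real n * gamma_density 2 a (t n x) = K n * (exp (- x) * (t n x / b n) powr (a - 1))"
          using elim True by (simp add: marginal_eq)
        also have "\<dots> \<le> 2 * (exp (- x / 2) + exp (- x))"
          using 1 elim K0 by (intro mult_mono) auto
        finally show ?thesis .
      qed
    qed
  qed
qed

text \<open>The part of the density that tends to a constant by \<open>hyp0F1_asymptotics\<close>.\<close>
definition Q where "Q z = hyp0F1 a (z\<^sup>2 / 4) * exp (- z) * z powr (a - 1/2)"

text \<open>All factors on the right converge, except that the argument of \<open>Q\<close> tends to infinity. The term \<open>b_n / 2\<close> in the
exponent comes from taking \<open>exp (- b_n / 2)\<close> into \<open>K\<close>.\<close>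
lemma density_factorization:
  assumes n: "1 \<le> n" and pos: "0 < b n" "0 < t n x" "0 < t n y"
  defines "S \<equiv> sqrt (t n x * t n y)" and "s \<equiv> 1 - r n"
  shows "4 * real n * dens n (t n x) (t n y) =
    2 powr (1 - a) / Gamma a * Q (sqrt (r n) * S / s) * r n powr ((1/2 - a) / 2) * (S / b n) powr (a - 1) * K n
      / sqrt (S * s) * exp (sqrt (r n) * S / s - (t n x + t n y) / (2 * s) + b n / 2)"
proof -
  define u where "u = t n x"
  define v where "v = t n y"
  define \<rho> where "\<rho> = r n"
  define \<beta> where "\<beta> = b n"
  define z where "z = sqrt \<rho> * S / s"
  have p: "0 < u" "0 < v" "0 < \<rho>" "\<rho> < 1" "0 < \<beta>" using pos r[OF n] by (auto simp: u_def v_def \<rho>_def \<beta>_def)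
  have s: "0 < s" using p by (simp add: s_def \<rho>_def)
  have S: "0 < S" "S\<^sup>2 = u * v" using p by (simp_all add: S_def u_def v_def)
  have z: "0 < z" using p s S by (simp add: z_def)
  have arg: "\<rho> * (u * v) / (2 * s)\<^sup>2 = z\<^sup>2 / 4"
    using p S by (simp add: z_def power_divide power_mult_distrib)
  have Q: "hyp0F1 a (z\<^sup>2 / 4) = Q z * exp z * z powr (1/2 - a)"
  proof -
    have "exp (- z) * exp z = 1" by (simp flip: exp_add)
    moreover have "z powr (a - 1/2) * z powr (1/2 - a) = 1" using z by (simp flip: powr_add)
    moreover have "Q z * exp z * z powr (1/2 - a) = hyp0F1 a (z\<^sup>2 / 4) * (exp (- z) * exp z) * (z powr (a - 1/2) * z powr (1/2 - a))"
      unfolding Q_def by (simp only: mult_ac)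
    ultimately show ?thesis by simp
  qed
  have "real (m - 2) = 2 * a - 2" using m by simp
  then have Sm: "S ^ (m - 2) = S powr (2 * a - 2)"
    using powr_realpow[OF S(1), of "m - 2"] by simp
  have sm: "(2 * s) ^ m = (2 * s) powr (2 * a)"
    using powr_realpow[of "2 * s" m] s by simp
  have zp: "z powr (1/2 - a) = \<rho> powr ((1/2 - a) / 2) * S powr (1/2 - a) * s powr (a - 1/2)"
  proof -
    have "z powr (1/2 - a) = sqrt \<rho> powr (1/2 - a) * S powr (1/2 - a) / s powr (1/2 - a)"
      unfolding z_def by (simp only: powr_mult powr_divide)
    also have "sqrt \<rho> powr (1/2 - a) = \<rho> powr ((1/2 - a) / 2)"
      using p by (simp add: powr_half_sqrt[symmetric] powr_powr del: powr_half_sqrt)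
    also have "\<rho> powr ((1/2 - a) / 2) * S powr (1/2 - a) / s powr (1/2 - a) = \<rho> powr ((1/2 - a) / 2) * S powr (1/2 - a) * s powr (a - 1/2)"
      using powr_minus_divide[of s "1/2 - a"] by simp
    finally show ?thesis .
  qed
  have powers: "4 * (s powr a / ((2 * s) powr (2 * a) * (Gamma a)\<^sup>2)) * S powr (2 * a - 2) * (S powr (1/2 - a) * s powr (a - 1/2)) =
      2 powr (1 - a) / Gamma a * (S / \<beta>) powr (a - 1) * ((\<beta> / 2) powr (a - 1) / Gamma a) / sqrt (S * s)"
  proof -
    have "4 * (s powr a / ((2 * s) powr (2 * a) * (Gamma a)\<^sup>2)) * S powr (2 * a - 2) * (S powr (1/2 - a) * s powr (a - 1/2)) =
      (4 * (s powr a / (2 * s) powr (2 * a)) * S powr (2 * a - 2) * (S powr (1/2 - a) * s powr (a - 1/2))) / (Gamma a)\<^sup>2"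
      by simp
    also have "\<dots> = (2 powr (1 - a) * (S / \<beta>) powr (a - 1) * (\<beta> / 2) powr (a - 1) / sqrt (S * s)) / (Gamma a)\<^sup>2"
      by (simp only: collect_powers[OF s S(1) p(5)])
    also have "\<dots> = 2 powr (1 - a) / Gamma a * (S / \<beta>) powr (a - 1) * ((\<beta> / 2) powr (a - 1) / Gamma a) / sqrt (S * s)"
      by (simp add: power2_eq_square)
    finally show ?thesis .
  qed
  have ee: "exp (- (u + v) / (2 * s)) * exp z = exp (z - (u + v) / (2 * s) + \<beta> / 2) * exp (- \<beta> / 2)"
    unfolding exp_add[symmetric] by (rule arg_cong[where f=exp]) (simp add: add_divide_distrib diff_divide_distrib)
  have "4 * real n * chi2_pair_density m \<rho> u v =
     real n * (4 * (s powr a / ((2 * s) powr (2 * a) * (Gamma a)\<^sup>2)) * S powr (2 * a - 2) * (S powr (1/2 - a) * s powr (a - 1/2)))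
      * Q z * \<rho> powr ((1/2 - a) / 2) * (exp (- (u + v) / (2 * s)) * exp z)"
  proof -
    have "sqrt (u * v) = S" by (simp add: S_def u_def v_def)
    moreover have "1 - \<rho> = s" by (simp add: s_def \<rho>_def)
    ultimately have "chi2_pair_density m \<rho> u v = s powr a / ((2 * s) powr (2 * a) * (Gamma a)\<^sup>2) * S powr (2 * a - 2)
        * exp (- (u + v) / (2 * s)) * (Q z * exp z * (\<rho> powr ((1/2 - a) / 2) * S powr (1/2 - a) * s powr (a - 1/2)))"
      unfolding chi2_pair_density_def by (simp only: arg Sm sm Q zp)
    then show ?thesis by (simp only: mult_ac times_divide_eq_right times_divide_eq_left)
  qed
  also have "\<dots> = 2 powr (1 - a) / Gamma a * Q z * \<rho> powr ((1/2 - a) / 2) * (S / \<beta>) powr (a - 1)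
      * (real n * exp (- \<beta> / 2) * (\<beta> / 2) powr (a - 1) / Gamma a) / sqrt (S * s) * exp (z - (u + v) / (2 * s) + \<beta> / 2)"
    unfolding powers ee by (simp add: mult_ac)
  finally show ?thesis
    by (simp add: K_def u_def v_def \<rho>_def \<beta>_def z_def)
qed

lemma S_limits:
  defines "S \<equiv> (\<lambda>x y n. sqrt (t n x * t n y))"
  shows "(\<lambda>n. S x y n / b n) \<longlonglongrightarrow> 1" "(\<lambda>n. S x y n * (1 - r n)) \<longlonglongrightarrow> l" "filterlim (S x y) at_top sequentially"
proof -
  have "(\<lambda>n. sqrt (t n x / b n * (t n y / b n))) \<longlonglongrightarrow> sqrt (1 * 1)"
    by (intro tendsto_intros t_over_b)
  moreover have "eventually (\<lambda>n. sqrt (t n x / b n * (t n y / b n)) = S x y n / b n) sequentially"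
    using b_pos by eventually_elim (simp add: S_def real_sqrt_mult real_sqrt_divide)
  ultimately show 1: "(\<lambda>n. S x y n / b n) \<longlonglongrightarrow> 1" using Lim_transform_eventually by fastforce
  have "(\<lambda>n. S x y n / b n * (b n * (1 - r n))) \<longlonglongrightarrow> 1 * l" by (intro tendsto_intros 1 lim)
  moreover have "eventually (\<lambda>n. S x y n / b n * (b n * (1 - r n)) = S x y n * (1 - r n)) sequentially"
    using b_pos by eventually_elim simp
  ultimately show "(\<lambda>n. S x y n * (1 - r n)) \<longlonglongrightarrow> l" using Lim_transform_eventually by fastforce
  have "filterlim (\<lambda>n. S x y n / b n * b n) at_top sequentially"
    by (intro filterlim_tendsto_pos_mult_at_top[OF 1] b_at_top) simp
  moreover have "eventually (\<lambda>n. S x y n / b n * b n = S x y n) sequentially"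
    using b_pos by eventually_elim simp
  ultimately show "filterlim (S x y) at_top sequentially"
    by (rule filterlim_mono_eventually[OF _ order_refl order_refl])
qed

lemma density_lim: "(\<lambda>n. 4 * real n * dens n (t n x) (t n y)) \<longlonglongrightarrow> HR_density l x y"
proof -
  define S where "S n = sqrt (t n x * t n y)" for n
  define s where "s n = 1 - r n" for n
  note S = S_limits[of x y, folded S_def s_def]
  note sl = s_lim[folded s_def]
  define z where "z n = sqrt (r n) * S n / s n" for n
  \<comment> \<open>Equal to \<open>(sqrt (t n x) - sqrt (t n y))\<^sup>2\<close>.\<close>
  define \<delta> where "\<delta> n = (t n x - t n y)\<^sup>2 / (t n x + t n y + 2 * S n)" for n
  have s_pos: "eventually (\<lambda>n. 0 < s n) sequentially"
    using eventually_ge_at_top[of 1] by eventually_elim (use r in \<open>auto simp: s_def\<close>)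
  have diff: "t n x - t n y = 2 * (x - y)" for n by (simp add: t_eq)
  have den: "filterlim (\<lambda>n. t n x + t n y + 2 * S n) at_top sequentially"
    by (intro filterlim_at_top_add_at_top t_at_top filterlim_tendsto_pos_mult_at_top[OF tendsto_const _ S(3)]) simp
  have \<delta>: "\<delta> \<longlonglongrightarrow> 0"
    unfolding \<delta>_def diff by (intro tendsto_divide_0[OF tendsto_const] filterlim_at_top_imp_at_infinity den)
  have dens: "(\<lambda>n. (t n x * s n) + (t n y * s n) + 2 * (S n * s n)) \<longlonglongrightarrow> l + l + 2 * l"
    unfolding s_def by (intro tendsto_intros t_times_s S_limits[of x y, folded S_def])
  have "(\<lambda>n. (2 * (x - y))\<^sup>2 / ((t n x * s n) + (t n y * s n) + 2 * (S n * s n))) \<longlonglongrightarrow> (2 * (x - y))\<^sup>2 / (l + l + 2 * l)"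
    using l by (intro tendsto_divide[OF tendsto_const dens]) simp
  moreover have "(2 * (x - y))\<^sup>2 / ((t n x * s n) + (t n y * s n) + 2 * (S n * s n)) = \<delta> n / s n" for n
    unfolding \<delta>_def diff divide_divide_eq_left by (simp add: distrib_right)
  ultimately have "(\<lambda>n. \<delta> n / s n) \<longlonglongrightarrow> (2 * (x - y))\<^sup>2 / (l + l + 2 * l)" by simp
  also have "(2 * (x - y))\<^sup>2 / (l + l + 2 * l) = (x - y)\<^sup>2 / l"
    unfolding power_mult_distrib using l by simp
  finally have \<delta>s: "(\<lambda>n. \<delta> n / s n) \<longlonglongrightarrow> (x - y)\<^sup>2 / l" .
  have z: "filterlim z at_top sequentially"
  proof -
    have "filterlim (\<lambda>n. inverse (s n)) at_top sequentially"
      using s_pos by (intro filterlim_inverse_at_top sl)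
    then have "filterlim (\<lambda>n. sqrt (r n) * (S n * inverse (s n))) at_top sequentially"
      using tendsto_real_sqrt[OF r_lim]
      by (intro filterlim_tendsto_pos_mult_at_top[where c="sqrt 1"] filterlim_at_top_mult_at_top S(3)) auto
    then show ?thesis unfolding z_def by (simp add: field_simps)
  qed
  have Q: "(\<lambda>n. Q (z n)) \<longlonglongrightarrow> Gamma a * 2 powr (a - 3/2) / sqrt pi"
    unfolding Q_def by (rule filterlim_compose[OF hyp0F1_asymptotics[OF a] z])
  define e where "e n = z n - (t n x + t n y) / (2 * s n) + b n / 2" for n
  have e: "e \<longlonglongrightarrow> - (x + y) / 2 - l / 8 - (x - y)\<^sup>2 / (2 * l)"
  proof -
    have "(\<lambda>n. - (x + y) / 2 + \<delta> n / 4 - S n * s n / (2 * (1 + sqrt (r n))\<^sup>2) - \<delta> n / s n / 2) \<longlonglongrightarrow>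
        - (x + y) / 2 + 0 / 4 - l / (2 * (1 + sqrt 1)\<^sup>2) - (x - y)\<^sup>2 / l / 2"
      by (intro tendsto_intros \<delta> \<delta>s S r_lim) auto
    moreover have "eventually (\<lambda>n. - (x + y) / 2 + \<delta> n / 4 - S n * s n / (2 * (1 + sqrt (r n))\<^sup>2) - \<delta> n / s n / 2 = e n) sequentially"
      using eventually_ge_at_top[of 1] t_pos[of x] t_pos[of y]
    proof eventually_elim
      case (elim n)
      have 1: "z n - (t n x + t n y) / (2 * s n) = - (t n x + t n y) / 4 + \<delta> n / 4 - S n * s n / (2 * (1 + sqrt (r n))\<^sup>2) - \<delta> n / (2 * s n)"
        using exponent_identity[of "t n x" "t n y" "r n" "s n"] elim r[of n] by (simp add: z_def S_def \<delta>_def s_def)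
      have 2: "- (t n x + t n y) / 4 = - (x + y) / 2 - b n / 2" by (simp add: t_eq field_simps)
      have 3: "\<delta> n / (2 * s n) = \<delta> n / s n / 2" by simp
      show ?case unfolding e_def 1 2 3 by simp
    qed
    ultimately have "e \<longlonglongrightarrow> - (x + y) / 2 + 0 / 4 - l / (2 * (1 + sqrt 1)\<^sup>2) - (x - y)\<^sup>2 / l / 2"
      by (rule Lim_transform_eventually)
    then show ?thesis by (simp add: mult.commute)
  qed
  let ?T = "\<lambda>n. 2 powr (1 - a) / Gamma a * Q (z n) * r n powr ((1/2 - a) / 2) * (S n / b n) powr (a - 1) * K n / sqrt (S n * s n) * exp (e n)"
  have "?T \<longlonglongrightarrow>
     2 powr (1 - a) / Gamma a * (Gamma a * 2 powr (a - 3/2) / sqrt pi) * 1 powr ((1/2 - a) / 2) * 1 powr (a - 1) * 1 / sqrt l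
      * exp (- (x + y) / 2 - l / 8 - (x - y)\<^sup>2 / (2 * l))"
    using l by (intro tendsto_intros Q r_lim S K_lim e) auto
  also have "2 powr (1 - a) / Gamma a * (Gamma a * 2 powr (a - 3/2) / sqrt pi) * 1 powr ((1/2 - a) / 2) * 1 powr (a - 1) * 1 / sqrt l
      * exp (- (x + y) / 2 - l / 8 - (x - y)\<^sup>2 / (2 * l)) = HR_density l x y"
  proof -
    have "2 powr (1 - a) * 2 powr (a - 3/2) = 2 powr (- (1/2) :: real)" by (simp flip: powr_add)
    also have "\<dots> = 1 / sqrt 2" by (simp add: powr_minus powr_half_sqrt inverse_eq_divide)
    finally have "2 powr (1 - a) / Gamma a * (Gamma a * 2 powr (a - 3/2) / sqrt pi) = 1 / sqrt (2 * pi)"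
      using Gamma_a by (simp add: real_sqrt_mult field_simps)
    then show ?thesis unfolding HR_density_eq[OF l] by simp
  qed
  finally have "?T \<longlonglongrightarrow> HR_density l x y" .
  moreover have "eventually (\<lambda>n. ?T n
      = 4 * real n * dens n (t n x) (t n y)) sequentially"
    using eventually_ge_at_top[of 1] t_pos[of x] t_pos[of y] b_pos
    by eventually_elim (simp add: density_factorization S_def s_def z_def e_def)
  ultimately show ?thesis by (rule Lim_transform_eventually)
qed

section \<open>Partial derivatives and exceedance probabilities in the limit\<close>

lemma nn_integral_norm_t:
  fixes f :: "real \<Rightarrow> ennreal"
  assumes [measurable]: "f \<in> borel_measurable borel"
  shows "ennreal (real n) * (\<integral>\<^sup>+ s. f s \<partial>lborel) = (\<integral>\<^sup>+ x. ennreal (2 * real n) * f (t n x) \<partial>lborel)"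
proof -
  have "(\<integral>\<^sup>+ s. f s \<partial>lborel) = ennreal \<bar>2\<bar> * (\<integral>\<^sup>+ x. f (b n + 2 * x) \<partial>lborel)"
    by (intro nn_integral_real_affine) auto
  also have "(\<integral>\<^sup>+ x. f (b n + 2 * x) \<partial>lborel) = (\<integral>\<^sup>+ x. f (t n x) \<partial>lborel)"
    by (simp add: t_eq add.commute)
  finally have "ennreal (real n) * (\<integral>\<^sup>+ s. f s \<partial>lborel) = ennreal (2 * real n) * (\<integral>\<^sup>+ x. f (t n x) \<partial>lborel)"
    by (simp add: ennreal_mult' mult_ac)
  also have "\<dots> = (\<integral>\<^sup>+ x. ennreal (2 * real n) * f (t n x) \<partial>lborel)"
    unfolding t_eq by (rule nn_integral_cmult[symmetric]) measurable
  finally show ?thesis .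
qed

lemma t_le_iff: "t n x \<le> t n y \<longleftrightarrow> x \<le> y" "t n x < t n y \<longleftrightarrow> x < y"
  by (simp_all add: t_eq)

lemma measurable_t [measurable]: "t n \<in> borel_measurable borel"
  unfolding t_eq[abs_def] by measurable

lemma measurable_section [measurable]:
  assumes "1 \<le> n"
  shows "dens n u \<in> borel_measurable borel"
  using r[OF assms] m by (intro borel_measurable_continuous_onI continuous_intros) auto

text \<open>Scheffe's lemma for the functions \<open>y' \<mapsto> 4 n g(t_n(x), t_n(y'))\<close>, extended by zero to the left of the support; their total
masses are the normalised marginal densities at \<open>x\<close>.\<close>
lemma partial_lim: "(\<lambda>n. 2 * real n * part n (t n x) (t n y)) \<longlonglongrightarrow> HR_partial l x y"
proof -
  define F where "F n y' = (if 1 \<le> n \<and> 0 < t n x \<and> 0 < t n y' then 4 * real n * dens n (t n x) (t n y') else 0)" for n y'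
  have F0: "0 \<le> F n y'" for n y'
    using r[of n] m by (auto simp: F_def intro!: mult_nonneg_nonneg chi2_pair_density_nonneg)
  have [measurable]: "F n \<in> borel_measurable borel" for n
  proof (cases "1 \<le> n")
    case True
    note measurable_section[OF True, measurable]
    have [measurable]: "(\<lambda>y'. dens n (t n x) (t n y')) \<in> borel_measurable borel"
      by measurable
    show ?thesis unfolding F_def[abs_def] by measurable
  qed (simp add: F_def[abs_def])
  have F_eq: "ennreal (F n y') = ennreal (2 * real n) * (ennreal 2 * ennreal (dens n (t n x) (t n y')) * indicator {0<..} (t n y'))"
    if "1 \<le> n" "0 < t n x" for n y'
  proof -
    have "ennreal (4 * real n * h) = ennreal (2 * real n) * (ennreal 2 * ennreal h)" if "0 \<le> h" for h
    proof -
      have "ennreal (2 * real n) * (ennreal 2 * ennreal h) = ennreal (2 * real n * (2 * h))"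
        using that by (simp only: ennreal_mult mult_nonneg_nonneg zero_le_numeral of_nat_0_le_iff)
      then show ?thesis by (simp add: mult_ac)
    qed
    then show ?thesis
      using that r[of n] m by (simp add: F_def chi2_pair_density_nonneg split: split_indicator)
  qed
  have total: "(\<integral>\<^sup>+ y'. ennreal (F n y') \<partial>lborel) = ennreal (2 * real n * gamma_density 2 a (t n x))"
    if n: "1 \<le> n" "0 < t n x" for n
  proof -
    note measurable_section[OF n(1), measurable]
    have "(\<integral>\<^sup>+ y'. ennreal (F n y') \<partial>lborel) = ennreal (real n) * (\<integral>\<^sup>+ s. ennreal 2 * ennreal (dens n (t n x) s) * indicator {0<..} s \<partial>lborel)"
      unfolding F_eq[OF n] by (rule nn_integral_norm_t[symmetric]) measurable
    also have "(\<integral>\<^sup>+ s. ennreal 2 * ennreal (dens n (t n x) s) * indicator {0<..} s \<partial>lborel) =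
        ennreal 2 * (\<integral>\<^sup>+ s. ennreal (dens n (t n x) s) * indicator {0<..} s \<partial>lborel)"
      by (simp add: nn_integral_cmult mult.assoc)
    also have "(\<integral>\<^sup>+ s. ennreal (dens n (t n x) s) * indicator {0<..} s \<partial>lborel) = ennreal (gamma_density 2 a (t n x))"
      using r[OF n(1)] n m by (intro chi2_pair_density_marginal) auto
    finally show ?thesis
      using gamma_density_nonneg[of a 2 "t n x"] a by (simp add: ennreal_mult mult_ac)
  qed
  have truncated: "(\<integral>\<^sup>+ y'. ennreal (F n y' * indicator {..y} y') \<partial>lborel) = ennreal (2 * real n * part n (t n x) (t n y))"
    if n: "1 \<le> n" "0 < t n x" for n
  proof -
    note measurable_section[OF n(1), measurable]
    have "ennreal (F n y' * indicator {..y} y') = ennreal (2 * real n) * (ennreal 2 * (ennreal (dens n (t n x) (t n y')) * indicator {0<..} (t n y') * indicator {..t n y} (t n y')))" for y'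
      using F_eq[OF n, of y'] by (auto simp: t_le_iff mult_ac split: split_indicator)
    then have "(\<integral>\<^sup>+ y'. ennreal (F n y' * indicator {..y} y') \<partial>lborel) =
        ennreal (real n) * (\<integral>\<^sup>+ s. ennreal 2 * (ennreal (dens n (t n x) s) * indicator {0<..} s * indicator {..t n y} s) \<partial>lborel)"
      by (simp only:) (rule nn_integral_norm_t[symmetric], measurable)
    also have "(\<integral>\<^sup>+ s. ennreal 2 * (ennreal (dens n (t n x) s) * indicator {0<..} s * indicator {..t n y} s) \<partial>lborel) =
        ennreal 2 * (\<integral>\<^sup>+ s. ennreal (dens n (t n x) s) * indicator {0<..} s * indicator {..t n y} s \<partial>lborel)"
      by (rule nn_integral_cmult) measurable
    also have "(\<integral>\<^sup>+ s. ennreal (dens n (t n x) s) * indicator {0<..} s * indicator {..t n y} s \<partial>lborel) = ennreal (part n (t n x) (t n y))"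
      using r[OF n(1)] n m by (intro chi2_pair_partial_eq_nn_integral[symmetric]) auto
    finally show ?thesis
      using r[OF n(1)] n m by (simp add: ennreal_mult chi2_pair_partial_nonneg mult_ac)
  qed
  have hb: "has_bochner_integral lborel (F n) (if 1 \<le> n \<and> 0 < t n x then 2 * real n * gamma_density 2 a (t n x) else 0)" for n
  proof (cases "1 \<le> n \<and> 0 < t n x")
    case True
    then show ?thesis
      using total[of n] F0 gamma_density_nonneg[of a 2 "t n x"] a by (auto intro!: has_bochner_integral_nn_integral)
  next
    case False
    then have "F n = (\<lambda>_. 0)" by (auto simp: F_def)
    then show ?thesis using False by (auto intro: has_bochner_integral_zero)
  qed
  have [measurable]: "HR_density l x \<in> borel_measurable borel"
    unfolding HR_density_def[abs_def] by measurable
  have hf: "has_bochner_integral lborel (HR_density l x) (exp (- x))"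
    using nn_integral_HR_density[OF l, of x] HR_density_nonneg[OF l] by (auto intro!: has_bochner_integral_nn_integral)
  have good: "eventually (\<lambda>n. 1 \<le> n \<and> 0 < t n x) sequentially"
    using eventually_ge_at_top[of 1] t_pos[of x] by eventually_elim simp
  have lim: "(\<lambda>n. F n y') \<longlonglongrightarrow> HR_density l x y'" for y'
  proof (rule Lim_transform_eventually[OF density_lim[of x y']])
    show "eventually (\<lambda>n. 4 * real n * dens n (t n x) (t n y') = F n y') sequentially"
      using good t_pos[of y'] by eventually_elim (simp add: F_def)
  qed
  have mass: "(\<lambda>n. integral\<^sup>L lborel (F n)) \<longlonglongrightarrow> integral\<^sup>L lborel (HR_density l x)"
    unfolding has_bochner_integral_integral_eq[OF hf]
  proof (rule Lim_transform_eventually[OF marginal_lim[of x]])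
    show "eventually (\<lambda>n. 2 * real n * gamma_density 2 a (t n x) = integral\<^sup>L lborel (F n)) sequentially"
      using good by eventually_elim (simp add: has_bochner_integral_integral_eq[OF hb])
  qed
  have "(\<lambda>n. \<integral>y'. F n y' * indicator {..y} y' \<partial>lborel) \<longlonglongrightarrow> (\<integral>y'. HR_density l x y' * indicator {..y} y' \<partial>lborel)"
    by (rule Scheffe_tendsto_set_integral[OF _ F0 _ HR_density_nonneg[OF l] lim mass])
       (use hb hf in \<open>auto simp: has_bochner_integral_iff\<close>)
  also have "(\<integral>y'. HR_density l x y' * indicator {..y} y' \<partial>lborel) = HR_partial l x y"
  proof -
    have "(\<integral>\<^sup>+ y'. ennreal (HR_density l x y' * indicator {..y} y') \<partial>lborel) = ennreal (HR_partial l x y)"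
      unfolding nn_integral_HR_density_Iic[OF l, symmetric] by (intro nn_integral_cong) (auto split: split_indicator)
    then show ?thesis
      using HR_density_nonneg[OF l] by (subst integral_eq_nn_integral) (auto simp: HR_partial_nonneg)
  qed
  finally have "(\<lambda>n. \<integral>y'. F n y' * indicator {..y} y' \<partial>lborel) \<longlonglongrightarrow> HR_partial l x y" .
  moreover have "eventually (\<lambda>n. (\<integral>y'. F n y' * indicator {..y} y' \<partial>lborel) = 2 * real n * part n (t n x) (t n y)) sequentially"
    using good
  proof eventually_elim
    case (elim n)
    then show ?case
      using F0 r[of n] m by (subst integral_eq_nn_integral) (auto simp: truncated chi2_pair_partial_nonneg)
  qed
  ultimately show ?thesis by (rule Lim_transform_eventually)
qed

lemma nn_integral_Ioi_eq_Ici: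
  fixes f :: "real \<Rightarrow> ennreal"
  shows "(\<integral>\<^sup>+ x. f x * indicator {c<..} x \<partial>lborel) = (\<integral>\<^sup>+ x. f x * indicator {c..} x \<partial>lborel)"
proof (rule nn_integral_cong_AE)
  show "AE x in lborel. f x * indicator {c<..} x = f x * indicator {c..} x"
    using AE_lborel_singleton[of c] by eventually_elim (auto split: split_indicator)
qed

lemma integrable_exp_tail:
  "integrable lborel (\<lambda>x::real. 2 * (exp (- x / 2) + exp (- x)) * indicator {c<..} x)"
proof (rule integrableI_nonneg)
  have "((\<lambda>x::real. - 4 * exp (- x / 2) - 2 * exp (- x)) \<longlongrightarrow> 0) at_top"
    by real_asymp
  then have "(\<integral>\<^sup>+ x. ennreal (2 * (exp (- x / 2) + exp (- x))) * indicator {c..} x \<partial>lborel) =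
      ennreal (0 - (- 4 * exp (- c / 2) - 2 * exp (- c)))"
    by (intro nn_integral_FTC_atLeast) (auto intro!: derivative_eq_intros simp: add_nonneg_nonneg)
  moreover have "(\<integral>\<^sup>+ x. ennreal (2 * (exp (- x / 2) + exp (- x)) * indicator {c<..} x) \<partial>lborel) =
      (\<integral>\<^sup>+ x. ennreal (2 * (exp (- x / 2) + exp (- x))) * indicator {c<..} x \<partial>lborel)"
    by (intro nn_integral_cong) (auto split: split_indicator)
  ultimately show "(\<integral>\<^sup>+ x. ennreal (2 * (exp (- x / 2) + exp (- x)) * indicator {c<..} x) \<partial>lborel) < \<infinity>"
    unfolding nn_integral_Ioi_eq_Ici by simp
qed (auto simp: add_nonneg_nonneg)

lemma partial_le_marginal:
  assumes n: "1 \<le> n" and u: "0 < u"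
  shows "part n u v \<le> gamma_density 2 a u"
proof -
  have "ennreal (part n u v) \<le> ennreal (gamma_density 2 a u)"
    using r[OF n] m u
    by (subst chi2_pair_partial_eq_nn_integral, simp_all, subst chi2_pair_density_marginal[symmetric, where r="r n"])
       (auto intro!: nn_integral_mono split: split_indicator)
  then show ?thesis
    using gamma_density_nonneg[of a 2 u] a by (simp add: ennreal_le_iff)
qed

text \<open>Dominated convergence in the splitting of \<open>joint_survival_eq\<close>. Both integrands are bounded by the normalised
marginal density, hence by the integrable function of \<open>marginal_bound\<close>.\<close>
lemma survival_lim:
  fixes S :: "nat \<Rightarrow> real"
  assumes S: "\<And>n. 1 \<le> n \<Longrightarrow> 0 < t n x \<Longrightarrow> 0 < t n y \<Longrightarrow> ennreal (S n) =
      (\<integral>\<^sup>+ s. ennreal (gamma_density 2 a s) * indicator {t n x<..} s \<partial>lborel) +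
      (\<integral>\<^sup>+ s. ennreal (part n s (t n x)) * indicator {t n y<..} s \<partial>lborel)"
    and S0: "\<And>n. 0 \<le> S n"
  shows "(\<lambda>n. real n * S n) \<longlonglongrightarrow> HR_partial l x y + HR_partial l y x"
proof -
  \<comment> \<open>The integrands are set to zero for the finitely many \<open>n\<close> outside \<open>good\<close>, so that the domination holds for every \<open>n\<close>.\<close>
  define good where "good n \<longleftrightarrow> 1 \<le> n \<and> 0 < t n x \<and> 0 < t n y \<and>
      (\<forall>x. 2 * real n * gamma_density 2 a (t n x) \<le> 2 * (exp (- x / 2) + exp (- x)))" for n
  have ev: "eventually good sequentially"
    using eventually_ge_at_top[of 1] t_pos[of x] t_pos[of y] marginal_bound
    by eventually_elim (simp add: good_def)
  define p where "p n x' = (if good n then 2 * real n * gamma_density 2 a (t n x') * indicator {x<..} x' else 0)" for n x'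
  define q where "q n y' = (if good n then 2 * real n * part n (t n y') (t n x) * indicator {y<..} y' else 0)" for n y'
  have [measurable]: "p n \<in> borel_measurable borel" for n
    unfolding p_def[abs_def] by measurable
  have part_meas: "(\<lambda>u. part n u v) \<in> borel_measurable borel" if "1 \<le> n" for n v
    using r[OF that] m by (intro borel_measurable_continuous_onI continuous_on_chi2_pair_partial) auto
  have [measurable]: "q n \<in> borel_measurable borel" for n
  proof (cases "good n")
    case True
    then have "1 \<le> n" by (simp add: good_def)
    note part_meas[OF this, measurable]
    show ?thesis unfolding q_def[abs_def] by measurable
  qed (simp add: q_def[abs_def])
  have g0: "0 \<le> gamma_density 2 a u" for u using a by (intro gamma_density_nonneg) simp
  have p0: "0 \<le> p n x'" for n x' using g0 by (simp add: p_def)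
  have ty: "0 < t n y'" if "good n" "y < y'" for n y'
    using that t_le_iff(2)[of n y y'] by (auto simp: good_def)
  have q0: "0 \<le> q n y'" for n y'
    using r[of n] m ty[of n y'] by (auto simp: q_def good_def less_imp_le intro!: mult_nonneg_nonneg chi2_pair_partial_nonneg split: split_indicator)
  have p_le: "p n x' \<le> 2 * (exp (- x' / 2) + exp (- x')) * indicator {x<..} x'" for n x'
    by (auto simp: p_def good_def add_nonneg_nonneg split: split_indicator)
  have q_le: "q n y' \<le> 2 * (exp (- y' / 2) + exp (- y')) * indicator {y<..} y'" for n y'
  proof (cases "good n \<and> y < y'")
    case True
    then have n: "1 \<le> n" by (simp add: good_def)
    have "2 * real n * part n (t n y') (t n x) \<le> 2 * real n * gamma_density 2 a (t n y')"
      using partial_le_marginal[OF n ty] True by (intro mult_left_mono) auto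
    also have "\<dots> \<le> 2 * (exp (- y' / 2) + exp (- y'))" using True by (simp add: good_def)
    finally show ?thesis using True by (simp add: q_def)
  qed (auto simp: q_def add_nonneg_nonneg)
  have p_lim: "(\<lambda>n. p n x') \<longlonglongrightarrow> exp (- x') * indicator {x<..} x'" for x'
    by (rule Lim_transform_eventually[OF tendsto_mult[OF marginal_lim tendsto_const]])
       (use ev in eventually_elim, simp add: p_def)
  have q_lim: "(\<lambda>n. q n y') \<longlonglongrightarrow> HR_partial l y' x * indicator {y<..} y'" for y'
    by (rule Lim_transform_eventually[OF tendsto_mult[OF partial_lim tendsto_const]])
       (use ev in eventually_elim, simp add: q_def)
  have [measurable]: "(\<lambda>y'. HR_partial l y' x) \<in> borel_measurable borel"
    unfolding HR_partial_def by measurable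
  have P: "(\<lambda>n. integral\<^sup>L lborel (p n)) \<longlonglongrightarrow> (\<integral>x'. exp (- x') * indicator {x<..} x' \<partial>lborel)"
    by (rule integral_dominated_convergence[OF _ _ integrable_exp_tail[of x]])
       (use p0 p_le p_lim in auto)
  have q': "(\<lambda>n. integral\<^sup>L lborel (q n)) \<longlonglongrightarrow> (\<integral>y'. HR_partial l y' x * indicator {y<..} y' \<partial>lborel)"
    by (rule integral_dominated_convergence[OF _ _ integrable_exp_tail[of y]])
       (use q0 q_le q_lim in auto)
  have val1: "(\<integral>x'. exp (- x') * indicator {x<..} x' \<partial>lborel) = exp (- x)"
  proof -
    have "((\<lambda>x::real. - exp (- x)) \<longlongrightarrow> 0) at_top" by real_asymp
    then have "(\<integral>\<^sup>+ x'. ennreal (exp (- x')) * indicator {x..} x' \<partial>lborel) = ennreal (0 - (- exp (- x)))"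
      by (intro nn_integral_FTC_atLeast) (auto intro!: derivative_eq_intros)
    moreover have "(\<integral>\<^sup>+ x'. ennreal (exp (- x') * indicator {x<..} x') \<partial>lborel) = (\<integral>\<^sup>+ x'. ennreal (exp (- x')) * indicator {x<..} x' \<partial>lborel)"
      by (intro nn_integral_cong) (auto split: split_indicator)
    ultimately show ?thesis
      unfolding nn_integral_Ioi_eq_Ici by (subst integral_eq_nn_integral) auto
  qed
  have val2: "(\<integral>y'. HR_partial l y' x * indicator {y<..} y' \<partial>lborel) = HR_partial l x y + HR_partial l y x - exp (- x)"
  proof -
    have "(\<integral>\<^sup>+ y'. ennreal (HR_partial l y' x * indicator {y<..} y') \<partial>lborel) = (\<integral>\<^sup>+ y'. ennreal (HR_partial l y' x) * indicator {y<..} y' \<partial>lborel)"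
      by (intro nn_integral_cong) (auto split: split_indicator)
    also have "\<dots> = ennreal (HR_partial l x y + HR_partial l y x - exp (- x))"
      unfolding nn_integral_Ioi_eq_Ici by (rule nn_integral_HR_partial_Ici[OF l])
    finally have nn: "(\<integral>\<^sup>+ y'. ennreal (HR_partial l y' x * indicator {y<..} y') \<partial>lborel) = \<dots>" .
    have "0 \<le> HR_partial l x y + HR_partial l y x - exp (- x)"
      using HR_exponent_ge_exp[OF l] by simp
    then show ?thesis
      using HR_partial_nonneg by (subst integral_eq_nn_integral) (auto simp: nn)
  qed
  have "(\<lambda>n. integral\<^sup>L lborel (p n) + integral\<^sup>L lborel (q n)) \<longlonglongrightarrow> exp (- x) + (HR_partial l x y + HR_partial l y x - exp (- x))"
    using tendsto_add[OF P q'] unfolding val1 val2 .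
  moreover have "eventually (\<lambda>n. integral\<^sup>L lborel (p n) + integral\<^sup>L lborel (q n) = real n * S n) sequentially"
    using ev
  proof eventually_elim
    case (elim n)
    then have n: "1 \<le> n" "0 < t n x" "0 < t n y" by (auto simp: good_def)
    note part_meas[OF n(1), measurable]
    have ip: "integrable lborel (p n)"
      by (rule Bochner_Integration.integrable_bound[OF integrable_exp_tail[of x]])
         (use p0 p_le in \<open>auto simp: add_nonneg_nonneg\<close>)
    have iq: "integrable lborel (q n)"
      by (rule Bochner_Integration.integrable_bound[OF integrable_exp_tail[of y]])
         (use q0 q_le in \<open>auto simp: add_nonneg_nonneg\<close>)
    have "ennreal (real n * S n) = ennreal (real n) * (\<integral>\<^sup>+ s. ennreal (gamma_density 2 a s) * indicator {t n x<..} s \<partial>lborel) +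
      ennreal (real n) * (\<integral>\<^sup>+ s. ennreal (part n s (t n x)) * indicator {t n y<..} s \<partial>lborel)"
      by (simp add: ennreal_mult' S[OF n] distrib_left)
    also have "ennreal (real n) * (\<integral>\<^sup>+ s. ennreal (gamma_density 2 a s) * indicator {t n x<..} s \<partial>lborel) =
        (\<integral>\<^sup>+ x'. ennreal (2 * real n) * (ennreal (gamma_density 2 a (t n x')) * indicator {t n x<..} (t n x')) \<partial>lborel)"
      by (rule nn_integral_norm_t) measurable
    also have "\<dots> = (\<integral>\<^sup>+ x'. ennreal (p n x') \<partial>lborel)"
      using elim g0 by (intro nn_integral_cong) (auto simp: p_def t_le_iff ennreal_mult split: split_indicator)
    also have "\<dots> = ennreal (integral\<^sup>L lborel (p n))"
      using ip p0 by (simp add: nn_integral_eq_integral)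
    also have "ennreal (real n) * (\<integral>\<^sup>+ s. ennreal (part n s (t n x)) * indicator {t n y<..} s \<partial>lborel) =
        (\<integral>\<^sup>+ y'. ennreal (2 * real n) * (ennreal (part n (t n y') (t n x)) * indicator {t n y<..} (t n y')) \<partial>lborel)"
      by (rule nn_integral_norm_t) measurable
    also have "\<dots> = (\<integral>\<^sup>+ y'. ennreal (q n y') \<partial>lborel)"
      using elim by (intro nn_integral_cong) (auto simp: q_def t_le_iff ennreal_mult' split: split_indicator)
    also have "\<dots> = ennreal (integral\<^sup>L lborel (q n))"
      using iq q0 by (simp add: nn_integral_eq_integral)
    finally have "ennreal (real n * S n) = ennreal (integral\<^sup>L lborel (p n) + integral\<^sup>L lborel (q n))"
      using p0 q0 by (simp add: ennreal_plus)
    then show ?case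
      using S0[of n] p0 q0 by (subst (asm) ennreal_inj) auto
  qed
  ultimately show ?thesis using Lim_transform_eventually by fastforce
qed

end

section \<open>Convergence to the Huesler-Reiss density\<close>

theorem proposition4p3:
  fixes m :: nat
    and M :: "nat \<Rightarrow> 'a measure"
    and X1 X2 :: "nat \<Rightarrow> nat \<Rightarrow> 'a \<Rightarrow> real"
    and \<zeta>1 \<zeta>2 :: "nat \<Rightarrow> 'a \<Rightarrow> real"
    and \<rho> :: "nat \<Rightarrow> real"
    and l :: real
    and H hhat :: "nat \<Rightarrow> real \<Rightarrow> real \<Rightarrow> real"
  assumes m: "m \<ge> 2"
    and prob: "\<And>n. n \<ge> 1 \<Longrightarrow> prob_space (M n)"
    and rho: "\<And>n. n \<ge> 1 \<Longrightarrow> \<rho> n \<in> {-1<..<1} - {0}"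
    and indep: "\<And>n. n \<ge> 1 \<Longrightarrow>
          prob_space.indep_vars (M n) (\<lambda>_. borel \<Otimes>\<^sub>M borel) (\<lambda>i \<omega>. (X1 n i \<omega>, X2 n i \<omega>)) {1..m}"
    and gauss: "\<And>n i. n \<ge> 1 \<Longrightarrow> i \<in> {1..m} \<Longrightarrow> bivariate_gaussian (M n) (X1 n i) (X2 n i)"
    and marg1: "\<And>n i. n \<ge> 1 \<Longrightarrow> i \<in> {1..m} \<Longrightarrow>
          distributed (M n) lborel (X1 n i) (\<lambda>x. ennreal (std_normal_density x))"
    and marg2: "\<And>n i. n \<ge> 1 \<Longrightarrow> i \<in> {1..m} \<Longrightarrow>
          distributed (M n) lborel (X2 n i) (\<lambda>x. ennreal (std_normal_density x))"
    and corr: "\<And>n i. n \<ge> 1 \<Longrightarrow> i \<in> {1..m} \<Longrightarrow> correlation (M n) (X1 n i) (X2 n i) = \<rho> n"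
    and zeta1: "\<And>n \<omega>. n \<ge> 1 \<Longrightarrow> \<zeta>1 n \<omega> = (\<Sum>i=1..m. (X1 n i \<omega>)\<^sup>2)"
    and zeta2: "\<And>n \<omega>. n \<ge> 1 \<Longrightarrow> \<zeta>2 n \<omega> = (\<Sum>i=1..m. (X2 n i \<omega>)\<^sup>2)"
    and H: "\<And>n x y. n \<ge> 1 \<Longrightarrow> H n x y = joint_cdf (M n) (\<zeta>1 n) (\<zeta>2 n) x y"
    and l_pos: "0 < l"
    and lim: "(\<lambda>n. 2 * (norm_b m n / norm_a n) * (1 - (\<rho> n)\<^sup>2)) \<longlonglongrightarrow> l"
    (* norm_b m n involves ln (ln n), so n = 1 is left out here *)
    and hhat_pdf: "\<And>n. n \<ge> 2 \<Longrightarrow>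
          is_pdf_of (hhat n) (\<lambda>x y. H n (norm_t m n x) (norm_t m n y) ^ n)"
    (* a density is determined only almost everywhere; the pointwise claim concerns the version
       that is continuous in the interior of the support *)
    and hhat_cont: "\<And>n. n \<ge> 2 \<Longrightarrow>
          continuous_on {(x, y). 0 < norm_t m n x \<and> 0 < norm_t m n y} (\<lambda>(x, y). hhat n x y)"
  shows "\<forall>x y. (\<lambda>n. hhat n x y) \<longlonglongrightarrow> HR_pdf l x y"
proof (intro allI)
  fix x y :: real
  define r where "r n = (\<rho> n)\<^sup>2" for n
  have r: "0 < r n \<and> r n < 1" if "1 \<le> n" for n
    using rho[OF that] by (auto simp: r_def abs_square_less_1)
  interpret husler_reiss_regime m l r
  proof
    show "(\<lambda>n. norm_b m n * (1 - r n)) \<longlonglongrightarrow> l" using lim by (simp add: r_def norm_a_def)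
  qed (use m l_pos r in auto)
  let ?t = "norm_t m"
  have meas: "X1 n i \<in> borel_measurable (M n)" "X2 n i \<in> borel_measurable (M n)" if "1 \<le> n" "i \<in> {1..m}" for n i
    using gauss[OF that] by (auto simp: bivariate_gaussian_def)
  have \<zeta>: "\<zeta>1 n = (\<lambda>\<omega>. \<Sum>i=1..m. (X1 n i \<omega>)\<^sup>2)" "\<zeta>2 n = (\<lambda>\<omega>. \<Sum>i=1..m. (X2 n i \<omega>)\<^sup>2)" if "1 \<le> n" for n
    using zeta1[OF that] zeta2[OF that] by auto
  have \<zeta>_meas: "\<zeta>1 n \<in> borel_measurable (M n)" "\<zeta>2 n \<in> borel_measurable (M n)" if "1 \<le> n" for n
    unfolding \<zeta>[OF that] using meas[OF that] by (auto intro!: borel_measurable_sum borel_measurable_power)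
  have law: "(\<integral>\<^sup>+ \<omega>. f (\<zeta>1 n \<omega>, \<zeta>2 n \<omega>) \<partial>M n) = gamma_mixture (real m / 2) (r n) f"
    if n: "1 \<le> n" and f: "f \<in> borel_measurable (borel \<Otimes>\<^sub>M borel)" for n and f :: "real \<times> real \<Rightarrow> ennreal"
    unfolding \<zeta>[OF n] r_def
    using prob_space.sum_of_squares_law[OF prob[OF n], of "{1..m}" "X1 n" "X2 n" "\<rho> n" f]
      indep[OF n] gauss[OF n] marg1[OF n] marg2[OF n] corr[OF n] f r[OF n] m
    by (simp add: r_def)
  define G where "G n u v = chi2_pair_cdf m (r n) u v" for n u v
  have HG: "H n u v = G n u v" if n: "1 \<le> n" for n u v
    unfolding H[OF n] G_def using r[OF n] m
    by (intro joint_cdf_eq_chi2_pair_cdf prob \<zeta>_meas law n) auto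
  have G01: "0 \<le> G n u v" "G n u v \<le> 1" if "1 \<le> n" for n u v
    unfolding HG[OF that, symmetric] H[OF that] joint_cdf_def
    using prob_space.prob_le_1[OF prob[OF that]] by auto
  define A where "A n u v = chi2_pair_partial m (r n) u v" for n u v
  define g where "g n u v = chi2_pair_density m (r n) u v" for n u v
  have explicit: "hhat n x y = G n (?t n x) (?t n y) ^ (n - 1) * (4 * real n * g n (?t n x) (?t n y)) +
      real (n - 1) / real n * (G n (?t n x) (?t n y) ^ (n - 2) *
        ((2 * real n * A n (?t n x) (?t n y)) * (2 * real n * A n (?t n y) (?t n x))))"
    if n: "2 \<le> n" and pos: "0 < ?t n x" "0 < ?t n y" for n
  proof -
    have n1: "1 \<le> n" using n by simp
    note rn = r[OF n1]
    define c where "c = - norm_b m n / 2"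
    have c: "c < x \<longleftrightarrow> 0 < ?t n x" for x by (auto simp: c_def t_eq)
    have dt: "(?t n has_real_derivative 2) (at x)" for x
      unfolding t_eq[abs_def] by (auto intro!: derivative_eq_intros)
    have G1: "((\<lambda>x. G n (?t n x) (?t n y)) has_real_derivative A n (?t n x) (?t n y) * 2) (at x)" if "c < x" for x y
      unfolding G_def A_def using that c rn m by (intro DERIV_chain2[OF DERIV_chi2_pair_cdf dt]) auto
    have G2: "((\<lambda>y. G n (?t n x) (?t n y)) has_real_derivative A n (?t n y) (?t n x) * 2) (at y)" if "c < y" for x y
    proof -
      have "G n u v = G n v u" for u v
        unfolding G_def using rn m by (intro chi2_pair_cdf_commute) auto
      then show ?thesis using G1[OF that, of x] by simp
    qed
    have A2: "((\<lambda>y. A n (?t n x) (?t n y)) has_real_derivative g n (?t n x) (?t n y) * 2) (at y)" if "c < y" for x y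
      unfolding A_def g_def using that c rn m by (intro DERIV_chain2[OF DERIV_chi2_pair_partial dt]) auto
    define P where "P x y = real n * G n (?t n x) (?t n y) ^ (n - 1) * (A n (?t n x) (?t n y) * 2)" for x y
    define D where "D x y = real n * (real (n - 1) * G n (?t n x) (?t n y) ^ (n - 2) * (A n (?t n y) (?t n x) * 2)) * (A n (?t n x) (?t n y) * 2)
        + real n * G n (?t n x) (?t n y) ^ (n - 1) * (g n (?t n x) (?t n y) * 2 * 2)" for x y
    have "hhat n x y = D x y"
    proof (rule continuous_pdf_eq_mixed_derivative[OF hhat_pdf[OF n], of c])
      show "continuous_on {(x, y). c < x \<and> c < y} (\<lambda>(x, y). hhat n x y)"
        using hhat_cont[OF n] by (simp add: c)
      show "((\<lambda>x. H n (?t n x) (?t n y) ^ n) has_real_derivative P x y) (at x)" if "c < x" "c < y" for x y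
        unfolding HG[OF n1] by (rule DERIV_cong[OF DERIV_power[OF G1[OF that(1)]]]) (simp add: P_def)
      show "((\<lambda>y. P x y) has_real_derivative D x y) (at y)" if "c < x" "c < y" for x y
        unfolding P_def
        by (rule DERIV_cong[OF DERIV_mult[OF DERIV_cmult[OF DERIV_power[OF G2[OF that(2)]]] DERIV_cmult_right[OF A2[OF that(2)]]]])
           (simp add: D_def numeral_2_eq_2)
    qed (use c pos in auto)
    also have "D x y = G n (?t n x) (?t n y) ^ (n - 1) * (4 * real n * g n (?t n x) (?t n y)) +
      real (n - 1) / real n * (G n (?t n x) (?t n y) ^ (n - 2) *
        ((2 * real n * A n (?t n x) (?t n y)) * (2 * real n * A n (?t n y) (?t n x))))"
    proof -
      have "N * (N' * E2 * (B * 2)) * (C * 2) + N * E1 * (h * 2 * 2) =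
          E1 * (4 * N * h) + N' / N * (E2 * ((2 * N * C) * (2 * N * B)))" if "N \<noteq> 0" for N N' E1 E2 B C h :: real
        using that by (simp add: field_simps)
      then show ?thesis using n unfolding D_def by simp
    qed
    finally show ?thesis .
  qed
  \<comment> \<open>The value at \<open>n = 0\<close>, where no distribution is given, only has to lie in the unit interval.\<close>
  define p where "p n = (if 1 \<le> n then G n (?t n x) (?t n y) else 1)" for n
  define V where "V = HR_partial l x y + HR_partial l y x"
  have p: "0 \<le> p n" "p n \<le> 1" for n using G01 by (auto simp: p_def)
  have V: "(\<lambda>n. real n * (1 - p n)) \<longlonglongrightarrow> V"
    unfolding V_def
  proof (rule survival_lim)
    fix n assume n: "1 \<le> n" "0 < ?t n x" "0 < ?t n y"
    have "1 - p n = 1 - joint_cdf (M n) (\<zeta>1 n) (\<zeta>2 n) (?t n x) (?t n y)"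
      using n HG[OF n(1)] H[OF n(1)] by (simp add: p_def)
    then show "ennreal (1 - p n) =
      (\<integral>\<^sup>+ s. ennreal (gamma_density 2 (real m / 2) s) * indicator {?t n x<..} s \<partial>lborel) +
      (\<integral>\<^sup>+ s. ennreal (chi2_pair_partial m (r n) s (?t n x)) * indicator {?t n y<..} s \<partial>lborel)"
      using joint_survival_eq[OF prob[OF n(1)] m _ _ \<zeta>_meas[OF n(1)] law[OF n(1)], of "?t n x" "?t n y"] n r[OF n(1)]
      by simp
  qed (use p in auto)
  have pn: "(\<lambda>n. p n ^ n) \<longlonglongrightarrow> HR_cdf l x y"
    using power_one_minus_tendsto_exp[OF p V] by (simp add: HR_cdf_eq V_def)
  have p1: "p \<longlonglongrightarrow> 1"
  proof -
    \<comment> \<open>Convergence of \<open>n (1 - p n)\<close> forces \<open>p n \<longlonglongrightarrow> 1\<close>, so that \<open>G^(n-1)\<close> and \<open>G^(n-2)\<close> share the limit of \<open>G^n\<close>.\<close>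
    have "(\<lambda>n. 1 - real n * (1 - p n) / real n) \<longlonglongrightarrow> 1 - 0"
      by (intro tendsto_diff tendsto_const tendsto_divide_0[OF V] filterlim_at_top_imp_at_infinity filterlim_real_sequentially)
    moreover have "eventually (\<lambda>n. 1 - real n * (1 - p n) / real n = p n) sequentially"
      using eventually_ge_at_top[of 1] by eventually_elim simp
    ultimately show ?thesis using Lim_transform_eventually by fastforce
  qed
  let ?E = "\<lambda>n. p n ^ n / p n * (4 * real n * g n (?t n x) (?t n y)) +
      (1 - 1 / real n) * (p n ^ n / p n / p n * ((2 * real n * A n (?t n x) (?t n y)) * (2 * real n * A n (?t n y) (?t n x))))"
  have "?E \<longlonglongrightarrow> HR_cdf l x y / 1 * HR_density l x y + (1 - 0) * (HR_cdf l x y / 1 / 1 * (HR_partial l x y * HR_partial l y x))"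
    unfolding g_def A_def by (intro tendsto_intros pn p1 density_lim partial_lim lim_1_over_n) auto
  also have "HR_cdf l x y / 1 * HR_density l x y + (1 - 0) * (HR_cdf l x y / 1 / 1 * (HR_partial l x y * HR_partial l y x)) = HR_pdf l x y"
    by (simp add: HR_pdf_eq algebra_simps)
  finally have "?E \<longlonglongrightarrow> HR_pdf l x y" .
  moreover have "eventually (\<lambda>n. ?E n
     = hhat n x y) sequentially"
    using eventually_ge_at_top[of 2] t_pos[of x] t_pos[of y] order_tendstoD(1)[OF p1 zero_less_one]
  proof eventually_elim
    case (elim n)
    obtain k where k: "n = Suc (Suc k)" using elim(1) by (metis add_2_eq_Suc le_Suc_ex)
    have "p n ^ n / p n = p n ^ (n - 1)" "p n ^ n / p n / p n = p n ^ (n - 2)"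
      using elim(4) by (simp_all add: k)
    moreover have "1 - 1 / real n = real (n - 1) / real n" by (simp add: k field_simps)
    moreover have "p n = G n (?t n x) (?t n y)" by (simp add: p_def k)
    ultimately show ?case using explicit[OF elim(1-3)] by simp
  qed
  ultimately show "(\<lambda>n. hhat n x y) \<longlonglongrightarrow> HR_pdf l x y"
    by (rule Lim_transform_eventually)
qed

end
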